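(* Let $\mathbf{T}=(T_1,\dots,T_m)\in\mathcal{B}_1^m(\mathbb{B}_m)$ be a commuting tuple of bounded operators on $\mathcal{H}$, and consider the operator tuple $\mathbf{M}_z^*=(M_{z_1}^*,\dots,M_{z_m}^* )$ on the weighted Bergman space $\mathcal{H}_k$, where $k>m+1$ is an integer. Suppose that $(I-\sum_{i=1}^m T_i^*T_i)^k\ge 0$ and that $\lim_j f_j(\mathbf{T}^*,\mathbf{T})h=0$ for all $h\in\mathcal{H}$, where $f_j(z,w)=\sum_{i=j}^\infty \mathbf{e}_i(z)(1-\langle z,w\rangle)^k\,\mathbf{e}_i(w)^*$ for an orthonormal basis $\{\mathbf{e}_i\}_{i=0}^\infty$ of $\mathcal{H}_k$. If there exist a non-vanishing holomorphic section $t$ of $\mathcal{E}_{\mathbf{T}}$ and a unit vector $\zeta_0\in\overline{\operatorname{ran}\mathcal{D}_{\mathbf{T}}}$ such that $$\sup_{w\in\mathbb{B}_m}\frac{\|\mathcal{D}_{\mathbf{T}}t(w)\|^2}{|\langle\mathcal{D}_{\mathbf{T}}t(w),\zeta_0\rangle|^2}<\infty,$$ then $\mathbf{T}\sim_s\mathbf{M}_z^*$.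
   Context: $\mathbb{B}_m$ is the open unit ball of $\mathbb{C}^m$; $\mathcal{H}$ is a complex separable Hilbert space. For a commuting tuple $\mathbf{T}=(T_1,\dots,T_m)\in\mathcal{L}(\mathcal{H})^m$ let $\mathscr{D}_{\mathbf{T}}h=(T_1h,\dots,T_mh)\in\mathcal{H}\oplus\cdots\oplus\mathcal{H}$ and $\mathbf{T}-w=(T_1-w_1,\dots,T_m-w_m)$, so $\ker\mathscr{D}_{\mathbf{T}-w}=\bigcap_i\ker(T_i-w_i)$, also written $\ker(\mathbf{T}-w)$. For a bounded domain $\Omega\subset\mathbb{C}^m$, the Cowen-Douglas class $\mathcal{B}_n^m(\Omega)$ consists of commuting $m$-tuples with (1) $\operatorname{ran}\mathscr{D}_{\mathbf{T}-w}$ closed for all $w\in\Omega$; (2) $\dim\ker\mathscr{D}_{\mathbf{T}-w}=n$ for all $w\in\Omega$; (3) the linear span of $\bigcup_{w\in\Omega}\ker\mathscr{D}_{\mathbf{T}-w}$ dense in $\mathcal{H}$. $\mathcal{E}_{\mathbf{T}}$ is the rank $n$ holomorphic eigenvector bundle over $\Omega$ with fibre $\ker(\mathbf{T}-w)$ at $w$, with the Hermitian metric inherited from $\mathcal{H}$. $\mathcal{H}_k$ is the Hilbert space of holomorphic functions on $\mathbb{B}_m$ with reproducing kernel $K(z,w)=(1-\langle z,w\rangle)^{-k}$ (for $k>m+1$ a weighted Bergman space), and $M_{z_i}$ is multiplication by the coordinate function $z_i$. Write $\mathbf{T}^\alpha=T_1^{\alpha_1}\cdots T_m^{\alpha_m}$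 and $\mathbf{T}^{*\alpha}=(T_1^* )^{\alpha_1}\cdots(T_m^* )^{\alpha_m}$. Expressions in $(\mathbf{T}^*,\mathbf{T})$ use the hereditary calculus: the monomial $z^I\overline{w}^J$ is replaced by $\mathbf{T}^{*I}\mathbf{T}^J$. Thus $(I-\sum_i T_i^*T_i)^k$ means $\frac1K(\mathbf{T}^*,\mathbf{T})=\sum_{|\alpha|\le k}(-1)^{|\alpha|}\frac{k!}{\alpha!(k-|\alpha|)!}\mathbf{T}^{*\alpha}\mathbf{T}^\alpha$, and the defect operator is $\mathcal{D}_{\mathbf{T}}=\left(\frac1K(\mathbf{T}^*,\mathbf{T})\right)^{1/2}$. The basis $\{\mathbf{e}_i\}$ consists of polynomials, so that $\mathbf{e}_i(\mathbf{T}^* )$ is defined, and $\mathbf{e}_i(w)^*$ is the complex conjugate of $\mathbf{e}_i(w)$. Since $\sum_{i\ge0}\mathbf{e}_i(z)\frac1K(z,w)\mathbf{e}_i(w)^*=1$, one has $f_j=1-\sum_{i<j}\mathbf{e}_i(z)\frac1K(z,w)\mathbf{e}_i(w)^*$, and $f_j(\mathbf{T}^*,\mathbf{T})=I-\sum_{i<j}\mathbf{e}_i(\mathbf{T}^* )\,\frac1K(\mathbf{T}^*,\mathbf{T})\,\mathbf{e}_i(\mathbf{T}^* )^*$. $\mathbf{T}\sim_s\mathbf{S}$ (similar) means there is a bounded invertible operator $X$ between the underlying Hilbert spaces with $XT_i=S_iX$ for all $i$. *)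

theory Defs
  imports "HOL-Analysis.Analysis" "HOL-Library.Poly_Mapping"
begin

section \<open>Complex Hilbert spaces\<close>

text \<open>
  Complex Hilbert spaces are built on top of the real inner product spaces of the library, the
  real inner product being the real part of the complex one; so norm, topology and completeness
  are those of the library. The complex inner product is linear in its \<^emph>\<open>first\<close> argument.
\<close>

class complex_vector = real_vector +
  fixes scaleC :: "complex \<Rightarrow> 'a \<Rightarrow> 'a"  (infixr \<open>*\<^sub>C\<close> 75)
  assumes scaleC_add_right: "a *\<^sub>C (x + y) = a *\<^sub>C x + a *\<^sub>C y"
    and scaleC_add_left: "(a + b) *\<^sub>C x = a *\<^sub>C x + b *\<^sub>C x"
    and scaleC_scaleC: "a *\<^sub>C b *\<^sub>C x = (a * b) *\<^sub>C x"
    and scaleC_one: "1 *\<^sub>C x = x"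
    and scaleR_scaleC: "r *\<^sub>R x = complex_of_real r *\<^sub>C x"

class complex_inner = complex_vector + real_inner +
  fixes cinner :: "'a \<Rightarrow> 'a \<Rightarrow> complex"
  assumes cinner_commute: "cinner x y = cnj (cinner y x)"
    and cinner_add_left: "cinner (x + y) z = cinner x z + cinner y z"
    and cinner_scaleC_left: "cinner (a *\<^sub>C x) y = a * cinner x y"
    and inner_eq_Re_cinner: "inner x y = Re (cinner x y)"

class complex_hilbert = complex_inner + complete_space

global_interpretation complex_vector: vector_space "scaleC :: complex \<Rightarrow> 'a \<Rightarrow> 'a::complex_vector"
  by unfold_locales (simp_all add: scaleC_add_right scaleC_add_left scaleC_scaleC scaleC_one)

instantiation complex :: complex_hilbert
begin

definition scaleC_complex :: "complex \<Rightarrow> complex \<Rightarrow> complex"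
  where "scaleC_complex a x = a * x"

definition cinner_complex :: "complex \<Rightarrow> complex \<Rightarrow> complex"
  where "cinner_complex x y = x * cnj y"

instance
  by standard (simp_all add: scaleC_complex_def cinner_complex_def algebra_simps
      scaleR_conv_of_real inner_complex_def)

end

text \<open>
  For \<open>complex ^ 'm\<close> this is the usual inner product; the direct sum of copies of a
  Hilbert space \<open>'h\<close> is \<open>'h ^ 'm\<close>.
\<close>

instantiation vec :: (complex_vector, finite) complex_vector
begin

definition scaleC_vec :: "complex \<Rightarrow> 'a ^ 'b \<Rightarrow> 'a ^ 'b"
  where "scaleC_vec a x = (\<chi> i. a *\<^sub>C (x $ i))"

instance
proof
  fix a b :: complex and r :: real and x y :: "'a ^ 'b"
  show "a *\<^sub>C (x + y) = a *\<^sub>C x + a *\<^sub>C y"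
    by (simp add: scaleC_vec_def vec_eq_iff scaleC_add_right)
  show "(a + b) *\<^sub>C x = a *\<^sub>C x + b *\<^sub>C x"
    by (simp add: scaleC_vec_def vec_eq_iff scaleC_add_left)
  show "a *\<^sub>C b *\<^sub>C x = (a * b) *\<^sub>C x"
    by (simp add: scaleC_vec_def vec_eq_iff scaleC_scaleC)
  show "1 *\<^sub>C x = x"
    by (simp add: scaleC_vec_def vec_eq_iff scaleC_one)
  show "r *\<^sub>R x = complex_of_real r *\<^sub>C x"
    unfolding scaleC_vec_def vec_eq_iff by (simp add: scaleR_scaleC)
qed

end

instantiation vec :: (complex_inner, finite) complex_inner
begin

definition cinner_vec :: "'a ^ 'b \<Rightarrow> 'a ^ 'b \<Rightarrow> complex"
  where "cinner_vec x y = (\<Sum>i\<in>UNIV. cinner (x $ i) (y $ i))"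

instance
proof
  fix x y z :: "'a ^ 'b" and a :: complex
  show "cinner x y = cnj (cinner y x)"
    unfolding cinner_vec_def cnj_sum by (rule sum.cong[OF refl]) (rule cinner_commute)
  show "cinner (x + y) z = cinner x z + cinner y z"
    by (simp add: cinner_vec_def cinner_add_left sum.distrib)
  show "cinner (a *\<^sub>C x) y = a * cinner x y"
    by (simp add: cinner_vec_def scaleC_vec_def cinner_scaleC_left sum_distrib_left)
  show "inner x y = Re (cinner x y)"
    by (simp add: cinner_vec_def inner_vec_def inner_eq_Re_cinner)
qed

end

instance vec :: (complex_hilbert, finite) complex_hilbert ..


section \<open>Operators\<close>

definition bounded_clinear :: "('a::complex_inner \<Rightarrow> 'b::complex_inner) \<Rightarrow> bool"
  where "bounded_clinear A \<longleftrightarrow> bounded_linear A \<and> (\<forall>c x. A (c *\<^sub>C x) = c *\<^sub>C A x)"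

definition cadjoint :: "('a::complex_inner \<Rightarrow> 'b::complex_inner) \<Rightarrow> 'b \<Rightarrow> 'a"
  where "cadjoint A = (THE B. \<forall>x y. cinner (A x) y = cinner x (B y))"

definition positive_operator :: "('a::complex_inner \<Rightarrow> 'a) \<Rightarrow> bool"
  where "positive_operator A \<longleftrightarrow>
    bounded_clinear A \<and> (\<forall>x. cinner (A x) x \<in> \<real> \<and> 0 \<le> Re (cinner (A x) x))"

definition sqrt_operator :: "('a::complex_inner \<Rightarrow> 'a) \<Rightarrow> 'a \<Rightarrow> 'a"
  where "sqrt_operator A = (THE B. positive_operator B \<and> B \<circ> B = A)"

definition orthonormal_basis :: "(nat \<Rightarrow> 'a::complex_inner) \<Rightarrow> bool"
  where "orthonormal_basis e \<longleftrightarrow>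
    (\<forall>i j. cinner (e i) (e j) = (if i = j then 1 else 0)) \<and>
    closure (complex_vector.span (range e)) = UNIV"

definition similar_tuples ::
    "('m \<Rightarrow> 'a::complex_inner \<Rightarrow> 'a) \<Rightarrow> ('m \<Rightarrow> 'b::complex_inner \<Rightarrow> 'b) \<Rightarrow> bool"
  where "similar_tuples T S \<longleftrightarrow>
    (\<exists>X Y. bounded_clinear X \<and> bounded_clinear Y \<and> Y \<circ> X = id \<and> X \<circ> Y = id \<and>
      (\<forall>i. X \<circ> T i = S i \<circ> X))"


section \<open>Holomorphic maps and the Cowen--Douglas class\<close>

text \<open>Holomorphy in several variables: complex Fr\'echet differentiability.\<close>

definition holomorphic_map_on :: "('a::complex_inner \<Rightarrow> 'b::complex_inner) \<Rightarrow> 'a set \<Rightarrow> bool"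
  where "holomorphic_map_on f S \<longleftrightarrow>
    (\<forall>z\<in>S. \<exists>D. bounded_clinear D \<and> (f has_derivative D) (at z within S))"

definition tuple_operator :: "('m::finite \<Rightarrow> 'h \<Rightarrow> 'h) \<Rightarrow> 'h \<Rightarrow> 'h ^ 'm"
  where "tuple_operator T h = (\<chi> i. T i h)"

definition shifted_tuple ::
    "('m::finite \<Rightarrow> 'h \<Rightarrow> 'h) \<Rightarrow> complex ^ 'm \<Rightarrow> 'm \<Rightarrow> 'h \<Rightarrow> 'h::complex_vector"
  where "shifted_tuple T w i h = T i h - (w $ i) *\<^sub>C h"

definition joint_kernel ::
    "('m::finite \<Rightarrow> 'h \<Rightarrow> 'h) \<Rightarrow> complex ^ 'm \<Rightarrow> 'h::complex_vector set"
  where "joint_kernel T w = {h. tuple_operator (shifted_tuple T w) h = 0}"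

text \<open>
  The library's dimension of an infinite-dimensional space is 0, so finite-dimensionality of the
  joint kernels is required separately.
\<close>

definition cowen_douglas ::
    "nat \<Rightarrow> (complex ^ 'm) set \<Rightarrow> ('m::finite \<Rightarrow> 'h \<Rightarrow> 'h::complex_hilbert) \<Rightarrow> bool"
  where "cowen_douglas n \<Omega> T \<longleftrightarrow>
    (\<forall>i. bounded_clinear (T i)) \<and> (\<forall>i j. T i \<circ> T j = T j \<circ> T i) \<and>
    (\<forall>w\<in>\<Omega>. closed (range (tuple_operator (shifted_tuple T w)))) \<and>
    (\<forall>w\<in>\<Omega>. (\<exists>B. finite B \<and> joint_kernel T w \<subseteq> complex_vector.span B) \<and>
      complex_vector.dim (joint_kernel T w) = n) \<and>
    closure (complex_vector.span (\<Union>w\<in>\<Omega>. joint_kernel T w)) = UNIV"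

text \<open>
  Holomorphic sections of the eigenvector bundle, which is a holomorphic subbundle of the trivial
  bundle with fibre the Hilbert space.
\<close>

definition holomorphic_eigensection ::
    "(complex ^ 'm) set \<Rightarrow> ('m::finite \<Rightarrow> 'h \<Rightarrow> 'h::complex_hilbert) \<Rightarrow> (complex ^ 'm \<Rightarrow> 'h) \<Rightarrow> bool"
  where "holomorphic_eigensection \<Omega> T t \<longleftrightarrow>
    holomorphic_map_on t \<Omega> \<and> (\<forall>w\<in>\<Omega>. t w \<in> joint_kernel T w)"


section \<open>Reproducing kernel Hilbert spaces and multiplication operators\<close>

text \<open>
  A Hilbert space of functions on \<open>\<Omega>\<close> is a Hilbert space \<open>'b\<close> with a map \<open>ev\<close> sending an
  element to the function it is; \<open>ev\<close> is linear, and injective after restriction to \<open>\<Omega>\<close>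
  (values outside \<open>\<Omega>\<close> carry no meaning).
\<close>

definition function_hilbert_space :: "'x set \<Rightarrow> ('b::complex_hilbert \<Rightarrow> 'x \<Rightarrow> complex) \<Rightarrow> bool"
  where "function_hilbert_space \<Omega> ev \<longleftrightarrow>
    (\<forall>f g. \<forall>z\<in>\<Omega>. ev (f + g) z = ev f z + ev g z) \<and>
    (\<forall>c f. \<forall>z\<in>\<Omega>. ev (c *\<^sub>C f) z = c * ev f z) \<and>
    (\<forall>f g. (\<forall>z\<in>\<Omega>. ev f z = ev g z) \<longrightarrow> f = g)"

definition has_reproducing_kernel ::
    "'x set \<Rightarrow> ('b::complex_hilbert \<Rightarrow> 'x \<Rightarrow> complex) \<Rightarrow> ('x \<Rightarrow> 'x \<Rightarrow> complex) \<Rightarrow> bool"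
  where "has_reproducing_kernel \<Omega> ev K \<longleftrightarrow>
    (\<forall>w\<in>\<Omega>. \<exists>Kw. (\<forall>z\<in>\<Omega>. ev Kw z = K z w) \<and> (\<forall>f. ev f w = cinner f Kw))"

definition ball_kernel :: "nat \<Rightarrow> complex ^ 'm \<Rightarrow> complex ^ 'm::finite \<Rightarrow> complex"
  where "ball_kernel k z w = 1 / (1 - cinner z w) ^ k"

text \<open>The space with this kernel is determined up to unique unitary equivalence over \<open>ev\<close>.\<close>

definition is_ball_space :: "nat \<Rightarrow> ('b::complex_hilbert \<Rightarrow> complex ^ 'm::finite \<Rightarrow> complex) \<Rightarrow> bool"
  where "is_ball_space k ev \<longleftrightarrow>
    function_hilbert_space (ball 0 1) ev \<and>
    (\<forall>f. holomorphic_map_on (ev f) (ball 0 1)) \<and>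
    has_reproducing_kernel (ball 0 1) ev (ball_kernel k)"

definition coordinate_mult :: "('b \<Rightarrow> complex ^ 'm::finite \<Rightarrow> complex) \<Rightarrow> 'm \<Rightarrow> 'b \<Rightarrow> 'b"
  where "coordinate_mult ev i f = (THE g. \<forall>z\<in>ball 0 1. ev g z = z $ i * ev f z)"


section \<open>Hereditary calculus\<close>

text \<open>
  Multi-indices are functions \<open>'m \<Rightarrow> nat\<close>. The product of the powers is only meaningful for
  commuting tuples, where the order of the factors is irrelevant.
\<close>

definition tuple_power :: "('m::finite \<Rightarrow> 'h \<Rightarrow> 'h) \<Rightarrow> ('m \<Rightarrow> nat) \<Rightarrow> 'h \<Rightarrow> 'h"
  where "tuple_power T \<alpha> = Finite_Set.fold (\<lambda>i A. (T i ^^ \<alpha> i) \<circ> A) id UNIV"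

definition adjoint_tuple :: "('m \<Rightarrow> 'h::complex_inner \<Rightarrow> 'h) \<Rightarrow> 'm \<Rightarrow> 'h \<Rightarrow> 'h"
  where "adjoint_tuple T i = cadjoint (T i)"

lemma finite_bounded_multiindices: "finite {\<alpha> :: 'm::finite \<Rightarrow> nat. sum \<alpha> UNIV \<le> k}"
proof (rule finite_subset)
  show "{\<alpha> :: 'm \<Rightarrow> nat. sum \<alpha> UNIV \<le> k} \<subseteq> (UNIV :: 'm set) \<rightarrow>\<^sub>E {..k}"
  proof
    fix \<alpha> :: "'m \<Rightarrow> nat"
    assume "\<alpha> \<in> {\<alpha>. sum \<alpha> UNIV \<le> k}"
    moreover have "\<alpha> i \<le> sum \<alpha> UNIV" for i
      by (rule member_le_sum) simp_all
    ultimately have "\<alpha> i \<le> k" for i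
      using order_trans by blast
    then show "\<alpha> \<in> (UNIV :: 'm set) \<rightarrow>\<^sub>E {..k}"
      by (simp add: PiE_def)
  qed
  show "finite ((UNIV :: 'm set) \<rightarrow>\<^sub>E {..k})"
    by (intro finite_PiE) auto
qed

text \<open>
  The operator \<open>(1/K)(T\<^sup>*, T) = (I - \<Sum>i. T\<^sub>i\<^sup>* T\<^sub>i)\<^sup>k\<close> in the hereditary calculus, by multinomial
  expansion of \<open>(1 - \<langle>z, w\<rangle>)\<^sup>k\<close>.
\<close>

definition inverse_kernel_operator :: "nat \<Rightarrow> ('m::finite \<Rightarrow> 'h \<Rightarrow> 'h::complex_inner) \<Rightarrow> 'h \<Rightarrow> 'h"
  where "inverse_kernel_operator k T h =
    (\<Sum>\<alpha> | sum \<alpha> UNIV \<le> k.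
      ((-1) ^ sum \<alpha> UNIV * fact k / ((\<Prod>i\<in>UNIV. fact (\<alpha> i)) * fact (k - sum \<alpha> UNIV)))
        *\<^sub>R tuple_power (adjoint_tuple T) \<alpha> (tuple_power T \<alpha> h))"

definition defect_operator :: "nat \<Rightarrow> ('m::finite \<Rightarrow> 'h \<Rightarrow> 'h::complex_inner) \<Rightarrow> 'h \<Rightarrow> 'h"
  where "defect_operator k T = sqrt_operator (inverse_kernel_operator k T)"

text \<open>Polynomials in the variables \<open>z\<^sub>i\<close> map multi-indices to coefficients, with finite support.\<close>

type_synonym 'm polynomial = "('m \<Rightarrow> nat) \<Rightarrow>\<^sub>0 complex"

definition poly_value :: "'m::finite polynomial \<Rightarrow> complex ^ 'm \<Rightarrow> complex"
  where "poly_value p z =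
    (\<Sum>\<alpha>\<in>Poly_Mapping.keys p. Poly_Mapping.lookup p \<alpha> * (\<Prod>i\<in>UNIV. (z $ i) ^ \<alpha> i))"

definition poly_operator :: "'m::finite polynomial \<Rightarrow> ('m \<Rightarrow> 'h \<Rightarrow> 'h::complex_inner) \<Rightarrow> 'h \<Rightarrow> 'h"
  where "poly_operator p T h =
    (\<Sum>\<alpha>\<in>Poly_Mapping.keys p. Poly_Mapping.lookup p \<alpha> *\<^sub>C tuple_power T \<alpha> h)"

text \<open>
  \<open>f\<^sub>j(T\<^sup>*, T)\<close> for \<open>f\<^sub>j(z, w) = (\<Sum>i\<ge>j. e\<^sub>i(z) (1 - \<langle>z, w\<rangle>)\<^sup>k cnj (e\<^sub>i(w)))\<close>, which equals
  \<open>1 - (\<Sum>i<j. e\<^sub>i(z) (1 - \<langle>z, w\<rangle>)\<^sup>k cnj (e\<^sub>i(w)))\<close> because \<open>\<Sum>i. e\<^sub>i(z) cnj (e\<^sub>i(w)) = K(z, w)\<close>.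
\<close>

definition tail_operator ::
    "nat \<Rightarrow> (nat \<Rightarrow> 'm::finite polynomial) \<Rightarrow> nat \<Rightarrow> ('m \<Rightarrow> 'h \<Rightarrow> 'h::complex_inner) \<Rightarrow> 'h \<Rightarrow> 'h"
  where "tail_operator k p j T h =
    h - (\<Sum>i<j. poly_operator (p i) (adjoint_tuple T)
            (inverse_kernel_operator k T (cadjoint (poly_operator (p i) (adjoint_tuple T)) h)))"

end

theory Submission
  imports Defs "HOL-Complex_Analysis.Complex_Analysis"
begin

text \<open>
  Let \<open>D\<close> be the defect operator and \<open>H\<close> the weighted Bergman space with kernel
  \<open>K z w = (1 - \<langle>z, w\<rangle>)\<^bsup>-k\<^esup>\<close>. The hypothesis on the tails says that
  \<open>h \<mapsto> \<Sum>i. e i \<otimes> D (e i (T\<^sup>*))\<^sup>* h\<close> is an isometry into a tensor product with \<open>H\<close>. On eigenvectors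
  it is explicit: \<open>t w \<mapsto> \<kappa> w \<otimes> D (t w)\<close>, where \<open>\<kappa> w\<close> is the kernel function at the conjugate
  of \<open>w\<close>, an eigenvector of \<open>M\<^sub>z\<^sup>*\<close> for \<open>w\<close>. Hence
  \<open>\<langle>t u, t v\<rangle> = \<langle>D (t u), D (t v)\<rangle> K u v\<close> (\<open>eigensection_gram\<close>), and everything else happens with
  Gram matrices.

  Put \<open>q w = \<langle>D (t w), \<zeta>0\<rangle>\<close> and \<open>g w = D (t w) / q w\<close>. The similarity is the map \<open>X\<close> with
  \<open>X (t w) = q w \<kappa> w\<close>, and its inverse \<open>Y\<close> sends \<open>\<kappa> w\<close> to \<open>t w / q w\<close>. Both are prescribed on
  families with dense span, so only boundedness is at stake. For \<open>X\<close> it follows from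
  \<open>\<parallel>\<zeta>0\<parallel> = 1\<close> and the fact that entrywise products of Gram matrices are positive
  (\<open>gram_product_nonneg\<close>). For \<open>Y\<close> it says that \<open>(C\<^sup>2 - \<langle>g u, g v\<rangle>) K u v\<close> is a positive kernel,
  that is, that the bounded holomorphic function \<open>g\<close> is a multiplier (\<open>multiplier_bound\<close>). The same
  statement for the coordinate functions makes \<open>M\<^sub>z\<close> bounded.

  Bounded holomorphic functions are multipliers of a Bergman space because its norm is an
  \<open>L\<^sup>2\<close> norm. In place of the measure \<open>(1 - \<parallel>z\<parallel>\<^sup>2)\<^bsup>k - m - 1\<^esup> dz\<close>,
  explicit finite averages over points of the closed ball are used. Their moments converge to the right limits by Vandermonde's identity and the
  orthogonality of roots of unity (\<open>quad_monomials_tendsto\<close>), so in the limit they reproduce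
  polynomials. Holomorphic functions on a larger ball are uniform limits of polynomials on the closed ball
  (\<open>holomorphic_polynomial_approximation\<close>), which gives the reproducing property for them
  (\<open>quad_reproducing\<close>); the boundary is reached by dilation.

  The operator theory that this needs is developed first: the Riesz representation theorem,
  adjoints, extension of operators from dense families, and square roots of positive operators.
\<close>

section \<open>Complex inner products\<close>

lemma cinner_add_right: "cinner x (y + z) = cinner x y + cinner x z"
  by (metis cinner_add_left cinner_commute complex_cnj_add)

lemma cinner_scaleC_right: "cinner x (a *\<^sub>C y) = cnj a * cinner x y"
  by (metis cinner_commute cinner_scaleC_left complex_cnj_mult)

lemma cinner_zero_left [simp]: "cinner 0 x = 0"
  using cinner_add_left[of 0 0 x] by simp

lemma cinner_zero_right [simp]: "cinner x 0 = 0"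
  using cinner_add_right[of x 0 0] by simp

lemma cinner_minus_left: "cinner (- x) y = - cinner x y"
  using cinner_add_left[of x "- x" y] by (simp add: eq_neg_iff_add_eq_0 add.commute)

lemma cinner_minus_right: "cinner x (- y) = - cinner x y"
  by (metis cinner_commute cinner_minus_left complex_cnj_minus)

lemma cinner_diff_left: "cinner (x - y) z = cinner x z - cinner y z"
  using cinner_add_left[of x "- y" z] by (simp add: cinner_minus_left)

lemma cinner_diff_right: "cinner x (y - z) = cinner x y - cinner x z"
  using cinner_add_right[of x y "- z"] by (simp add: cinner_minus_right)

lemma cinner_sum_left: "cinner (sum f A) y = (\<Sum>i\<in>A. cinner (f i) y)"
  by (induction A rule: infinite_finite_induct) (simp_all add: cinner_add_left)

lemma cinner_sum_right: "cinner x (sum f A) = (\<Sum>i\<in>A. cinner x (f i))"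
  by (induction A rule: infinite_finite_induct) (simp_all add: cinner_add_right)

lemma cinner_self: "cinner x x = complex_of_real ((norm x)\<^sup>2)"
proof -
  have "Im (cinner x x) = 0"
    using cinner_commute[of x x] by (metis Reals_cnj_iff complex_is_Real_iff)
  moreover have "Re (cinner x x) = (norm x)\<^sup>2"
    by (simp add: inner_eq_Re_cinner[symmetric] power2_norm_eq_inner)
  ultimately show ?thesis by (simp add: complex_eq_iff)
qed

lemma norm_scaleC: "norm (a *\<^sub>C x) = cmod a * norm x" for x :: "'a::complex_inner"
proof -
  have "complex_of_real ((norm (a *\<^sub>C x))\<^sup>2) = a * cnj a * complex_of_real ((norm x)\<^sup>2)"
    by (simp only: cinner_self[symmetric] cinner_scaleC_left cinner_scaleC_right mult_ac)
  also have "\<dots> = complex_of_real ((cmod a * norm x)\<^sup>2)"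
    by (simp only: complex_norm_square[symmetric] of_real_mult power_mult_distrib)
  finally have "(norm (a *\<^sub>C x))\<^sup>2 = (cmod a * norm x)\<^sup>2" by (simp only: of_real_eq_iff)
  then show ?thesis by (simp add: power2_eq_iff_nonneg)
qed

text \<open>A unimodular factor makes the inner product real and nonnegative, which reduces the claim to the
  real Cauchy--Schwarz inequality.\<close>

lemma cinner_Cauchy_Schwarz: "cmod (cinner x y) \<le> norm x * norm y"
proof (cases "cinner x y = 0")
  case False
  define c where "c = cnj (cinner x y) / cmod (cinner x y)"
  have c: "cmod c = 1" using False by (simp add: c_def norm_divide)
  have "cinner (c *\<^sub>C x) y = complex_of_real (cmod (cinner x y))"
    using False by (simp add: c_def cinner_scaleC_left complex_norm_square[symmetric] power2_eq_square)
      (metis complex_norm_square mult.commute nonzero_mult_div_cancel_left norm_eq_zero of_real_eq_0_iff of_real_mult power2_eq_square)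
  then have "cmod (cinner x y) = inner (c *\<^sub>C x) y"
    by (simp add: inner_eq_Re_cinner)
  also have "\<dots> \<le> norm (c *\<^sub>C x) * norm y" by (rule norm_cauchy_schwarz)
  finally show ?thesis by (simp add: norm_scaleC c)
qed simp

lemma scaleR_scaleC_commute: "r *\<^sub>R a *\<^sub>C x = a *\<^sub>C r *\<^sub>R x"
  by (simp add: scaleR_scaleC scaleC_scaleC mult.commute)

lemma cinner_scaleR_left: "cinner (r *\<^sub>R x) y = r *\<^sub>R cinner x y"
  by (simp only: scaleR_scaleC[of r x] cinner_scaleC_left scaleR_conv_of_real)

lemma cinner_scaleR_right: "cinner x (r *\<^sub>R y) = r *\<^sub>R cinner x y"
  by (simp only: scaleR_scaleC[of r y] cinner_scaleC_right scaleR_conv_of_real complex_cnj_complex_of_real)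

lemma bounded_bilinear_cinner: "bounded_bilinear cinner"
  by unfold_locales
    (auto simp: cinner_add_left cinner_add_right cinner_scaleR_left cinner_scaleR_right
      intro!: exI[of _ 1] cinner_Cauchy_Schwarz)

lemma bounded_bilinear_scaleC: "bounded_bilinear (scaleC :: complex \<Rightarrow> 'a \<Rightarrow> 'a::complex_inner)"
proof
  show "\<exists>K. \<forall>a (b::'a). norm (a *\<^sub>C b) \<le> norm a * norm b * K"
    by (intro exI[of _ 1]) (simp add: norm_scaleC)
  show "(r *\<^sub>R a) *\<^sub>C b = r *\<^sub>R a *\<^sub>C b" for r a and b :: 'a
    by (simp only: scaleR_scaleC[of r "a *\<^sub>C b"] scaleC_scaleC scaleR_conv_of_real)
qed (simp_all add: scaleC_add_left scaleC_add_right scaleR_scaleC_commute)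

lemmas tendsto_cinner = bounded_bilinear.tendsto[OF bounded_bilinear_cinner]
lemmas tendsto_scaleC = bounded_bilinear.tendsto[OF bounded_bilinear_scaleC]

lemma cinner_eqI: "(\<And>y. cinner x y = cinner x' y) \<Longrightarrow> x = x'"
  by (metis cinner_diff_left cinner_self eq_iff_diff_eq_0 norm_eq_zero of_real_eq_0_iff zero_eq_power2)

lemma bounded_clinearI:
  assumes "\<And>x y. A (x + y) = A x + A y" "\<And>c x. A (c *\<^sub>C x) = c *\<^sub>C A x" "\<And>x. norm (A x) \<le> norm x * K"
  shows "bounded_clinear A"
  unfolding bounded_clinear_def
  by (intro conjI bounded_linear_intro[where K = K]) (simp_all add: assms scaleR_scaleC)

lemma bounded_clinearD:
  assumes "bounded_clinear A"
  shows "bounded_linear A" "A (x + y) = A x + A y" "A (c *\<^sub>C x) = c *\<^sub>C A x" "A (x - y) = A x - A y"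
    "A 0 = 0" "A (sum f I) = (\<Sum>i\<in>I. A (f i))"
proof -
  show *: "bounded_linear A" and "A (c *\<^sub>C x) = c *\<^sub>C A x"
    using assms by (simp_all add: bounded_clinear_def)
  interpret bounded_linear A by fact
  show "A (x + y) = A x + A y" "A (x - y) = A x - A y" "A 0 = 0" "A (sum f I) = (\<Sum>i\<in>I. A (f i))"
    by (rule add diff zero sum)+
qed

lemma bounded_clinear_compose:
  "bounded_clinear A \<Longrightarrow> bounded_clinear B \<Longrightarrow> bounded_clinear (A \<circ> B)"
  unfolding bounded_clinear_def by (auto simp: o_def intro: bounded_linear_compose)

section \<open>Orthogonality, Riesz representation and adjoints\<close>

text \<open>By the parallelogram law, points of a convex set whose norms are almost minimal are close to
  each other, so a minimising sequence is Cauchy.\<close>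

lemma closed_convex_minimal_norm:
  fixes S :: "'a::{real_inner, complete_space} set"
  assumes "closed S" "convex S" "S \<noteq> {}"
  shows "\<exists>s\<in>S. \<forall>x\<in>S. norm s \<le> norm x"
proof -
  define d where "d = (INF x\<in>S. (norm x)\<^sup>2)"
  have bdd: "bdd_below ((\<lambda>x. (norm x)\<^sup>2) ` S)" by (rule bdd_belowI[of _ 0]) auto
  have d_le: "d \<le> (norm x)\<^sup>2" if "x \<in> S" for x
    unfolding d_def by (rule cINF_lower[OF bdd that])
  have "\<exists>x\<in>S. (norm x)\<^sup>2 < d + inverse (real (Suc n))" for n
  proof -
    have "d < d + inverse (real (Suc n))" by simp
    then show ?thesis unfolding d_def by (subst (asm) (1) cINF_less_iff[OF \<open>S \<noteq> {}\<close> bdd]) auto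
  qed
  then obtain s where sS: "\<And>n. s n \<in> S" and s: "\<And>n. (norm (s n))\<^sup>2 < d + inverse (real (Suc n))"
    by metis
  have close: "(norm (s m - s n))\<^sup>2 \<le> 2 * inverse (real (Suc m)) + 2 * inverse (real (Suc n))" for m n
  proof -
    have "(1/2) *\<^sub>R s m + (1/2) *\<^sub>R s n \<in> S"
      by (rule convexD[OF \<open>convex S\<close>]) (auto simp: sS)
    from d_le[OF this] have "4 * d \<le> (norm (s m + s n))\<^sup>2"
      by (simp add: scaleR_add_right[symmetric] power_mult_distrib power_divide)
    moreover have "(norm (s m + s n))\<^sup>2 + (norm (s m - s n))\<^sup>2 = 2 * (norm (s m))\<^sup>2 + 2 * (norm (s n))\<^sup>2"
      by (simp add: power2_norm_eq_inner inner_add_left inner_add_right inner_diff_left inner_diff_right)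
    ultimately show ?thesis using s[of m] s[of n] by linarith
  qed
  have "Cauchy s"
  proof (rule metric_CauchyI)
    fix e :: real assume "e > 0"
    then obtain N where N: "inverse (real (Suc N)) < e\<^sup>2 / 4"
      using reals_Archimedean[of "e\<^sup>2 / 4"] by auto
    have "dist (s m) (s n) < e" if "m \<ge> N" "n \<ge> N" for m n
    proof -
      have "inverse (real (Suc m)) \<le> inverse (real (Suc N))" "inverse (real (Suc n)) \<le> inverse (real (Suc N))"
        using that by (simp_all add: field_simps)
      with close[of m n] N have "(norm (s m - s n))\<^sup>2 < e\<^sup>2" by linarith
      then show ?thesis using \<open>e > 0\<close> by (simp add: dist_norm power2_less_imp_less)
    qed
    then show "\<exists>M. \<forall>m\<ge>M. \<forall>n\<ge>M. dist (s m) (s n) < e" by blast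
  qed
  then obtain l where l: "s \<longlonglongrightarrow> l" using Cauchy_convergent convergent_def by blast
  have "l \<in> S" using closed_sequentially[OF \<open>closed S\<close>] sS l by blast
  moreover have "(norm l)\<^sup>2 \<le> d"
  proof (rule LIMSEQ_le)
    show "(\<lambda>n. (norm (s n))\<^sup>2) \<longlonglongrightarrow> (norm l)\<^sup>2" by (intro tendsto_intros l)
    show "(\<lambda>n. d + inverse (real (Suc n))) \<longlonglongrightarrow> d"
      using tendsto_add[OF tendsto_const LIMSEQ_inverse_real_of_nat, of d] by simp
    show "\<exists>N. \<forall>n\<ge>N. (norm (s n))\<^sup>2 \<le> d + inverse (real (Suc n))" using s less_imp_le by blast
  qed
  ultimately show ?thesis using d_le by (meson norm_ge_zero order_trans power2_le_imp_le)
qed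

text \<open>The first-order condition for minimality of a squared distance at \<open>t = 0\<close>.\<close>

lemma zero_if_quadratic_nonneg:
  fixes a b :: real
  assumes "\<And>t. 0 \<le> 2 * t * a + t\<^sup>2 * b"
  shows "a = 0"
proof (rule ccontr)
  assume "a \<noteq> 0"
  \<comment> \<open>near \<open>0\<close> the linear term wins; a step of size \<open>1 / c\<close> is short enough for that\<close>
  define c where "c = \<bar>b\<bar> + 1"
  have c: "c > 0" "b < c" by (auto simp: c_def)
  have "0 \<le> 2 * (- a / c) * a + (- a / c)\<^sup>2 * b" by (rule assms)
  also have "\<dots> = (a\<^sup>2 / c) * (b / c - 2)"
    using c by (simp add: power2_eq_square field_simps)
  also have "\<dots> < 0" using c \<open>a \<noteq> 0\<close>
    by (intro mult_pos_neg) (auto simp: field_simps)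
  finally show False by simp
qed

lemma norm_add_scaleR_squared:
  "(norm (s + t *\<^sub>R u))\<^sup>2 = (norm s)\<^sup>2 + 2 * t * inner s u + t\<^sup>2 * (norm u)\<^sup>2" for s u :: "'a::real_inner"
proof -
  have "inner u s = inner s u" by (rule inner_commute)
  then show ?thesis
    unfolding power2_norm_eq_inner
    by (simp add: inner_add_left inner_add_right power2_eq_square algebra_simps)
qed

lemma complex_subspace_real:
  assumes "complex_vector.subspace S"
  shows "subspace S"
  using assms unfolding complex_vector.subspace_def subspace_def by (simp add: scaleR_scaleC)

lemma closure_complex_subspace:
  fixes S :: "'a::complex_inner set"
  assumes "complex_vector.subspace S"
  shows "complex_vector.subspace (closure S)"
proof (rule complex_vector.subspaceI)
  show "0 \<in> closure S" using complex_vector.subspace_0[OF assms] closure_subset by blast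
next
  fix x y assume "x \<in> closure S" "y \<in> closure S"
  then obtain f g where "\<And>n. f n \<in> S" "\<And>n. g n \<in> S" "f \<longlonglongrightarrow> x" "g \<longlonglongrightarrow> y"
    unfolding closure_sequential by blast
  then show "x + y \<in> closure S" unfolding closure_sequential
    by (intro exI[of _ "\<lambda>n. f n + g n"]) (auto intro!: tendsto_intros complex_vector.subspace_add[OF assms])
next
  fix c and x :: 'a assume "x \<in> closure S"
  then obtain f where "\<And>n. f n \<in> S" "f \<longlonglongrightarrow> x"
    unfolding closure_sequential by blast
  then show "c *\<^sub>C x \<in> closure S" unfolding closure_sequential
    by (intro exI[of _ "\<lambda>n. c *\<^sub>C f n"])
      (auto intro!: tendsto_intros tendsto_scaleC complex_vector.subspace_scale[OF assms])
qed

text \<open>The difference between a vector and its best approximation from the closed span is orthogonal to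
  the span.\<close>

lemma dense_if_orthogonal_trivial:
  fixes S :: "'a::complex_hilbert set"
  assumes orth: "\<And>x. (\<And>s. s \<in> S \<Longrightarrow> cinner x s = 0) \<Longrightarrow> x = 0"
  shows "closure (complex_vector.span S) = UNIV"
proof -
  define V where "V = closure (complex_vector.span S)"
  have V: "complex_vector.subspace V"
    unfolding V_def by (intro closure_complex_subspace complex_vector.subspace_span)
  have "y \<in> V" for y
  proof -
    have "\<exists>s\<in>(\<lambda>v. y - v) ` V. \<forall>x\<in>(\<lambda>v. y - v) ` V. norm s \<le> norm x"
    proof (rule closed_convex_minimal_norm)
      have cl: "closed ((\<lambda>v. y + v) ` uminus ` V)"
        by (intro closed_translation closed_negations) (simp add: V_def)
      have cv: "convex ((\<lambda>v. y + v) ` uminus ` V)"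
        by (intro convex_translation convex_negations subspace_imp_convex complex_subspace_real V)
      have eq: "(\<lambda>v. y + v) ` uminus ` V = (\<lambda>v. y - v) ` V" by (simp add: image_image)
      show "closed ((\<lambda>v. y - v) ` V)" "convex ((\<lambda>v. y - v) ` V)" using cl cv by (simp_all only: eq)
      show "(\<lambda>v. y - v) ` V \<noteq> {}" using complex_vector.subspace_0[OF V] by blast
    qed
    then obtain v where v: "v \<in> V" and le: "\<And>u. u \<in> V \<Longrightarrow> norm (y - v) \<le> norm (y - u)" by blast
    have orthV: "inner (y - v) u = 0" if "u \<in> V" for u
    proof (rule zero_if_quadratic_nonneg[of _ "(norm u)\<^sup>2"])
      fix t
      have "v - t *\<^sub>R u \<in> V"
        by (metis V complex_vector.subspace_diff complex_vector.subspace_scale scaleR_scaleC that v)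
      from le[OF this] have "(norm (y - v))\<^sup>2 \<le> (norm ((y - v) + t *\<^sub>R u))\<^sup>2"
        by (simp add: algebra_simps)
      also have "\<dots> = (norm (y - v))\<^sup>2 + 2 * t * inner (y - v) u + t\<^sup>2 * (norm u)\<^sup>2" by (rule norm_add_scaleR_squared)
      finally show "0 \<le> 2 * t * inner (y - v) u + t\<^sup>2 * (norm u)\<^sup>2" by simp
    qed
    have "y - v = 0"
    proof (rule orth)
      fix s assume "s \<in> S"
      then have s: "s \<in> V" unfolding V_def using complex_vector.span_base closure_subset by blast
      then have "Re (cinner (y - v) s) = 0" using orthV by (simp add: inner_eq_Re_cinner[symmetric])
      moreover have "Re (cinner (y - v) (\<i> *\<^sub>C s)) = 0"
        using orthV[OF complex_vector.subspace_scale[OF V s]] by (simp add: inner_eq_Re_cinner[symmetric])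
      ultimately show "cinner (y - v) s = 0" by (simp add: cinner_scaleC_right complex_eq_iff)
    qed
    then show ?thesis using v by simp
  qed
  then show ?thesis by (auto simp: V_def)
qed

text \<open>The representing vector is a multiple of the shortest element of \<open>{x. f x = 1}\<close>.\<close>

lemma real_Riesz_representation:
  fixes f :: "'a::{real_inner, complete_space} \<Rightarrow> real"
  assumes "bounded_linear f"
  shows "\<exists>y. \<forall>x. f x = inner x y"
proof (cases "\<exists>x. f x \<noteq> 0")
  case True
  interpret bounded_linear f by fact
  let ?S = "{x. f x = 1}"
  obtain x0 where x0: "f x0 \<noteq> 0" using True by blast
  have "\<exists>s\<in>?S. \<forall>x\<in>?S. norm s \<le> norm x"
  proof (rule closed_convex_minimal_norm)
    show "closed ?S" by (intro closed_Collect_eq continuous_intros linear_continuous_on assms)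
    show "convex ?S" by (auto simp: convex_def add scale algebra_simps)
    have "x0 /\<^sub>R f x0 \<in> ?S" using x0 by (simp add: scale)
    then show "?S \<noteq> {}" by blast
  qed
  then obtain s where s: "f s = 1" and le: "\<And>x. f x = 1 \<Longrightarrow> norm s \<le> norm x" by blast
  have "s \<noteq> 0" using s zero by auto
  have orth: "inner s u = 0" if "f u = 0" for u
  proof (rule zero_if_quadratic_nonneg[of _ "(norm u)\<^sup>2"])
    fix t
    have "f (s + t *\<^sub>R u) = 1" using s that by (simp add: add scale)
    from power_mono[OF le[OF this] norm_ge_zero, of 2]
    have "(norm s)\<^sup>2 \<le> (norm (s + t *\<^sub>R u))\<^sup>2" .
    also have "\<dots> = (norm s)\<^sup>2 + 2 * t * inner s u + t\<^sup>2 * (norm u)\<^sup>2" by (rule norm_add_scaleR_squared)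
    finally show "0 \<le> 2 * t * inner s u + t\<^sup>2 * (norm u)\<^sup>2" by simp
  qed
  have "f x = inner x (s /\<^sub>R (norm s)\<^sup>2)" for x
  proof -
    have "inner s (x - f x *\<^sub>R s) = 0" by (rule orth) (simp add: diff scale s)
    then have "inner x s = f x * (norm s)\<^sup>2"
      by (simp add: inner_diff_right power2_norm_eq_inner inner_commute)
    then show ?thesis using \<open>s \<noteq> 0\<close> by simp
  qed
  then show ?thesis by blast
qed (auto intro!: exI[of _ 0])

lemma cadjoint_unique:
  assumes "\<And>x y. cinner (A x) y = cinner x (B y)"
  shows "cadjoint A = B"
  unfolding cadjoint_def
proof (rule the_equality)
  fix B' assume "\<forall>x y. cinner (A x) y = cinner x (B' y)"
  then have "cinner (B' y) x = cinner (B y) x" for x y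
    by (metis assms cinner_commute)
  then show "B' = B" by (auto intro: cinner_eqI)
qed (simp add: assms)

lemma cinner_cadjoint_right:
  fixes A :: "'a::complex_hilbert \<Rightarrow> 'b::complex_inner"
  assumes A: "bounded_clinear A"
  shows "cinner (A x) y = cinner x (cadjoint A y)"
proof -
  note D = bounded_clinearD[OF A]
  have "\<exists>z. \<forall>x. cinner (A x) y = cinner x z" for y
  proof -
    have "bounded_linear (\<lambda>x. inner (A x) y)"
      by (rule bounded_linear_compose[OF bounded_linear_inner_left D(1)])
    then obtain z where z: "\<And>x. inner (A x) y = inner x z" using real_Riesz_representation by blast
    have "cinner (A x) y = cinner x z" for x
    proof (rule complex_eqI)
      show "Re (cinner (A x) y) = Re (cinner x z)" using z by (simp add: inner_eq_Re_cinner)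
      show "Im (cinner (A x) y) = Im (cinner x z)"
        using z[of "\<i> *\<^sub>C x"] by (simp add: inner_eq_Re_cinner D(3) cinner_scaleC_left)
    qed
    then show ?thesis by blast
  qed
  then obtain B where B: "\<And>x y. cinner (A x) y = cinner x (B y)" by metis
  from cadjoint_unique[OF B] B show ?thesis by simp
qed

lemma bounded_clinear_cadjoint:
  fixes A :: "'a::complex_hilbert \<Rightarrow> 'b::complex_inner"
  assumes A: "bounded_clinear A"
  shows "bounded_clinear (cadjoint A)"
proof -
  have "\<exists>K>0. \<forall>x. norm (A x) \<le> norm x * K"
    by (rule bounded_linear.pos_bounded[OF bounded_clinearD(1)[OF A]])
  then obtain K where K: "\<And>x. norm (A x) \<le> norm x * K" "K > 0"
    by blast
  have r: "cinner (cadjoint A y) x = cinner y (A x)" for x y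
    by (simp only: cinner_commute[of "cadjoint A y"] cinner_cadjoint_right[OF A, symmetric]
        cinner_commute[of y])
  show ?thesis
  proof (rule bounded_clinearI)
    fix y
    have "(norm (cadjoint A y))\<^sup>2 = cmod (cinner y (A (cadjoint A y)))"
      unfolding r[symmetric] cinner_self by (simp add: norm_power)
    also have "\<dots> \<le> norm y * (norm (cadjoint A y) * K)"
      by (rule order_trans[OF cinner_Cauchy_Schwarz mult_left_mono[OF K(1)]]) simp
    finally have "norm (cadjoint A y) * norm (cadjoint A y) \<le> (norm y * K) * norm (cadjoint A y)"
      by (simp add: power2_eq_square mult_ac)
    then show "norm (cadjoint A y) \<le> norm y * K"
      using K(2) by (cases "norm (cadjoint A y) = 0") auto
  qed (rule cinner_eqI, simp add: r cinner_add_left cinner_scaleC_left)+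
qed

section \<open>Operators prescribed on families with dense span\<close>

text \<open>The inequality makes the set \<open>G\<close> of pairs of corresponding linear combinations the graph of a
  Lipschitz function on the span of the \<open>a i\<close>, even when the \<open>a i\<close> are linearly dependent; that
  function extends to the closure by uniform continuity.\<close>

lemma bounded_clinear_extension:
  fixes a :: "'i \<Rightarrow> 'a::complex_inner" and b :: "'i \<Rightarrow> 'b::complex_hilbert"
  assumes dense: "closure (complex_vector.span (a ` I)) = UNIV"
    and bound: "\<And>J c. finite J \<Longrightarrow> J \<subseteq> I \<Longrightarrow>
      norm (\<Sum>i\<in>J. c i *\<^sub>C b i) \<le> C * norm (\<Sum>i\<in>J. c i *\<^sub>C a i)"
  shows "\<exists>X. bounded_clinear X \<and> (\<forall>i\<in>I. X (a i) = b i)"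
proof -
  define G where "G = {(\<Sum>i\<in>J. c i *\<^sub>C a i, \<Sum>i\<in>J. c i *\<^sub>C b i) | J c. finite J \<and> J \<subseteq> I}"
  have G_E: "\<exists>J c. finite J \<and> J \<subseteq> I \<and> x = (\<Sum>i\<in>J. c i *\<^sub>C a i) \<and> x' = (\<Sum>i\<in>J. c i *\<^sub>C b i)"
    if "(x, x') \<in> G" for x x'
    using that unfolding G_def by auto
  have G_add: "(x + y, x' + y') \<in> G" if xy: "(x, x') \<in> G" "(y, y') \<in> G" for x x' y y'
  proof -
    obtain J c where J: "finite J" "J \<subseteq> I" and x: "x = (\<Sum>i\<in>J. c i *\<^sub>C a i)" "x' = (\<Sum>i\<in>J. c i *\<^sub>C b i)"
      using G_E[OF xy(1)] by blast
    obtain L d where L: "finite L" "L \<subseteq> I" and y: "y = (\<Sum>i\<in>L. d i *\<^sub>C a i)" "y' = (\<Sum>i\<in>L. d i *\<^sub>C b i)"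
      using G_E[OF xy(2)] by blast
    define e where "e i = (if i \<in> J then c i else 0) + (if i \<in> L then d i else 0)" for i
    have ext: "(\<Sum>i\<in>J \<union> L. e i *\<^sub>C f i) = (\<Sum>i\<in>J. c i *\<^sub>C f i) + (\<Sum>i\<in>L. d i *\<^sub>C f i)"
      for f :: "'i \<Rightarrow> 'z::complex_inner"
    proof -
      have "(\<Sum>i\<in>J \<union> L. e i *\<^sub>C f i) = (\<Sum>i\<in>J \<union> L. (if i \<in> J then c i *\<^sub>C f i else 0)) +
          (\<Sum>i\<in>J \<union> L. (if i \<in> L then d i *\<^sub>C f i else 0))"
        unfolding sum.distrib[symmetric] e_def by (intro sum.cong refl) (simp add: scaleC_add_left)
      then show ?thesis using J(1) L(1)
        by (simp add: sum.If_cases Int_absorb1 Int_absorb2)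
    qed
    have "finite (J \<union> L)" "J \<union> L \<subseteq> I" using J L by auto
    then show ?thesis unfolding G_def x y ext[symmetric]
      by (intro CollectI exI[of _ "J \<union> L"] exI[of _ e]) simp
  qed
  have G_scale: "(s *\<^sub>C x, s *\<^sub>C x') \<in> G" if xG: "(x, x') \<in> G" for s x x'
  proof -
    obtain J c where J: "finite J" "J \<subseteq> I" and x: "x = (\<Sum>i\<in>J. c i *\<^sub>C a i)" "x' = (\<Sum>i\<in>J. c i *\<^sub>C b i)"
      using G_E[OF xG] by blast
    have eq: "s *\<^sub>C (\<Sum>i\<in>J. c i *\<^sub>C f i) = (\<Sum>i\<in>J. (s * c i) *\<^sub>C f i)"
      for f :: "'i \<Rightarrow> 'z::complex_vector"
      by (simp only: complex_vector.scale_sum_right scaleC_scaleC)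
    show ?thesis unfolding G_def x eq
      by (intro CollectI exI[of _ J] exI[of _ "\<lambda>i. s * c i"]) (simp add: J)
  qed
  have G_bound: "norm x' \<le> C * norm x" if "(x, x') \<in> G" for x x'
    using G_E[OF that] bound by blast
  have G_base: "(a i, b i) \<in> G" if "i \<in> I" for i
    unfolding G_def using that by (auto intro!: exI[of _ "{i}"] exI[of _ "\<lambda>_. 1"] simp: scaleC_one)
  have G_zero: "(0, 0) \<in> G"
    unfolding G_def by (auto intro!: exI[of _ "{}"])
  have G_dom: "\<exists>x'. (x, x') \<in> G" if "x \<in> complex_vector.span (a ` I)" for x
    using that
  proof (induction rule: complex_vector.span_induct_alt)
    case base then show ?case using G_zero by blast
  next
    case (step c x y) then show ?case using G_add G_scale G_base by blast
  qed
  have C: "0 \<le> max C 1" by simp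
  have G_lip: "norm (x' - y') \<le> max C 1 * norm (x - y)" if "(x, x') \<in> G" "(y, y') \<in> G" for x x' y y'
  proof -
    have "(x + (-1) *\<^sub>C y, x' + (-1) *\<^sub>C y') \<in> G" using that G_add G_scale by blast
    moreover have "(-1) *\<^sub>C z = - z" for z :: "'z::complex_inner"
      by (metis complex_vector.scale_minus_left scaleC_one)
    ultimately have "norm (x' - y') \<le> C * norm (x - y)" using G_bound by fastforce
    also have "\<dots> \<le> max C 1 * norm (x - y)" by (intro mult_right_mono) auto
    finally show ?thesis .
  qed
  \<comment> \<open>the domain of the function whose graph is \<open>G\<close>\<close>
  define V where "V = fst ` G"
  define f where "f x = (SOME x'. (x, x') \<in> G)" for x
  have fG: "(x, f x) \<in> G" if "x \<in> V" for x
    using that unfolding V_def f_def by (metis (mono_tags) imageE prod.collapse someI_ex)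
  have f_eq: "f x = x'" if "(x, x') \<in> G" for x x'
  proof -
    have "x \<in> V" unfolding V_def using that by force
    from G_lip[OF fG[OF this] that] show ?thesis by simp
  qed
  have closV: "closure V = UNIV"
  proof -
    have "complex_vector.span (a ` I) \<subseteq> V" unfolding V_def using G_dom by force
    then show ?thesis using dense closure_mono by blast
  qed
  have "uniformly_continuous_on V f"
    unfolding uniformly_continuous_on_def
  proof (intro allI impI)
    fix e :: real assume "e > 0"
    have "dist (f x') (f x) < e" if "x \<in> V" "x' \<in> V" "dist x' x < e / max C 1" for x x'
      using G_lip[OF fG fG, OF that(2,1)] that(3)
      by (simp add: dist_norm field_simps)
    then show "\<exists>d>0. \<forall>x\<in>V. \<forall>x'\<in>V. dist x' x < d \<longrightarrow> dist (f x') (f x) < e"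
      using \<open>e > 0\<close> by (intro exI[of _ "e / max C 1"]) auto
  qed
  then obtain X where X: "uniformly_continuous_on UNIV X" "\<And>x. x \<in> V \<Longrightarrow> f x = X x"
    using uniformly_continuous_on_extension_on_closure closV by metis
  have XG: "X x = x'" if "(x, x') \<in> G" for x x'
    using f_eq[OF that] X(2)[of x] that unfolding V_def by force
  have cont: "X \<midarrow>x\<rightarrow> X x" for x
    using uniformly_continuous_imp_continuous[OF X(1)]
    by (simp add: continuous_on_eq_continuous_at isCont_def)
  have approx: "\<exists>s s'. (\<forall>n. (s n, s' n) \<in> G) \<and> s \<longlonglongrightarrow> x \<and> s' \<longlonglongrightarrow> X x" for x
  proof -
    have "x \<in> closure V" using closV by simp
    then obtain s where s: "\<And>n. s n \<in> V" "s \<longlonglongrightarrow> x" unfolding closure_sequential by blast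
    have "(\<lambda>n. X (s n)) \<longlonglongrightarrow> X x"
      using cont[of x] s(2) by (metis isCont_def isCont_tendsto_compose)
    moreover have "X (s n) = f (s n)" for n using X(2) s(1) by simp
    ultimately show ?thesis using s fG
      by (intro exI[of _ s] exI[of _ "\<lambda>n. f (s n)"]) simp
  qed
  have "bounded_clinear X"
  proof (rule bounded_clinearI)
    fix x y
    obtain s s' where s: "\<And>n. (s n, s' n) \<in> G" "s \<longlonglongrightarrow> x" "s' \<longlonglongrightarrow> X x" using approx by blast
    obtain r r' where r: "\<And>n. (r n, r' n) \<in> G" "r \<longlonglongrightarrow> y" "r' \<longlonglongrightarrow> X y" using approx by blast
    have "(\<lambda>n. X (s n + r n)) \<longlonglongrightarrow> X (x + y)"
      using cont[of "x + y"] tendsto_add[OF s(2) r(2)] by (metis isCont_def isCont_tendsto_compose)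
    moreover have "(\<lambda>n. X (s n + r n)) \<longlonglongrightarrow> X x + X y"
      unfolding XG[OF G_add[OF s(1) r(1)]] by (rule tendsto_add[OF s(3) r(3)])
    ultimately show "X (x + y) = X x + X y" by (rule LIMSEQ_unique)
  next
    fix c x
    obtain s s' where s: "\<And>n. (s n, s' n) \<in> G" "s \<longlonglongrightarrow> x" "s' \<longlonglongrightarrow> X x" using approx by blast
    have "(\<lambda>n. X (c *\<^sub>C s n)) \<longlonglongrightarrow> X (c *\<^sub>C x)"
      using cont[of "c *\<^sub>C x"] tendsto_scaleC[OF tendsto_const s(2)]
      by (metis isCont_def isCont_tendsto_compose)
    moreover have "(\<lambda>n. X (c *\<^sub>C s n)) \<longlonglongrightarrow> c *\<^sub>C X x"
      unfolding XG[OF G_scale[OF s(1)]] by (rule tendsto_scaleC[OF tendsto_const s(3)])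
    ultimately show "X (c *\<^sub>C x) = c *\<^sub>C X x" by (rule LIMSEQ_unique)
  next
    fix x
    obtain s s' where s: "\<And>n. (s n, s' n) \<in> G" "s \<longlonglongrightarrow> x" "s' \<longlonglongrightarrow> X x" using approx by blast
    show "norm (X x) \<le> norm x * C"
      by (rule LIMSEQ_le[OF tendsto_norm[OF s(3)] tendsto_mult[OF tendsto_norm[OF s(2)] tendsto_const]])
        (use G_bound s(1) in \<open>auto simp: mult.commute\<close>)
  qed
  moreover have "\<forall>i\<in>I. X (a i) = b i" using XG G_base by blast
  ultimately show ?thesis by blast
qed

lemma bounded_clinear_eq_on_dense:
  assumes "bounded_clinear A" "bounded_clinear B" "closure (complex_vector.span S) = UNIV"
    and eq: "\<And>s. s \<in> S \<Longrightarrow> A s = B s"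
  shows "A = B"
proof
  fix x
  have sp: "A y = B y" if "y \<in> complex_vector.span S" for y
    using that
    by (induction rule: complex_vector.span_induct_alt)
      (simp_all add: bounded_clinearD[OF assms(1)] bounded_clinearD[OF assms(2)] eq)
  have "x \<in> closure (complex_vector.span S)" using assms(3) by simp
  then obtain s where s: "\<And>n. s n \<in> complex_vector.span S" "s \<longlonglongrightarrow> x"
    unfolding closure_sequential by blast
  have "(\<lambda>n. A (s n)) \<longlonglongrightarrow> A x"
    by (rule bounded_linear.tendsto[OF bounded_clinearD(1)[OF assms(1)] s(2)])
  moreover have "(\<lambda>n. A (s n)) \<longlonglongrightarrow> B x"
    unfolding sp[OF s(1)] by (rule bounded_linear.tendsto[OF bounded_clinearD(1)[OF assms(2)] s(2)])
  ultimately show "A x = B x" by (rule LIMSEQ_unique)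
qed

section \<open>Square roots of positive operators\<close>

instance complex_hilbert \<subseteq> banach ..

lemma positive_operatorD:
  assumes "positive_operator A"
  shows "bounded_clinear A" "cinner (A x) x \<in> \<real>" "0 \<le> Re (cinner (A x) x)"
  using assms unfolding positive_operator_def by auto

text \<open>Polarisation with \<open>x + y\<close> and \<open>x + \<i> y\<close>.\<close>

lemma positive_operator_symmetric:
  assumes "positive_operator A"
  shows "cinner (A x) y = cinner x (A y)"
proof -
  note A = bounded_clinearD[OF positive_operatorD(1)[OF assms]]
  have Im0: "Im (cinner (A z) z) = 0" for z
    using positive_operatorD(2)[OF assms, of z] by (simp add: complex_is_Real_iff)
  have "Im (cinner (A (x + y)) (x + y)) = 0" "Im (cinner (A (x + \<i> *\<^sub>C y)) (x + \<i> *\<^sub>C y)) = 0"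
    by (rule Im0)+
  then have 1: "Im (cinner (A x) y) + Im (cinner (A y) x) = 0"
      "Re (cinner (A y) x) - Re (cinner (A x) y) = 0"
    using Im0[of x] Im0[of y]
    by (simp_all add: A cinner_add_left cinner_add_right cinner_scaleC_left cinner_scaleC_right)
  have "cinner x (A y) = cnj (cinner (A y) x)" by (rule cinner_commute)
  then show ?thesis using 1 by (simp add: complex_eq_iff)
qed

text \<open>The Taylor coefficients of \<open>(1 - x)\<^bsup>1/2\<^esup>\<close> at \<open>0\<close>.\<close>

definition sqrt_coeff :: "nat \<Rightarrow> real"
  where "sqrt_coeff n = (1/2 gchoose n) * (-1) ^ n"

lemma sqrt_coeff_0 [simp]: "sqrt_coeff 0 = 1"
  by (simp add: sqrt_coeff_def)

lemma sqrt_coeff_nonpos: "n > 0 \<Longrightarrow> sqrt_coeff n \<le> 0"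
proof -
  assume "n > 0"
  then obtain m where m: "n = Suc m" by (cases n) auto
  have "sqrt_coeff n = pochhammer (-1/2) n / fact n"
    by (simp add: sqrt_coeff_def gbinomial_pochhammer power_mult_distrib[symmetric])
  also have "\<dots> = - (1/2) * pochhammer (1/2) m / fact n"
    by (simp add: m pochhammer_rec)
  also have "\<dots> \<le> 0" by (simp add: pochhammer_nonneg)
  finally show ?thesis .
qed

text \<open>The partial sums at \<open>x = 1\<close> are, up to sign, the binomial coefficients of \<open>-1/2\<close>.\<close>

lemma sqrt_coeff_partial_sum_nonneg: "0 \<le> (\<Sum>n\<le>N. sqrt_coeff n)"
proof -
  have "(\<Sum>n\<le>N. sqrt_coeff n) = (-1) ^ N * (1/2 - 1 gchoose N)"
    unfolding sqrt_coeff_def by (rule gbinomial_sum_lower_neg)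
  also have "\<dots> = pochhammer (1/2) N / fact N"
    by (simp add: gbinomial_pochhammer power_mult_distrib[symmetric])
  finally show ?thesis by (simp add: pochhammer_nonneg)
qed

text \<open>Only the coefficient of index \<open>0\<close> is positive. With the nonnegativity of the partial sums, the
  absolute values therefore have sum at most \<open>2\<close>.\<close>

lemma abs_sqrt_coeff_partial_sum: "(\<Sum>n\<le>N. \<bar>sqrt_coeff n\<bar>) = 2 - (\<Sum>n\<le>N. sqrt_coeff n)"
  by (induction N) (auto simp: abs_of_nonpos[OF sqrt_coeff_nonpos])

lemma summable_abs_sqrt_coeff: "summable (\<lambda>n. \<bar>sqrt_coeff n\<bar>)"
proof (rule summableI_nonneg_bounded)
  fix N
  have "(\<Sum>n<N. \<bar>sqrt_coeff n\<bar>) \<le> (\<Sum>n\<le>N. \<bar>sqrt_coeff n\<bar>)" by (intro sum_mono2) auto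
  then show "(\<Sum>n<N. \<bar>sqrt_coeff n\<bar>) \<le> 2"
    using abs_sqrt_coeff_partial_sum[of N] sqrt_coeff_partial_sum_nonneg[of N] by linarith
qed simp

text \<open>The square of the series is \<open>1 - x\<close>, by Vandermonde's identity for \<open>1/2 + 1/2 = 1\<close>.\<close>

lemma sqrt_coeff_convolution:
  "(\<Sum>i\<le>n. sqrt_coeff i * sqrt_coeff (n - i)) = (if n = 0 then 1 else if n = 1 then -1 else 0)"
proof -
  have "(\<Sum>i\<le>n. sqrt_coeff i * sqrt_coeff (n - i)) =
      (-1) ^ n * (\<Sum>i\<le>n. (1/2 gchoose i) * (1/2 gchoose (n - i)))"
    unfolding sum_distrib_left sqrt_coeff_def
    by (intro sum.cong refl) (auto simp: power_add[symmetric] mult_ac)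
  also have "(\<Sum>i\<le>n. (1/2 gchoose i) * (1/2 gchoose (n - i))) = ((1::real) gchoose n)"
    using gbinomial_Vandermonde[where a = "1/2::real" and b = "1/2" and n = n] by (simp add: atLeast0AtMost)
  also have "(1::real) gchoose n = real (1 choose n)"
    by (simp add: binomial_gbinomial)
  finally show ?thesis
    by (cases n rule: nat.exhaust) (auto simp: binomial_eq_0 split: if_splits)
qed

text \<open>For a contraction \<open>B\<close>, the binomial series of \<open>(1 - B)\<^bsup>1/2\<^esup>\<close> converges absolutely,
  since the sum of the moduli of its coefficients is finite.\<close>

definition sqrt_series :: "('a::complex_hilbert \<Rightarrow> 'a) \<Rightarrow> 'a \<Rightarrow> 'a"
  where "sqrt_series B x = suminf (\<lambda>n. sqrt_coeff n *\<^sub>R (B ^^ n) x)"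

lemma bounded_clinear_funpow:
  assumes "bounded_clinear (B :: 'a::complex_inner \<Rightarrow> 'a)"
  shows "bounded_clinear (B ^^ n)"
proof (induction n)
  case 0
  then show ?case by (auto intro: bounded_clinearI[where K = 1])
next
  case (Suc n)
  show ?case unfolding funpow.simps by (rule bounded_clinear_compose[OF assms Suc])
qed

context
  fixes B :: "'a::complex_hilbert \<Rightarrow> 'a"
  assumes B: "bounded_clinear B" and contr: "\<And>x. norm (B x) \<le> norm x"
begin

lemma norm_funpow_contraction: "norm ((B ^^ n) x) \<le> norm x"
  by (induction n) (auto intro: order_trans[OF contr])

lemma summable_norm_sqrt_series: "summable (\<lambda>n. norm (sqrt_coeff n *\<^sub>R (B ^^ n) x))"
  by (rule summable_comparison_test'[OF summable_mult2[OF summable_abs_sqrt_coeff, of "norm x"], of 0])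
    (auto intro!: mult_left_mono norm_funpow_contraction)

lemma sqrt_series_sums: "(\<lambda>n. sqrt_coeff n *\<^sub>R (B ^^ n) x) sums sqrt_series B x"
  unfolding sqrt_series_def by (rule summable_sums[OF summable_norm_cancel[OF summable_norm_sqrt_series]])

lemma sqrt_series_tendsto:
  "(\<lambda>N. \<Sum>n\<le>N. sqrt_coeff n *\<^sub>R (B ^^ n) x) \<longlonglongrightarrow> sqrt_series B x"
  using sqrt_series_sums[of x] by (simp add: sums_def_le)

lemma norm_sqrt_series_partial: "norm (\<Sum>n\<le>N. sqrt_coeff n *\<^sub>R (B ^^ n) x) \<le> norm x * 2"
proof -
  have "norm (\<Sum>n\<le>N. sqrt_coeff n *\<^sub>R (B ^^ n) x) \<le> (\<Sum>n\<le>N. \<bar>sqrt_coeff n\<bar> * norm x)"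
    by (intro sum_norm_le) (auto intro!: mult_left_mono norm_funpow_contraction)
  also have "\<dots> = norm x * (2 - (\<Sum>n\<le>N. sqrt_coeff n))"
    unfolding sum_distrib_right[symmetric] abs_sqrt_coeff_partial_sum by (rule mult.commute)
  also have "\<dots> \<le> norm x * 2"
    using sqrt_coeff_partial_sum_nonneg[of N] by (intro mult_left_mono) auto
  finally show ?thesis .
qed

lemma bounded_clinear_sqrt_series: "bounded_clinear (sqrt_series B)"
proof (rule bounded_clinearI)
  note Bn = bounded_clinearD[OF bounded_clinear_funpow[OF B]]
  fix x y c
  have "(\<lambda>N. (\<Sum>n\<le>N. sqrt_coeff n *\<^sub>R (B ^^ n) x) + (\<Sum>n\<le>N. sqrt_coeff n *\<^sub>R (B ^^ n) y))
      \<longlonglongrightarrow> sqrt_series B (x + y)"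
    using sqrt_series_tendsto[of "x + y"] by (simp only: Bn(2) scaleR_add_right sum.distrib)
  with tendsto_add[OF sqrt_series_tendsto sqrt_series_tendsto]
  show "sqrt_series B (x + y) = sqrt_series B x + sqrt_series B y"
    by (metis (no_types, lifting) LIMSEQ_unique)
  have "(\<lambda>N. c *\<^sub>C (\<Sum>n\<le>N. sqrt_coeff n *\<^sub>R (B ^^ n) x)) \<longlonglongrightarrow> sqrt_series B (c *\<^sub>C x)"
    using sqrt_series_tendsto[of "c *\<^sub>C x"]
    by (simp only: Bn(3) complex_vector.scale_sum_right scaleR_scaleC_commute)
  with tendsto_scaleC[OF tendsto_const sqrt_series_tendsto]
  show "sqrt_series B (c *\<^sub>C x) = c *\<^sub>C sqrt_series B x"
    by (metis (no_types, lifting) LIMSEQ_unique)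
  show "norm (sqrt_series B x) \<le> norm x * 2"
    by (rule LIMSEQ_le_const2[OF tendsto_norm[OF sqrt_series_tendsto]])
      (use norm_sqrt_series_partial in blast)
qed

lemma sqrt_series_commute:
  assumes C: "bounded_clinear C" and comm: "\<And>x. C (B x) = B (C x)"
  shows "C (sqrt_series B x) = sqrt_series B (C x)"
proof -
  have comm_n: "C ((B ^^ n) x) = (B ^^ n) (C x)" for n
    by (induction n) (auto simp: comm)
  interpret C: bounded_linear C by (rule bounded_clinearD(1)[OF C])
  have "(\<lambda>N. C (\<Sum>n\<le>N. sqrt_coeff n *\<^sub>R (B ^^ n) x)) \<longlonglongrightarrow> C (sqrt_series B x)"
    by (rule C.tendsto[OF sqrt_series_tendsto])
  then have "(\<lambda>N. \<Sum>n\<le>N. sqrt_coeff n *\<^sub>R (B ^^ n) (C x)) \<longlonglongrightarrow> C (sqrt_series B x)"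
    by (simp only: C.sum C.scale comm_n)
  with sqrt_series_tendsto[of "C x"] show ?thesis by (metis LIMSEQ_unique)
qed

text \<open>The square of the \<open>N\<close>-th partial sum is a sum over a square of indices, which differs from
  the sum over the triangle \<open>i + j \<le> N\<close>, equal to \<open>1 - B\<close>, by a vanishing tail of the
  convergent scalar Cauchy product.\<close>

lemma sqrt_series_square: "sqrt_series B (sqrt_series B x) = x - B x"
proof -
  let ?b = sqrt_coeff
  define S where "S N y = (\<Sum>n\<le>N. ?b n *\<^sub>R (B ^^ n) y)" for N y
  note Bn = bounded_clinearD[OF bounded_clinear_funpow[OF B]]
  have lin_diff: "S N (y - z) = S N y - S N z" for N y z
    unfolding S_def by (simp add: Bn(4) scaleR_diff_right sum_subtractf)
  have S_lim: "(\<lambda>N. S N y) \<longlonglongrightarrow> sqrt_series B y" for y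
    unfolding S_def by (rule sqrt_series_tendsto)
  have "(\<lambda>N. S N (S N x - sqrt_series B x)) \<longlonglongrightarrow> 0"
  proof (rule Lim_null_comparison)
    show "\<forall>\<^sub>F N in sequentially. norm (S N (S N x - sqrt_series B x)) \<le> norm (S N x - sqrt_series B x) * 2"
      unfolding S_def using norm_sqrt_series_partial by (intro always_eventually) blast
    show "(\<lambda>N. norm (S N x - sqrt_series B x) * 2) \<longlonglongrightarrow> 0"
      by (intro tendsto_mult_left_zero tendsto_norm_zero) (use S_lim[of x] LIM_zero in blast)
  qed
  from tendsto_add[OF this S_lim[of "sqrt_series B x"]]
  have SS: "(\<lambda>N. S N (S N x)) \<longlonglongrightarrow> sqrt_series B (sqrt_series B x)"
    by (simp add: lin_diff)
  define P where "P M = (\<Sum>(i,j)\<in>M. (?b i * ?b j) *\<^sub>R (B ^^ (i + j)) x)" for M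
  define Sq where "Sq N = {..N} \<times> {..N}" for N :: nat
  define Tri where "Tri N = {(i, j). i + j \<le> N}" for N :: nat
  have TS: "Tri N \<subseteq> Sq N" "finite (Sq N)" for N unfolding Tri_def Sq_def by auto
  have "S N (S N x) = P (Sq N)" for N
  proof -
    have "S N (S N x) = (\<Sum>i\<le>N. \<Sum>j\<le>N. (?b i * ?b j) *\<^sub>R (B ^^ (i + j)) x)"
      unfolding S_def[of N "S N x"]
    proof (intro sum.cong refl)
      fix i
      interpret Bi: bounded_linear "B ^^ i" by (rule Bn(1))
      show "?b i *\<^sub>R (B ^^ i) (S N x) = (\<Sum>j\<le>N. (?b i * ?b j) *\<^sub>R (B ^^ (i + j)) x)"
        by (simp add: S_def Bi.sum Bi.scale scaleR_sum_right funpow_add)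
    qed
    then show ?thesis by (simp add: P_def Sq_def sum.cartesian_product)
  qed
  moreover have "P (Tri N) = x - B x" if "N \<ge> 1" for N
  proof -
    have "P (Tri N) = (\<Sum>k\<le>N. \<Sum>i\<le>k. (?b i * ?b (k - i)) *\<^sub>R (B ^^ (i + (k - i))) x)"
      unfolding P_def Tri_def by (rule sum.triangle_reindex_eq)
    also have "\<dots> = (\<Sum>k\<le>N. (\<Sum>i\<le>k. ?b i * ?b (k - i)) *\<^sub>R (B ^^ k) x)"
      by (auto simp: scaleR_sum_left intro!: sum.cong)
    also have "\<dots> = (\<Sum>k\<le>N. if k \<in> {0, 1} then (if k = 0 then x else - B x) else 0)"
      unfolding sqrt_coeff_convolution by (intro sum.cong refl) auto
    also have "\<dots> = (\<Sum>k\<in>{0, 1::nat}. if k = 0 then x else - B x)"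
      by (rule sum.mono_neutral_cong_right) (use that in auto)
    finally show ?thesis by simp
  qed
  moreover have "(\<lambda>N. P (Sq N) - P (Tri N)) \<longlonglongrightarrow> 0"
  proof (rule Lim_null_comparison)
    have sub: "sum g (Sq N - Tri N) = sum g (Sq N) - sum g (Tri N)" for N and g :: "_ \<Rightarrow> 'z::ab_group_add"
      by (rule sum_diff[OF TS(2) TS(1)])
    let ?q = "\<lambda>M. (\<Sum>(i,j)\<in>M. \<bar>?b i\<bar> * \<bar>?b j\<bar>)"
    have "norm (P (Sq N - Tri N)) \<le> ?q (Sq N - Tri N) * norm x" for N
      unfolding P_def sum_distrib_right
      by (rule sum_norm_le) (auto simp: abs_mult intro!: mult_left_mono norm_funpow_contraction)
    then show "\<forall>\<^sub>F N in sequentially. norm (P (Sq N) - P (Tri N)) \<le> (?q (Sq N) - ?q (Tri N)) * norm x"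
      unfolding P_def by (simp add: sub)
    let ?L = "suminf (\<lambda>n. \<bar>?b n\<bar>)"
    have "(\<lambda>N. (\<Sum>i\<le>N. \<bar>?b i\<bar>) * (\<Sum>j\<le>N. \<bar>?b j\<bar>)) \<longlonglongrightarrow> ?L * ?L"
      using summable_sums[OF summable_abs_sqrt_coeff] by (intro tendsto_mult) (simp_all add: sums_def_le)
    then have 1: "(\<lambda>N. ?q (Sq N)) \<longlonglongrightarrow> ?L * ?L"
      by (simp add: Sq_def sum.cartesian_product[symmetric] sum_product)
    have "(\<lambda>k. \<Sum>i\<le>k. \<bar>?b i\<bar> * \<bar>?b (k - i)\<bar>) sums (?L * ?L)"
      by (rule Cauchy_product_sums) (simp_all add: summable_abs_sqrt_coeff)
    then have 2: "(\<lambda>N. ?q (Tri N)) \<longlonglongrightarrow> ?L * ?L"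
      unfolding Tri_def by (subst sum.triangle_reindex_eq) (simp add: sums_def_le)
    show "(\<lambda>N. (?q (Sq N) - ?q (Tri N)) * norm x) \<longlonglongrightarrow> 0"
      using tendsto_mult[OF tendsto_diff[OF 1 2] tendsto_const, of "norm x"] by simp
  qed
  ultimately have "(\<lambda>N. S N (S N x) - (x - B x)) \<longlonglongrightarrow> 0"
    by (rule_tac Lim_transform_eventually) (auto intro: eventually_sequentiallyI[of 1])
  then have "(\<lambda>N. S N (S N x)) \<longlonglongrightarrow> x - B x" by (rule LIM_zero_cancel)
  with SS show ?thesis by (metis LIMSEQ_unique)
qed

text \<open>Since \<open>\<langle>B\<^sup>n x, x\<rangle> \<le> \<parallel>x\<parallel>\<^sup>2\<close> and the coefficients beyond the first are nonpositive,
  replacing every \<open>\<langle>B\<^sup>n x, x\<rangle>\<close> by \<open>\<parallel>x\<parallel>\<^sup>2\<close> can only decrease the sum, and leaves a nonnegative partial sum of coefficients.\<close>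

lemma positive_sqrt_series:
  assumes sym: "\<And>x y. cinner (B x) y = cinner x (B y)"
  shows "positive_operator (sqrt_series B)"
  unfolding positive_operator_def
proof (intro conjI allI bounded_clinear_sqrt_series)
  fix x
  have "cinner ((B ^^ n) x) y = cinner x ((B ^^ n) y)" for n x y
    by (induction n arbitrary: x y) (auto simp: sym funpow_swap1)
  then have "cinner ((B ^^ n) x) x = cnj (cinner ((B ^^ n) x) x)" for n
    by (metis cinner_commute)
  then have real_n: "cinner ((B ^^ n) x) x = of_real (Re (cinner ((B ^^ n) x) x))" for n
    by (metis Reals_cnj_iff of_real_Re)
  let ?p = "\<lambda>N. \<Sum>n\<le>N. sqrt_coeff n * Re (cinner ((B ^^ n) x) x)"
  have lim: "(\<lambda>N. cinner (\<Sum>n\<le>N. sqrt_coeff n *\<^sub>R (B ^^ n) x) x) \<longlonglongrightarrow> cinner (sqrt_series B x) x"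
    by (rule tendsto_cinner[OF sqrt_series_tendsto tendsto_const])
  have eq: "cinner (\<Sum>n\<le>N. sqrt_coeff n *\<^sub>R (B ^^ n) x) x = of_real (?p N)" for N
    unfolding cinner_sum_left cinner_scaleR_left
    by (subst real_n) (simp add: scaleR_conv_of_real)
  have lim': "(\<lambda>N. complex_of_real (?p N)) \<longlonglongrightarrow> cinner (sqrt_series B x) x"
    using lim unfolding eq .
  from tendsto_Im[OF this] have "Im (cinner (sqrt_series B x) x) = 0"
    by (simp add: LIMSEQ_const_iff)
  then show "cinner (sqrt_series B x) x \<in> \<real>" by (simp add: complex_is_Real_iff)
  have "0 \<le> ?p N" for N
  proof -
    have "0 \<le> (\<Sum>n\<le>N. sqrt_coeff n) * (norm x)\<^sup>2"
      by (simp add: sqrt_coeff_partial_sum_nonneg)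
    also have "\<dots> \<le> ?p N"
      unfolding sum_distrib_right
    proof (rule sum_mono)
      fix n
      have "Re (cinner ((B ^^ n) x) x) \<le> norm ((B ^^ n) x) * norm x"
        by (rule order_trans[OF complex_Re_le_cmod cinner_Cauchy_Schwarz])
      also have "\<dots> \<le> (norm x)\<^sup>2"
        by (simp add: power2_eq_square mult_right_mono norm_funpow_contraction)
      finally have le: "Re (cinner ((B ^^ n) x) x) \<le> (norm x)\<^sup>2" .
      show "sqrt_coeff n * (norm x)\<^sup>2 \<le> sqrt_coeff n * Re (cinner ((B ^^ n) x) x)"
        using le sqrt_coeff_nonpos[of n] by (cases "n = 0") (auto simp: cinner_self intro: mult_left_mono_neg)
    qed
    finally show ?thesis .
  qed
  then show "0 \<le> Re (cinner (sqrt_series B x) x)"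
    using tendsto_Re[OF lim'] by (intro LIMSEQ_le_const[of ?p]) auto
qed

end

lemma bounded_clinear_scaleR:
  assumes "bounded_clinear A"
  shows "bounded_clinear (\<lambda>x. r *\<^sub>R A x)"
  using assms unfolding bounded_clinear_def
  by (auto intro: bounded_linear_compose[OF bounded_linear_scaleR_right] simp: scaleR_scaleC_commute)

text \<open>After scaling, \<open>0 \<le> \<langle>A (x - A x), x - A x\<rangle>\<close> shows that \<open>I - A\<close> is a contraction, and its binomial
  series is a square root of \<open>A\<close>. That series commutes with everything that commutes with \<open>A\<close>,
  which is what uniqueness of the square root rests on.\<close>

lemma positive_square_root_exists:
  fixes A :: "'a::complex_hilbert \<Rightarrow> 'a"
  assumes A: "positive_operator A"
  shows "\<exists>R. positive_operator R \<and> (\<forall>x. R (R x) = A x) \<and>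
    (\<forall>C. bounded_clinear C \<longrightarrow> (\<forall>x. C (A x) = A (C x)) \<longrightarrow> (\<forall>x. C (R x) = R (C x)))"
proof -
  note AD = bounded_clinearD[OF positive_operatorD(1)[OF A]]
  have "\<exists>K>0. \<forall>x. norm (A x) \<le> norm x * K" by (rule bounded_linear.pos_bounded[OF AD(1)])
  then obtain K where K: "K > 0" "\<And>x. norm (A x) \<le> norm x * K" by blast
  define A' where "A' x = (1 / K) *\<^sub>R A x" for x
  have A': "bounded_clinear A'" unfolding A'_def
    by (rule bounded_clinear_scaleR[OF positive_operatorD(1)[OF A]])
  note A'D = bounded_clinearD[OF A']
  have A'_norm: "norm (A' x) \<le> norm x" for x
    using K(2)[of x] K(1) by (simp add: A'_def field_simps)
  have A'_sym: "cinner (A' x) y = cinner x (A' y)" for x y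
    by (simp add: A'_def cinner_scaleR_left cinner_scaleR_right positive_operator_symmetric[OF A])
  have A'_pos: "0 \<le> inner (A' x) x" for x
    using positive_operatorD(3)[OF A, of x] K(1) by (simp add: A'_def inner_eq_Re_cinner[symmetric])
  have A'_inner: "inner (A' x) y = inner x (A' y)" for x y
    by (simp add: inner_eq_Re_cinner A'_sym)
  define B where "B x = x - A' x" for x
  have contr: "norm (B x) \<le> norm x" for x
  proof -
    have "0 \<le> inner (A' (x - A' x)) (x - A' x)" by (rule A'_pos)
    also have "\<dots> = inner (A' x) x - 2 * (norm (A' x))\<^sup>2 + inner (A' (A' x)) (A' x)"
      by (simp add: A'D(4) inner_diff_left inner_diff_right A'_inner[of "A' x" x] power2_norm_eq_inner)
    also have "inner (A' (A' x)) (A' x) \<le> (norm (A' x))\<^sup>2"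
      using norm_cauchy_schwarz[of "A' (A' x)" "A' x"] mult_right_mono[OF A'_norm[of "A' x"], of "norm (A' x)"]
      by (simp add: power2_eq_square)
    finally have "(norm (A' x))\<^sup>2 \<le> inner (A' x) x" by simp
    moreover have "(norm (B x))\<^sup>2 = (norm x)\<^sup>2 - 2 * inner (A' x) x + (norm (A' x))\<^sup>2"
      by (simp add: B_def power2_norm_eq_inner inner_diff_left inner_diff_right inner_commute[of x "A' x"])
    ultimately have "(norm (B x))\<^sup>2 \<le> (norm x)\<^sup>2" using A'_pos[of x] by linarith
    then show ?thesis by (rule power2_le_imp_le) simp
  qed
  have B: "bounded_clinear B"
  proof (rule bounded_clinearI[where K = 1])
    show "B (x + y) = B x + B y" for x y by (simp add: B_def A'D(2))
    show "B (c *\<^sub>C x) = c *\<^sub>C B x" for c x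
      by (simp only: B_def A'D(3) complex_vector.scale_right_diff_distrib)
  qed (simp add: contr)
  have B_sym: "cinner (B x) y = cinner x (B y)" for x y
    by (simp add: B_def cinner_diff_left cinner_diff_right A'_sym)
  define R where "R x = sqrt K *\<^sub>R sqrt_series B x" for x
  have R0: "positive_operator (sqrt_series B)" by (rule positive_sqrt_series[OF B contr B_sym])
  note R0D = bounded_clinearD[OF positive_operatorD(1)[OF R0]]
  interpret R0: bounded_linear "sqrt_series B" by (rule R0D(1))
  have "positive_operator R"
    unfolding positive_operator_def R_def
    using positive_operatorD[OF R0] K(1) bounded_clinear_scaleR
    by (auto simp: cinner_scaleR_left scaleR_conv_of_real Reals_mult)
  moreover have "R (R x) = A x" for x
    using K(1) by (simp add: R_def R0.scale sqrt_series_square[OF B contr] B_def A'_def)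
  moreover have "C (R x) = R (C x)" if C: "bounded_clinear C" "\<forall>x. C (A x) = A (C x)" for C x
  proof -
    interpret C: bounded_linear C by (rule bounded_clinearD(1)[OF C(1)])
    have "C (B x) = B (C x)" for x using C(2) by (simp add: B_def A'_def C.diff C.scale)
    then show ?thesis by (simp add: R_def C.scale sqrt_series_commute[OF B contr C(1)])
  qed
  ultimately show ?thesis by blast
qed

text \<open>If \<open>R\<close> is a square root of \<open>A\<close>, then \<open>\<langle>A x, x\<rangle> = \<parallel>R x\<parallel>\<^sup>2\<close>.\<close>

lemma positive_operator_eq_0:
  fixes A :: "'a::complex_hilbert \<Rightarrow> 'a"
  assumes A: "positive_operator A" and x: "Re (cinner (A x) x) = 0"
  shows "A x = 0"
proof -
  obtain R where R: "positive_operator R" "\<And>x. R (R x) = A x"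
    using positive_square_root_exists[OF A] by blast
  have "cinner (A x) x = cinner (R x) (R x)"
    using positive_operator_symmetric[OF R(1), of "R x" x] by (simp add: R(2))
  then have "R x = 0" using x by (simp add: cinner_self)
  then have "A x = R 0" using R(2)[of x] by simp
  then show ?thesis using bounded_clinearD(5)[OF positive_operatorD(1)[OF R(1)]] by simp
qed

text \<open>For \<open>y = R x - C x\<close>, commutation gives \<open>(R + C) y = 0\<close>. By positivity both \<open>R\<close> and \<open>C\<close> kill \<open>y\<close>,
  so \<open>y\<close> is orthogonal to itself.\<close>

lemma positive_square_root_unique:
  fixes R C :: "'a::complex_hilbert \<Rightarrow> 'a"
  assumes R: "positive_operator R" and C: "positive_operator C"
    and sq: "\<And>x. R (R x) = C (C x)" and comm: "\<And>x. C (R x) = R (C x)"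
  shows "R = C"
proof
  fix x
  note RD = bounded_clinearD[OF positive_operatorD(1)[OF R]]
  note CD = bounded_clinearD[OF positive_operatorD(1)[OF C]]
  define y where "y = R x - C x"
  have "R y + C y = 0" by (simp add: y_def RD(4) CD(4) sq comm)
  then have "cinner (R y) y + cinner (C y) y = 0" by (simp add: cinner_add_left[symmetric])
  then have "Re (cinner (R y) y) + Re (cinner (C y) y) = 0" by (metis plus_complex.sel(1) zero_complex.sel(1))
  then have "Re (cinner (R y) y) = 0" "Re (cinner (C y) y) = 0"
    using positive_operatorD(3)[OF R, of y] positive_operatorD(3)[OF C, of y] by linarith+
  then have 0: "R y = 0" "C y = 0" using positive_operator_eq_0 R C by blast+
  have "cinner y y = cinner (R x - C x) y" by (simp add: y_def)
  also have "\<dots> = cinner x (R y) - cinner x (C y)"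
    by (simp add: cinner_diff_left positive_operator_symmetric[OF R] positive_operator_symmetric[OF C])
  finally have "y = 0" by (simp add: 0 cinner_self)
  then show "R x = C x" by (simp add: y_def)
qed

lemma sqrt_operator_positive_square:
  fixes A :: "'a::complex_hilbert \<Rightarrow> 'a"
  assumes A: "positive_operator A"
  shows "positive_operator (sqrt_operator A)" "sqrt_operator A (sqrt_operator A x) = A x"
proof -
  obtain R where R: "positive_operator R" "\<And>x. R (R x) = A x"
    and comm: "\<And>C x. bounded_clinear C \<Longrightarrow> (\<And>x. C (A x) = A (C x)) \<Longrightarrow> C (R x) = R (C x)"
    using positive_square_root_exists[OF A] by blast
  have "sqrt_operator A = R"
    unfolding sqrt_operator_def
  proof (rule the_equality)
    show "positive_operator R \<and> R \<circ> R = A" using R by (auto simp: fun_eq_iff)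
  next
    fix C assume "positive_operator C \<and> C \<circ> C = A"
    then have C: "positive_operator C" and CC: "\<And>x. C (C x) = A x" by (auto simp: fun_eq_iff)
    have "C (R x) = R (C x)" for x
      by (rule comm[OF positive_operatorD(1)[OF C]]) (simp flip: CC)
    then have "R = C" by (intro positive_square_root_unique R(1) C) (simp_all add: R(2) CC)
    then show "C = R" by simp
  qed
  then show "positive_operator (sqrt_operator A)" "sqrt_operator A (sqrt_operator A x) = A x"
    using R by simp_all
qed

section \<open>Polynomial approximation of holomorphic functions on the ball\<close>

definition monomial_value :: "('m::finite \<Rightarrow> nat) \<Rightarrow> complex ^ 'm \<Rightarrow> complex"
  where "monomial_value \<alpha> z = (\<Prod>i\<in>UNIV. (z $ i) ^ \<alpha> i)"

text \<open>Built from monomials by addition, so that a linear statement about all polynomial functions needs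
  checking for monomials only.\<close>

inductive_set polyfuns :: "(complex ^ 'm::finite \<Rightarrow> complex) set" where
  monomial: "(\<lambda>z. c * monomial_value \<alpha> z) \<in> polyfuns"
| add: "f \<in> polyfuns \<Longrightarrow> g \<in> polyfuns \<Longrightarrow> (\<lambda>z. f z + g z) \<in> polyfuns"

lemma polyfuns_const: "(\<lambda>z. c) \<in> polyfuns"
  using polyfuns.monomial[of c "\<lambda>_. 0"] by (simp add: monomial_value_def)

lemma polyfuns_sum: "(\<And>i. i \<in> I \<Longrightarrow> f i \<in> polyfuns) \<Longrightarrow> (\<lambda>z. \<Sum>i\<in>I. f i z) \<in> polyfuns"
  by (induction I rule: infinite_finite_induct) (auto intro: polyfuns_const polyfuns.add)

lemma polyfuns_cmult: "f \<in> polyfuns \<Longrightarrow> (\<lambda>z. c * f z) \<in> polyfuns"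
proof (induction rule: polyfuns.induct)
  case (monomial d \<alpha>)
  then show ?case using polyfuns.monomial[of "c * d" \<alpha>] by (simp add: mult.assoc)
next
  case (add f g)
  then show ?case using polyfuns.add by (simp add: distrib_left)
qed

lemma polyfuns_coord_mult: "f \<in> polyfuns \<Longrightarrow> (\<lambda>z. z $ i * f z) \<in> polyfuns"
proof (induction rule: polyfuns.induct)
  case (monomial c \<alpha>)
  have "monomial_value (\<alpha>(i := Suc (\<alpha> i))) z = z $ i * monomial_value \<alpha> z" for z
  proof -
    have "(\<Prod>j\<in>UNIV - {i}. (z $ j) ^ (\<alpha>(i := Suc (\<alpha> i))) j) = (\<Prod>j\<in>UNIV - {i}. (z $ j) ^ \<alpha> j)"
      by (intro prod.cong) auto
    then show ?thesis by (simp add: monomial_value_def prod.remove[of UNIV i])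
  qed
  then show ?case using polyfuns.monomial[of c "\<alpha>(i := Suc (\<alpha> i))"] by (simp add: mult.left_commute)
next
  case (add f g)
  then show ?case using polyfuns.add by (simp add: distrib_left)
qed

lemma polyfuns_poly_mult: "f \<in> polyfuns \<Longrightarrow> (\<lambda>z. poly P (z $ i) * f z) \<in> polyfuns"
proof (induction P)
  case 0
  then show ?case by (simp add: polyfuns_const)
next
  case (pCons a P)
  then have "(\<lambda>z. a * f z + z $ i * (poly P (z $ i) * f z)) \<in> polyfuns"
    by (intro polyfuns.add polyfuns_cmult polyfuns_coord_mult)
  then show ?case by (simp add: algebra_simps)
qed

definition lagrange_basis :: "nat \<Rightarrow> nat \<Rightarrow> complex poly"
  where "lagrange_basis n a = smult (1 / (\<Prod>b\<in>{..n} - {a}. of_nat a - of_nat b))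
    (\<Prod>b\<in>{..n} - {a}. [:- of_nat b, 1:])"

text \<open>Both sides have degree at most \<open>n\<close> and agree at the \<open>n + 1\<close> nodes \<open>0, \<dots>, n\<close>.\<close>

lemma lagrange_interpolation:
  assumes "degree P \<le> n"
  shows "poly P \<zeta> = (\<Sum>a\<le>n. poly P (of_nat a) * poly (lagrange_basis n a) \<zeta>)"
proof -
  let ?Q = "\<Sum>a\<le>n. smult (poly P (of_nat a)) (lagrange_basis n a)"
  have node: "poly (lagrange_basis n a) (of_nat b) = (if a = b then 1 else 0)" if "a \<le> n" "b \<le> n" for a b
  proof (cases "a = b")
    case True
    have "(\<Prod>c\<in>{..n} - {a}. of_nat a - of_nat c) \<noteq> (0::complex)" by auto
    then show ?thesis using True by (simp add: lagrange_basis_def poly_prod)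
  next
    case False
    have "(\<Prod>c\<in>{..n} - {a}. of_nat b - of_nat c) = (0::complex)"
      by (rule prod_zero) (use False that in auto)
    then show ?thesis using False by (simp add: lagrange_basis_def poly_prod)
  qed
  have deg: "degree (lagrange_basis n a) \<le> n" if "a \<le> n" for a
  proof -
    have "degree (\<Prod>b\<in>{..n} - {a}. [:- of_nat b, 1 :: complex:]) \<le>
        sum (degree \<circ> (\<lambda>b. [:- of_nat b, 1 :: complex:])) ({..n} - {a})"
      by (rule degree_prod_sum_le) simp
    also have "\<dots> = n" using that by simp
    finally show ?thesis
      unfolding lagrange_basis_def using degree_smult_le order_trans by blast
  qed
  have "P = ?Q"
  proof (rule poly_eqI_degree)
    let ?A = "of_nat ` {..n} :: complex set"
    fix x assume "x \<in> ?A"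
    then obtain b where b: "b \<le> n" "x = of_nat b" by auto
    have "poly ?Q x = (\<Sum>a\<le>n. if a = b then poly P (of_nat a) else 0)"
      unfolding poly_sum b(2) by (intro sum.cong refl) (simp add: node b)
    also have "\<dots> = poly P x" using b by simp
    finally show "poly P x = poly ?Q x" by simp
  next
    have card: "card (of_nat ` {..n} :: complex set) = n + 1" by (subst card_image) (auto simp: inj_on_def)
    show "card (of_nat ` {..n} :: complex set) > degree P" using assms card by simp
    have "degree ?Q \<le> n"
      by (intro degree_sum_le) (use deg in auto)
    then show "card (of_nat ` {..n} :: complex set) > degree ?Q" using card by simp
  qed
  then have "poly P \<zeta> = poly ?Q \<zeta>" by (rule arg_cong)
  then show ?thesis by (simp add: poly_sum)
qed

definition vec_upd :: "complex ^ 'm \<Rightarrow> 'm \<Rightarrow> complex \<Rightarrow> complex ^ 'm"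
  where "vec_upd y i \<zeta> = (\<chi> j. if j = i then \<zeta> else y $ j)"

text \<open>Lagrange interpolation in one variable expresses the function through finitely many of
  its restrictions to hyperplanes, which depend on one variable less.\<close>

lemma separately_polynomial_imp_polyfun:
  fixes q :: "complex ^ 'm::finite \<Rightarrow> complex"
  assumes "finite I"
    and "\<And>y y' :: complex ^ 'm. (\<And>i. i \<in> I \<Longrightarrow> y $ i = y' $ i) \<Longrightarrow> q y = q y'"
    and "\<And>i y. i \<in> I \<Longrightarrow> \<exists>P. degree P \<le> n \<and> (\<forall>\<zeta>. q (vec_upd y i \<zeta>) = poly P \<zeta>)"
  shows "q \<in> polyfuns"
  using assms
proof (induction I arbitrary: q rule: finite_induct)
  case empty
  then have "q = (\<lambda>y. q 0)" by blast
  then show ?case using polyfuns_const by metis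
next
  case (insert i I)
  have "(\<lambda>y. q (vec_upd y i (of_nat a))) \<in> polyfuns" for a
  proof (rule insert.IH)
    fix y y' :: "complex ^ 'm" assume "\<And>j. j \<in> I \<Longrightarrow> y $ j = y' $ j"
    then show "q (vec_upd y i (of_nat a)) = q (vec_upd y' i (of_nat a))"
      by (intro insert.prems(1)) (auto simp: vec_upd_def)
  next
    fix j and y :: "complex ^ 'm" assume j: "j \<in> I"
    then have "vec_upd (vec_upd y j \<zeta>) i (of_nat a) = vec_upd (vec_upd y i (of_nat a)) j \<zeta>" for \<zeta>
      using insert.hyps(2) by (auto simp: vec_upd_def vec_eq_iff)
    then show "\<exists>P. degree P \<le> n \<and> (\<forall>\<zeta>. q (vec_upd (vec_upd y j \<zeta>) i (of_nat a)) = poly P \<zeta>)"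
      using insert.prems(2)[of j "vec_upd y i (of_nat a)"] j by simp
  qed
  then have "(\<lambda>y. \<Sum>a\<le>n. poly (lagrange_basis n a) (y $ i) * q (vec_upd y i (of_nat a))) \<in> polyfuns"
    by (intro polyfuns_sum polyfuns_poly_mult)
  also have "(\<lambda>y. \<Sum>a\<le>n. poly (lagrange_basis n a) (y $ i) * q (vec_upd y i (of_nat a))) = q"
  proof
    fix y
    obtain P where P: "degree P \<le> n" "\<And>\<zeta>. q (vec_upd y i \<zeta>) = poly P \<zeta>"
      using insert.prems(2)[of i y] by blast
    have "vec_upd y i (y $ i) = y" by (simp add: vec_upd_def vec_eq_iff)
    then have "q y = poly P (y $ i)" using P(2) by metis
    then show "(\<Sum>a\<le>n. poly (lagrange_basis n a) (y $ i) * q (vec_upd y i (of_nat a))) = q y"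
      unfolding P(2) by (simp add: lagrange_interpolation[OF P(1), of "y $ i"] mult.commute)
  qed
  finally show ?case .
qed

text \<open>Complex linearity of the Frechet derivative turns it into a complex derivative along the line.\<close>

lemma holomorphic_map_on_affine_line:
  assumes f: "holomorphic_map_on f S" and "open S"
  shows "(\<lambda>\<zeta>. f (y + \<zeta> *\<^sub>C e) :: complex) holomorphic_on {\<zeta>. y + \<zeta> *\<^sub>C e \<in> S}"
proof -
  have "(\<lambda>\<zeta>. f (y + \<zeta> *\<^sub>C e)) field_differentiable at \<zeta>" if \<zeta>: "y + \<zeta> *\<^sub>C e \<in> S" for \<zeta>
  proof -
    obtain D where D: "bounded_clinear D" "(f has_derivative D) (at (y + \<zeta> *\<^sub>C e) within S)"
      using f \<zeta> unfolding holomorphic_map_on_def by blast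
    then have fD: "(f has_derivative D) (at (y + \<zeta> *\<^sub>C e))"
      using at_within_open[OF \<zeta> \<open>open S\<close>] by simp
    have lin: "((\<lambda>\<zeta>. y + \<zeta> *\<^sub>C e) has_derivative (\<lambda>h. h *\<^sub>C e)) (at \<zeta>)"
      by (rule has_derivative_eq_rhs[OF has_derivative_add[OF has_derivative_const
        bounded_linear_imp_has_derivative[OF bounded_bilinear.bounded_linear_left[OF bounded_bilinear_scaleC]]]])
        simp
    have "((\<lambda>\<zeta>. f (y + \<zeta> *\<^sub>C e)) has_derivative (\<lambda>h. D (h *\<^sub>C e))) (at \<zeta>)"
      using has_derivative_compose[OF lin fD] .
    also have "(\<lambda>h. D (h *\<^sub>C e)) = (*) (D e)"
      by (simp add: bounded_clinearD(3)[OF D(1)] scaleC_complex_def fun_eq_iff)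
    finally show ?thesis
      unfolding field_differentiable_def has_field_derivative_def by blast
  qed
  then show ?thesis unfolding holomorphic_on_def by (auto intro: field_differentiable_at_within)
qed

text \<open>The homogeneous part of degree \<open>n\<close> of the Taylor expansion at \<open>0\<close>, obtained from one-variable
  calculus on the complex line through \<open>y\<close> instead of partial derivatives.\<close>

definition homogeneous_part :: "(complex ^ 'm::finite \<Rightarrow> complex) \<Rightarrow> nat \<Rightarrow> complex ^ 'm \<Rightarrow> complex"
  where "homogeneous_part f n y = (deriv ^^ n) (\<lambda>l. f (l *\<^sub>C y)) 0 / fact n"

lemma power_series_tail_bound:
  fixes c :: "nat \<Rightarrow> complex"
  assumes sums: "(\<lambda>n. c n * l ^ n) sums s" and c: "\<And>n. cmod (c n) \<le> M * b ^ n"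
    and q: "b * cmod l = q" "0 \<le> q" "q < 1"
  shows "cmod (s - (\<Sum>i<n. c i * l ^ i)) \<le> M * q ^ n / (1 - q)"
proof -
  have le: "cmod (c i * l ^ i) \<le> M * q ^ i" for i
    using mult_right_mono[OF c, of "cmod l ^ i" i]
    by (simp add: norm_mult norm_power q(1)[symmetric] power_mult_distrib mult.assoc)
  have geo: "(\<lambda>i. M * q ^ (i + n)) sums (M * q ^ n * (1 / (1 - q)))"
    using sums_mult[OF geometric_sums[of q], of "M * q ^ n"] q
    by (simp add: power_add mult_ac)
  have "(\<lambda>i. c (i + n) * l ^ (i + n)) sums (s - (\<Sum>i<n. c i * l ^ i))"
    using sums_split_initial_segment[OF sums, of n] .
  moreover have summ: "summable (\<lambda>i. cmod (c (i + n) * l ^ (i + n)))"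
    by (rule summable_comparison_test'[OF sums_summable[OF geo], of 0]) (use le in auto)
  ultimately have "cmod (s - (\<Sum>i<n. c i * l ^ i)) \<le> suminf (\<lambda>i. cmod (c (i + n) * l ^ (i + n)))"
    using summable_norm[OF summ] by (simp add: sums_iff)
  also have "\<dots> \<le> suminf (\<lambda>i. M * q ^ (i + n))"
    by (intro suminf_le le summ sums_summable[OF geo])
  also have "\<dots> = M * q ^ n / (1 - q)" using geo by (simp add: sums_iff)
  finally show ?thesis .
qed

context
  fixes f :: "complex ^ 'm::finite \<Rightarrow> complex" and R \<rho> M :: real
  assumes f: "holomorphic_map_on f (ball 0 R)" and \<rho>: "0 < \<rho>" "\<rho> < R"
    and bounded_by: "\<forall>z\<in>cball 0 \<rho>. cmod (f z) \<le> M"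
begin

lemma ray_holomorphic:
  assumes "norm y \<le> a" "0 < a"
  shows "(\<lambda>l. f (l *\<^sub>C y)) holomorphic_on ball 0 (R / a)"
proof (rule holomorphic_on_subset)
  show "(\<lambda>l. f (l *\<^sub>C y)) holomorphic_on {l. 0 + l *\<^sub>C y \<in> ball 0 R}"
    using holomorphic_map_on_affine_line[OF f open_ball, of 0 y] by simp
  have "cmod l * norm y < R" if "cmod l < R / a" for l
  proof -
    have "cmod l * norm y \<le> cmod l * a" by (intro mult_left_mono assms) auto
    also have "\<dots> < R" using that assms(2) by (simp add: field_simps)
    finally show ?thesis .
  qed
  then show "ball 0 (R / a) \<subseteq> {l. 0 + l *\<^sub>C y \<in> ball 0 R}" by (auto simp: norm_scaleC)
qed

lemma homogeneous_part_sums: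
  assumes "norm y \<le> a" "0 < a" "cmod l * a < R"
  shows "(\<lambda>n. homogeneous_part f n y * l ^ n) sums f (l *\<^sub>C y)"
proof -
  have "l \<in> ball 0 (R / a)" using assms(2,3) by (simp add: field_simps)
  from holomorphic_power_series[OF ray_holomorphic[OF assms(1,2)] this]
  show ?thesis by (simp add: homogeneous_part_def)
qed

text \<open>Cauchy's inequality on the circle of radius \<open>\<rho> / a\<close>, which the map \<open>l \<mapsto> l y\<close> sends into the ball of
  radius \<open>\<rho>\<close>.\<close>

lemma homogeneous_part_bound:
  assumes "norm y \<le> a" "0 < a"
  shows "cmod (homogeneous_part f n y) \<le> M * (a / \<rho>) ^ n"
proof -
  have sub: "\<rho> / a < R / a" using \<rho> assms(2) by (simp add: divide_strict_right_mono)
  have "cmod ((deriv ^^ n) (\<lambda>l. f (l *\<^sub>C y)) 0) \<le> fact n * M / (\<rho> / a) ^ n"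
  proof (rule Cauchy_inequality)
    show "(\<lambda>l. f (l *\<^sub>C y)) holomorphic_on ball 0 (\<rho> / a)"
      using ray_holomorphic[OF assms] by (rule holomorphic_on_subset) (use sub in auto)
    show "continuous_on (cball 0 (\<rho> / a)) (\<lambda>l. f (l *\<^sub>C y))"
      by (rule holomorphic_on_imp_continuous_on, rule holomorphic_on_subset[OF ray_holomorphic[OF assms]])
        (use sub in auto)
    show "0 < \<rho> / a" using \<rho> assms(2) by simp
    fix l :: complex assume "cmod (0 - l) = \<rho> / a"
    then have "cmod l = \<rho> / a" by simp
    then have "cmod l * norm y \<le> \<rho> / a * a"
      using assms \<rho> mult_left_mono[OF assms(1), of "\<rho> / a"] by simp
    then show "cmod (f (l *\<^sub>C y)) \<le> M"
      using assms(2) by (intro bounded_by[rule_format]) (simp add: norm_scaleC)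
  qed
  then have "cmod ((deriv ^^ n) (\<lambda>l. f (l *\<^sub>C y)) 0) / fact n \<le> M / (\<rho> / a) ^ n"
    by (simp add: field_simps)
  then show ?thesis by (simp add: homogeneous_part_def norm_divide power_divide)
qed

text \<open>The \<open>n\<close>-th part at \<open>y\<close> is the limit for \<open>l \<rightarrow> 0\<close> of the difference between \<open>f (l y)\<close> and the
  lower parts, divided by \<open>l\<^sup>n\<close>, uniformly on bounded sets; so it inherits holomorphy along
  complex lines.\<close>

lemma homogeneous_part_line_holomorphic:
  "(\<lambda>\<zeta>. homogeneous_part f n (y + \<zeta> *\<^sub>C e)) holomorphic_on UNIV"
proof (induction n rule: less_induct)
  case (less n)
  have "(\<lambda>\<zeta>. homogeneous_part f n (y + \<zeta> *\<^sub>C e)) holomorphic_on ball 0 A" if "A > 0" for A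
  proof -
    define a where "a = norm y + A * norm e + 1"
    have a: "a > 0" using \<open>A > 0\<close> by (simp add: a_def add_nonneg_pos)
    have le_a: "norm (y + \<zeta> *\<^sub>C e) \<le> a" if "cmod \<zeta> < A" for \<zeta>
    proof -
      have "norm (y + \<zeta> *\<^sub>C e) \<le> norm y + cmod \<zeta> * norm e"
        by (rule order_trans[OF norm_triangle_ineq]) (simp add: norm_scaleC)
      also have "\<dots> \<le> a" using that by (simp add: a_def add_increasing2 mult_right_mono)
      finally show ?thesis .
    qed
    \<comment> \<open>a null sequence for which the geometric ratio \<open>(a / \<rho>) l j\<close> of the tail is \<open>1 / (j + 2)\<close>\<close>
    define l where "l j = \<rho> / (a * (real j + 2))" for j
    have l: "l j > 0" "a / \<rho> * l j = 1 / (real j + 2)" "l j * a < R" for j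
    proof -
      show "l j > 0" using a \<rho> by (simp add: l_def)
      show "a / \<rho> * l j = 1 / (real j + 2)" using a \<rho> by (simp add: l_def)
      have "l j * a = \<rho> / (real j + 2)" using a by (simp add: l_def)
      also have "\<dots> \<le> \<rho> / 1" using \<rho> by (intro divide_left_mono) auto
      finally show "l j * a < R" using \<rho> by simp
    qed
    let ?F = "\<lambda>j \<zeta>. (f (complex_of_real (l j) *\<^sub>C (y + \<zeta> *\<^sub>C e)) -
      (\<Sum>i<n. homogeneous_part f i (y + \<zeta> *\<^sub>C e) * complex_of_real (l j) ^ i)) / complex_of_real (l j) ^ n"
    have hol: "?F j holomorphic_on ball 0 A" for j
    proof -
      let ?l = "complex_of_real (l j)"
      have "(\<lambda>\<zeta>. f (?l *\<^sub>C y + \<zeta> *\<^sub>C (?l *\<^sub>C e))) holomorphic_on ball 0 A"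
      proof (rule holomorphic_on_subset[OF holomorphic_map_on_affine_line[OF f open_ball]])
        have "norm (?l *\<^sub>C (y + \<zeta> *\<^sub>C e)) < R" if "cmod \<zeta> < A" for \<zeta>
        proof -
          have "l j * norm (y + \<zeta> *\<^sub>C e) \<le> l j * a"
            by (intro mult_left_mono le_a that less_imp_le[OF l(1)])
          also note l(3)
          finally show ?thesis using l(1)[of j] by (simp add: norm_scaleC)
        qed
        then show "ball 0 A \<subseteq> {\<zeta>. ?l *\<^sub>C y + \<zeta> *\<^sub>C (?l *\<^sub>C e) \<in> ball 0 R}"
          by (auto simp: scaleC_add_right scaleC_scaleC mult.commute)
      qed
      then have "(\<lambda>\<zeta>. f (?l *\<^sub>C (y + \<zeta> *\<^sub>C e))) holomorphic_on ball 0 A"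
        by (simp add: scaleC_add_right scaleC_scaleC mult.commute)
      then show ?thesis using l(1)[of j]
        by (intro holomorphic_intros holomorphic_on_subset[OF less.IH]) auto
    qed
    have lim: "uniform_limit (ball 0 A) ?F (\<lambda>\<zeta>. homogeneous_part f n (y + \<zeta> *\<^sub>C e)) sequentially"
    proof (rule uniform_limitI)
      fix \<epsilon> :: real assume "\<epsilon> > 0"
      have bound: "dist (?F j \<zeta>) (homogeneous_part f n (y + \<zeta> *\<^sub>C e)) \<le> M * (a / \<rho>) ^ n / real (Suc j)"
        if \<zeta>: "\<zeta> \<in> ball 0 A" for j \<zeta>
      proof -
        let ?l = "complex_of_real (l j)" and ?w = "y + \<zeta> *\<^sub>C e" and ?q = "1 / (real j + 2)"
        have w: "norm ?w \<le> a" using \<zeta> by (intro le_a) simp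
        have lp: "cmod ?l = l j" using l(1)[of j] by simp
        have "cmod (f (?l *\<^sub>C ?w) - (\<Sum>i<Suc n. homogeneous_part f i ?w * ?l ^ i)) \<le> M * ?q ^ Suc n / (1 - ?q)"
          by (rule power_series_tail_bound[OF homogeneous_part_sums[OF w a] homogeneous_part_bound[OF w a]])
            (use l(2,3)[of j] lp in auto)
        also have "1 - ?q = real (Suc j) * ?q" by (simp add: field_simps)
        also have "M * ?q ^ Suc n / (real (Suc j) * ?q) = M * ?q ^ n / real (Suc j)"
        proof -
          have "M * q ^ Suc n / (r * q) = M * q ^ n / r" if "q \<noteq> 0" for q r :: real
            using that by simp
          moreover have "?q \<noteq> 0" by simp
          ultimately show ?thesis by blast
        qed
        also have "?q ^ n = (a / \<rho>) ^ n * l j ^ n" by (simp only: l(2)[symmetric] power_mult_distrib)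
        finally have le: "cmod (f (?l *\<^sub>C ?w) - (\<Sum>i<Suc n. homogeneous_part f i ?w * ?l ^ i))
            \<le> M * ((a / \<rho>) ^ n * l j ^ n) / real (Suc j)" .
        have "?F j \<zeta> - homogeneous_part f n ?w =
            (f (?l *\<^sub>C ?w) - (\<Sum>i<Suc n. homogeneous_part f i ?w * ?l ^ i)) / ?l ^ n"
          using l(1)[of j] by (simp add: field_simps)
        then have "dist (?F j \<zeta>) (homogeneous_part f n ?w) =
            cmod (f (?l *\<^sub>C ?w) - (\<Sum>i<Suc n. homogeneous_part f i ?w * ?l ^ i)) / l j ^ n"
          by (simp add: dist_norm norm_divide norm_power abs_of_pos[OF l(1)])
        also have "\<dots> \<le> (M * ((a / \<rho>) ^ n * l j ^ n) / real (Suc j)) / l j ^ n"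
          using le l(1)[of j] by (intro divide_right_mono) auto
        also have "\<dots> = M * (a / \<rho>) ^ n / real (Suc j)" using l(1)[of j] by simp
        finally show ?thesis .
      qed
      have "(\<lambda>j. M * (a / \<rho>) ^ n / real (Suc j)) \<longlonglongrightarrow> 0"
        by (rule LIMSEQ_Suc[OF lim_const_over_n])
      then have "\<forall>\<^sub>F j in sequentially. M * (a / \<rho>) ^ n / real (Suc j) < \<epsilon>"
        using \<open>\<epsilon> > 0\<close> by (rule order_tendstoD(2))
      then show "\<forall>\<^sub>F j in sequentially. \<forall>\<zeta>\<in>ball 0 A. dist (?F j \<zeta>) (homogeneous_part f n (y + \<zeta> *\<^sub>C e)) < \<epsilon>"
        by eventually_elim (use bound in \<open>blast intro: le_less_trans\<close>)
    qed
    show ?thesis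
    proof (rule holomorphic_uniform_sequence[OF open_ball hol])
      fix x :: complex assume "x \<in> ball 0 A"
      then obtain d where d: "d > 0" "cball x d \<subseteq> ball 0 A" 
        using open_ball[of 0 A] unfolding open_contains_cball by blast
      then show "\<exists>d>0. cball x d \<subseteq> ball 0 A \<and>
          uniform_limit (cball x d) ?F (\<lambda>\<zeta>. homogeneous_part f n (y + \<zeta> *\<^sub>C e)) sequentially"
        using uniform_limit_on_subset[OF lim] by blast
    qed
  qed
  then have "(\<lambda>\<zeta>. homogeneous_part f n (y + \<zeta> *\<^sub>C e)) holomorphic_on ball 0 (cmod z + 1)" for z
    by (simp add: add_nonneg_pos)
  then have "(\<lambda>\<zeta>. homogeneous_part f n (y + \<zeta> *\<^sub>C e)) field_differentiable at z" for z
    by (metis centre_in_ball dist_0_norm holomorphic_on_imp_differentiable_at less_add_one mem_ball open_ball)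
  then show ?case by (simp add: holomorphic_on_def)
qed

text \<open>In each coordinate the \<open>n\<close>-th part is entire and grows at most like the \<open>n\<close>-th power, so it is a
  polynomial of degree at most \<open>n\<close> by Liouville's theorem.\<close>

lemma homogeneous_part_polyfun: "homogeneous_part f n \<in> polyfuns"
proof (rule separately_polynomial_imp_polyfun[of UNIV _ n])
  fix i y
  let ?y = "vec_upd y i 0" and ?e = "axis i 1 :: complex ^ 'm"
  let ?g = "\<lambda>\<zeta>. homogeneous_part f n (?y + \<zeta> *\<^sub>C ?e)"
  have upd: "vec_upd y i \<zeta> = ?y + \<zeta> *\<^sub>C ?e" for \<zeta>
    by (simp add: vec_upd_def scaleC_vec_def scaleC_complex_def axis_def vec_eq_iff)
  have M0: "0 \<le> M" by (rule order_trans[OF norm_ge_zero bounded_by[rule_format, of 0]]) (use \<rho> in simp)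
  have bound: "cmod (?g \<zeta>) \<le> M * ((norm ?y + norm ?e + 1) / \<rho>) ^ n * cmod \<zeta> ^ n" if "1 \<le> cmod \<zeta>" for \<zeta>
  proof -
    let ?a = "norm ?y + cmod \<zeta> * norm ?e + 1"
    have "cmod (?g \<zeta>) \<le> M * (?a / \<rho>) ^ n"
    proof (rule homogeneous_part_bound)
      have "norm (?y + \<zeta> *\<^sub>C ?e) \<le> norm ?y + cmod \<zeta> * norm ?e"
        by (rule order_trans[OF norm_triangle_ineq]) (simp add: norm_scaleC)
      then show "norm (?y + \<zeta> *\<^sub>C ?e) \<le> ?a" by simp
    qed (simp add: add_nonneg_pos)
    also have "?a \<le> (norm ?y + norm ?e + 1) * cmod \<zeta>"
      using that mult_left_mono[OF that, of "norm ?y"] by (simp add: algebra_simps)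
    then have "M * (?a / \<rho>) ^ n \<le> M * ((norm ?y + norm ?e + 1) * cmod \<zeta> / \<rho>) ^ n"
      using M0 \<rho> by (intro mult_left_mono power_mono divide_right_mono) auto
    also have "\<dots> = M * ((norm ?y + norm ?e + 1) / \<rho>) ^ n * cmod \<zeta> ^ n"
      by (simp add: power_mult_distrib power_divide)
    finally show ?thesis .
  qed
  define P where "P = (\<Sum>k\<le>n. monom ((deriv ^^ k) ?g 0 / fact k) k)"
  have deg: "degree P \<le> n"
    unfolding P_def by (intro degree_sum_le) (auto intro: order_trans[OF degree_monom_le])
  have "homogeneous_part f n (vec_upd y i \<zeta>) = poly P \<zeta>" for \<zeta>
  proof -
    have "homogeneous_part f n (vec_upd y i \<zeta>) = ?g \<zeta>" by (rule arg_cong[OF upd])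
    also have "\<dots> = (\<Sum>k\<le>n. (deriv ^^ k) ?g 0 / fact k * \<zeta> ^ k)"
      by (rule Liouville_polynomial[OF homogeneous_part_line_holomorphic bound])
    also have "\<dots> = poly P \<zeta>" by (simp only: P_def poly_sum poly_monom)
    finally show ?thesis .
  qed
  with deg show "\<exists>P. degree P \<le> n \<and> (\<forall>\<zeta>. homogeneous_part f n (vec_upd y i \<zeta>) = poly P \<zeta>)"
    by blast
next
  fix y y' :: "complex ^ 'm"
  assume "\<And>i. i \<in> UNIV \<Longrightarrow> y $ i = y' $ i"
  then have "y = y'" by (simp add: vec_eq_iff)
  then show "homogeneous_part f n y = homogeneous_part f n y'" by simp
qed simp

end

lemma holomorphic_map_on_imp_continuous_on:
  "holomorphic_map_on f S \<Longrightarrow> continuous_on S f"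
  unfolding holomorphic_map_on_def continuous_on_eq_continuous_within
  using has_derivative_continuous by blast

text \<open>The partial sums of the homogeneous expansion converge geometrically on the closed unit ball,
  because \<open>f\<close> is bounded on a ball of radius \<open>\<rho> > 1\<close>.\<close>

theorem holomorphic_polynomial_approximation:
  fixes f :: "complex ^ 'm::finite \<Rightarrow> complex"
  assumes f: "holomorphic_map_on f (ball 0 R)" and "1 < R" "0 < \<epsilon>"
  shows "\<exists>P\<in>polyfuns. \<forall>z\<in>cball 0 1. cmod (f z - P z) \<le> \<epsilon>"
proof -
  define \<rho> where "\<rho> = (1 + R) / 2"
  have \<rho>: "1 < \<rho>" "\<rho> < R" using \<open>1 < R\<close> by (auto simp: \<rho>_def)
  have "continuous_on (cball 0 \<rho>) f"
    using holomorphic_map_on_imp_continuous_on[OF f] by (rule continuous_on_subset) (use \<rho> in auto)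
  then have "bounded (f ` cball 0 \<rho>)"
    by (intro compact_imp_bounded compact_continuous_image) auto
  then obtain M where M: "\<forall>z\<in>cball 0 \<rho>. cmod (f z) \<le> M"
    unfolding bounded_iff by auto
  have "(\<lambda>n. M * (1 / \<rho>) ^ n / (1 - 1 / \<rho>)) \<longlonglongrightarrow> M * 0 / (1 - 1 / \<rho>)"
    using \<rho> by (intro tendsto_intros LIMSEQ_realpow_zero) auto
  then have "\<forall>\<^sub>F n in sequentially. M * (1 / \<rho>) ^ n / (1 - 1 / \<rho>) < \<epsilon>"
    using \<open>0 < \<epsilon>\<close> by (intro order_tendstoD(2)) auto
  then obtain n where n: "M * (1 / \<rho>) ^ n / (1 - 1 / \<rho>) < \<epsilon>"
    by (auto simp: eventually_sequentially)
  have *: "0 < \<rho>" using \<rho> by simp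
  note hp = homogeneous_part_sums[OF f * \<rho>(2) M] homogeneous_part_bound[OF f * \<rho>(2) M]
    homogeneous_part_polyfun[OF f * \<rho>(2) M]
  have "(\<lambda>z. \<Sum>i<n. homogeneous_part f i z) \<in> polyfuns" by (intro polyfuns_sum hp(3))
  moreover have "cmod (f z - (\<Sum>i<n. homogeneous_part f i z)) \<le> \<epsilon>" if z: "z \<in> cball 0 1" for z
  proof -
    have z1: "norm z \<le> 1" "(0::real) < 1" "cmod 1 * 1 < R" using z \<rho> by auto
    have "cmod (f (1 *\<^sub>C z) - (\<Sum>i<n. homogeneous_part f i z * 1 ^ i)) \<le> M * (1 / \<rho>) ^ n / (1 - 1 / \<rho>)"
      by (rule power_series_tail_bound[OF hp(1)[OF z1] hp(2)[OF z1(1,2)]]) (use \<rho> in auto)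
    then show ?thesis using n by (simp add: scaleC_one)
  qed
  ultimately show ?thesis
    by (intro bexI[of _ "\<lambda>z. \<Sum>i<n. homogeneous_part f i z"] ballI)
qed

section \<open>Multi-index sums\<close>

text \<open>The total degree is constrained by a predicate so that the homogeneous case \<open>t = n\<close> and the case
  \<open>t \<le> N\<close> share the splitting of one coordinate below. Entries outside \<open>I\<close> are \<open>0\<close>, which makes the
  representation unique.\<close>

definition multiindices :: "'i set \<Rightarrow> (nat \<Rightarrow> bool) \<Rightarrow> ('i \<Rightarrow> nat) set"
  where "multiindices I P = {\<beta>. (\<forall>i. i \<notin> I \<longrightarrow> \<beta> i = 0) \<and> P (sum \<beta> I)}"

lemma finite_multiindices:
  assumes "finite I" "\<And>t. P t \<Longrightarrow> t \<le> n"
  shows "finite (multiindices I P)"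
proof (rule finite_subset)
  show "multiindices I P \<subseteq> {\<beta>. \<forall>i. (i \<in> I \<longrightarrow> \<beta> i \<in> {..n}) \<and> (i \<notin> I \<longrightarrow> \<beta> i = 0)}"
  proof
    fix \<beta> assume \<beta>: "\<beta> \<in> multiindices I P"
    have "\<beta> i \<le> n" if "i \<in> I" for i
      using member_le_sum[OF that _ assms(1), of \<beta>] assms(2)[of "sum \<beta> I"] \<beta>
      by (simp add: multiindices_def)
    then show "\<beta> \<in> {\<beta>. \<forall>i. (i \<in> I \<longrightarrow> \<beta> i \<in> {..n}) \<and> (i \<notin> I \<longrightarrow> \<beta> i = 0)}"
      using \<beta> by (simp add: multiindices_def)
  qed
  show "finite {\<beta>. \<forall>i. (i \<in> I \<longrightarrow> \<beta> i \<in> {..n}) \<and> (i \<notin> I \<longrightarrow> \<beta> i = 0)}"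
    by (rule finite_set_of_finite_funs[OF assms(1)]) simp
qed

lemma sum_multiindices_insert:
  assumes I: "finite I" "i \<notin> I" and P: "\<And>t. P t \<Longrightarrow> t \<le> n"
  shows "sum g (multiindices (insert i I) P) =
    (\<Sum>j\<le>n. \<Sum>\<beta>\<in>multiindices I (\<lambda>t. P (j + t)). g (\<beta>(i := j)))"
proof -
  have fin: "finite (multiindices I (\<lambda>t. P (j + t)))" for j
    by (rule finite_multiindices[OF I(1), of _ n]) (use P in force)
  have upd: "(\<Sum>x\<in>I. if x = i then j else \<beta> x) = sum \<beta> I" for \<beta> :: "'a \<Rightarrow> nat" and j
    using I(2) by (intro sum.cong) auto
  have "(\<Sum>j\<le>n. \<Sum>\<beta>\<in>multiindices I (\<lambda>t. P (j + t)). g (\<beta>(i := j))) =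
      (\<Sum>(j, \<beta>)\<in>(SIGMA j:{..n}. multiindices I (\<lambda>t. P (j + t))). g (\<beta>(i := j)))"
    by (rule sum.Sigma) (auto intro: fin)
  also have "\<dots> = sum g (multiindices (insert i I) P)"
  proof (rule sum.reindex_bij_witness[where j = "\<lambda>(j, \<beta>). \<beta>(i := j)" and i = "\<lambda>\<gamma>. (\<gamma> i, \<gamma>(i := 0))"])
    fix \<gamma> assume \<gamma>: "\<gamma> \<in> multiindices (insert i I) P"
    then have "P (\<gamma> i + sum \<gamma> I)" using I by (simp add: multiindices_def)
    moreover from P[OF this] have "\<gamma> i \<le> n" by simp
    ultimately show "(\<gamma> i, \<gamma>(i := 0)) \<in> (SIGMA j:{..n}. multiindices I (\<lambda>t. P (j + t)))"
      using \<gamma> by (auto simp: multiindices_def upd)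
  qed (use I in \<open>auto simp: multiindices_def upd fun_eq_iff\<close>)
  finally show ?thesis by simp
qed

lemma multinomial_power:
  fixes x :: "'i \<Rightarrow> complex"
  assumes "finite I"
  shows "(\<Sum>i\<in>I. x i) ^ n / fact n = (\<Sum>\<beta>\<in>multiindices I (\<lambda>t. t = n). \<Prod>i\<in>I. x i ^ \<beta> i / fact (\<beta> i))"
  using assms
proof (induction I arbitrary: n rule: finite_induct)
  case empty
  have "multiindices {} (\<lambda>t. t = n) = (if n = 0 then {\<lambda>_::'i. 0} else {})"
    by (auto simp: multiindices_def)
  then show ?case by (simp add: power_0_left)
next
  case (insert i I)
  let ?s = "\<Sum>i\<in>I. x i"
  have "(\<Sum>j\<in>insert i I. x j) ^ n / fact n = (\<Sum>j\<le>n. x i ^ j / fact j * (?s ^ (n - j) / fact (n - j)))"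
    using insert.hyps by (simp add: binomial_ring sum_divide_distrib)
      (intro sum.cong refl, simp add: binomial_fact field_simps)
  also have "\<dots> = (\<Sum>j\<le>n. \<Sum>\<beta>\<in>multiindices I (\<lambda>t. j + t = n).
      \<Prod>l\<in>insert i I. x l ^ (\<beta>(i := j)) l / fact ((\<beta>(i := j)) l))"
  proof (intro sum.cong refl)
    fix j assume "j \<in> {..n}"
    then have eq: "(\<lambda>t. j + t = n) = (\<lambda>t. t = n - j)" by auto
    have "(\<Prod>l\<in>I. x l ^ (\<beta>(i := j)) l / fact ((\<beta>(i := j)) l)) = (\<Prod>l\<in>I. x l ^ \<beta> l / fact (\<beta> l))" for \<beta>
      using insert.hyps by (intro prod.cong) auto
    then show "x i ^ j / fact j * (?s ^ (n - j) / fact (n - j)) =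
        (\<Sum>\<beta>\<in>multiindices I (\<lambda>t. j + t = n).
          \<Prod>l\<in>insert i I. x l ^ (\<beta>(i := j)) l / fact ((\<beta>(i := j)) l))"
      using insert.hyps by (simp add: eq insert.IH sum_distrib_left)
  qed
  also have "\<dots> = (\<Sum>\<beta>\<in>multiindices (insert i I) (\<lambda>t. t = n). \<Prod>l\<in>insert i I. x l ^ \<beta> l / fact (\<beta> l))"
    by (rule sum_multiindices_insert[OF insert.hyps, symmetric]) simp
  finally show ?case .
qed

lemma choose_convolution: "(\<Sum>j\<le>L. (j choose a) * ((L - j) choose b)) = Suc L choose Suc (a + b)"
proof (induction L arbitrary: b)
  case 0
  then show ?case by (cases a; cases b) auto
next
  case (Suc L)
  show ?case
  proof (cases b)
    case 0
    then show ?thesis using sum_choose_upper[of a "Suc L"] by simp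
  next
    case (Suc b')
    have "(\<Sum>j\<le>Suc L. (j choose a) * ((Suc L - j) choose b)) =
        (\<Sum>j\<le>L. (j choose a) * ((L - j) choose b')) + (\<Sum>j\<le>L. (j choose a) * ((L - j) choose b))"
      by (simp add: Suc Suc_diff_le sum.distrib[symmetric] distrib_left)
    then show ?thesis by (simp only: Suc.IH) (simp add: Suc)
  qed
qed

text \<open>The summands by which the full convolution exceeds this sum vanish, since for them
  \<open>N + q - j < q \<le> b\<close>.\<close>

lemma choose_convolution_shift:
  assumes "q \<le> b"
  shows "(\<Sum>j\<le>N. (j choose a) * ((N - j + q) choose b)) = Suc (N + q) choose Suc (a + b)"
proof -
  have "(\<Sum>j\<le>N. (j choose a) * ((N - j + q) choose b)) = (\<Sum>j\<le>N + q. (j choose a) * ((N + q - j) choose b))"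
  proof (rule sum.mono_neutral_cong_left)
    show "\<forall>j\<in>{..N + q} - {..N}. (j choose a) * (N + q - j choose b) = 0"
      using assms by (auto intro!: binomial_eq_0)
  qed auto
  then show ?thesis using choose_convolution[of a "N + q" b] by simp
qed

text \<open>Up to normalisation, these are the factorial moments of the uniform distribution on the
  compositions of \<open>N\<close> into \<open>card I + s + 1\<close> parts, the parts outside \<open>I\<close> having been summed out.\<close>

lemma composition_factorial_moment:
  assumes "finite I"
  shows "(\<Sum>n\<in>multiindices I (\<lambda>t. t \<le> N). (\<Prod>i\<in>I. n i choose \<alpha> i) * ((N - sum n I + s) choose s)) =
    (N + s + card I) choose (s + card I + sum \<alpha> I)"
  using assms
proof (induction I arbitrary: N rule: finite_induct)
  case empty
  have "multiindices {} (\<lambda>t. t \<le> N) = {\<lambda>_::'a. 0}" by (auto simp: multiindices_def)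
  then show ?case by simp
next
  case (insert i I)
  let ?F = "\<lambda>n. (\<Prod>l\<in>insert i I. n l choose \<alpha> l) * ((N - sum n (insert i I) + s) choose s)"
  have "sum ?F (multiindices (insert i I) (\<lambda>t. t \<le> N)) =
      (\<Sum>j\<le>N. \<Sum>n\<in>multiindices I (\<lambda>t. j + t \<le> N). ?F (n(i := j)))"
    by (rule sum_multiindices_insert[OF insert.hyps]) simp
  also have "\<dots> = (\<Sum>j\<le>N. (j choose \<alpha> i) * ((N - j + (s + card I)) choose (s + card I + sum \<alpha> I)))"
  proof (intro sum.cong refl)
    fix j assume j: "j \<in> {..N}"
    then have eq: "(\<lambda>t. j + t \<le> N) = (\<lambda>t. t \<le> N - j)" by auto
    have upd: "(\<Sum>x\<in>I. if x = i then j else n x) = sum n I"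
        "(\<Prod>l\<in>I. (if l = i then j else n l) choose \<alpha> l) = (\<Prod>l\<in>I. n l choose \<alpha> l)" for n
      using insert.hyps by (auto intro!: sum.cong prod.cong)
    have "(\<Sum>n\<in>multiindices I (\<lambda>t. j + t \<le> N). ?F (n(i := j))) = (j choose \<alpha> i) *
        (\<Sum>n\<in>multiindices I (\<lambda>t. t \<le> N - j). (\<Prod>l\<in>I. n l choose \<alpha> l) * ((N - j - sum n I + s) choose s))"
      using insert.hyps by (simp add: eq upd sum_distrib_left mult.assoc)
    then show "(\<Sum>n\<in>multiindices I (\<lambda>t. j + t \<le> N). ?F (n(i := j))) =
        (j choose \<alpha> i) * ((N - j + (s + card I)) choose (s + card I + sum \<alpha> I))"
      by (simp only: insert.IH add.assoc)
  qed
  also have "\<dots> = Suc (N + (s + card I)) choose Suc (\<alpha> i + (s + card I + sum \<alpha> I))"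
    by (rule choose_convolution_shift) simp
  finally show ?case using insert.hyps by (simp add: ac_simps)
qed

section \<open>A finite quadrature on the ball\<close>

lemma root_of_unity_orthogonality:
  fixes a b M :: nat
  assumes "a < M" "b < M"
  defines "\<omega> \<equiv> exp (2 * of_real pi * \<i> / of_nat M)"
  shows "(\<Sum>l<M. (\<omega> ^ l) ^ a * cnj ((\<omega> ^ l) ^ b)) = (if a = b then of_nat M else 0)"
proof -
  define x where "x = \<omega> ^ a * cnj (\<omega> ^ b)"
  have norm1: "cmod (\<omega> ^ j) = 1" for j
    by (simp add: \<omega>_def norm_power)
  have cnj1: "\<omega> ^ j * cnj (\<omega> ^ j) = 1" for j
    unfolding complex_norm_square[symmetric] norm1 by simp
  have pow: "\<omega> ^ j = exp (2 * of_real pi * \<i> * of_nat j / of_nat M)" for j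
    by (simp add: \<omega>_def exp_of_nat_mult[symmetric] mult_ac)
  have \<omega>M: "\<omega> ^ M = 1" using assms(1) by (simp add: pow)
  have eq: "(\<omega> ^ l) ^ a * cnj ((\<omega> ^ l) ^ b) = x ^ l" for l
    by (simp add: x_def power_mult_distrib power_mult[symmetric] mult.commute)
  show ?thesis
  proof (cases "a = b")
    case True
    then have "x = 1" using cnj1 by (simp add: x_def)
    then show ?thesis unfolding eq using True by simp
  next
    case False
    have "x \<noteq> 1"
    proof
      assume "x = 1"
      have "\<omega> ^ a = \<omega> ^ a * (\<omega> ^ b * cnj (\<omega> ^ b))" by (simp only: cnj1 mult_1_right)
      also have "\<dots> = \<omega> ^ b * x" unfolding x_def by (rule mult.left_commute)
      finally have "\<omega> ^ a = \<omega> ^ b" using \<open>x = 1\<close> by simp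
      then have "a mod M = b mod M"
        using complex_root_unity_eq[of M a b] assms(1) unfolding pow by (simp add: cong_def)
      then show False using False assms by simp
    qed
    moreover have "x ^ M = 1"
    proof -
      have "x ^ M = (\<omega> ^ M) ^ a * cnj ((\<omega> ^ M) ^ b)"
        by (simp add: x_def power_mult_distrib power_mult[symmetric] mult.commute)
      then show ?thesis by (simp add: \<omega>M)
    qed
    ultimately have "(\<Sum>l<M. x ^ l) = 0" by (simp add: geometric_sum)
    then show ?thesis unfolding eq using False by simp
  qed
qed

text \<open>The factorial moments are exact, whereas squared moduli of nodes involve ordinary powers. Comparing
  the products factor by factor, with all factors in the unit interval, costs only \<open>O(1 / N)\<close>.\<close>

lemma power_falling_diff:
  fixes n N a :: nat
  assumes "n \<le> N" "N > 0"
  shows "\<bar>(real n / real N) ^ a - fact a * real (n choose a) / real N ^ a\<bar> \<le> (real a)\<^sup>2 / real N"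
    and "\<bar>fact a * real (n choose a) / real N ^ a\<bar> \<le> 1"
proof -
  have falling: "fact a * real (n choose a) = (\<Prod>l<a. real (n - l))"
  proof (cases "a \<le> n")
    case True
    have "fact a * real (n choose a) = (\<Prod>l = 0..<a. real n - real l)"
      by (simp add: binomial_gbinomial gbinomial_mult_fact)
    also have "\<dots> = (\<Prod>l<a. real (n - l))"
      unfolding lessThan_atLeast0 by (intro prod.cong refl) (use True in auto)
    finally show ?thesis .
  next
    case False
    then have "(\<Prod>l<a. real (n - l)) = 0" by (intro prod_zero) auto
    then show ?thesis using False by (simp add: binomial_eq_0)
  qed
  have fall: "fact a * real (n choose a) / real N ^ a = (\<Prod>l<a. real (n - l) / real N)"
    unfolding falling by (simp add: prod_dividef)
  have pw: "(real n / real N) ^ a = (\<Prod>l<a. real n / real N)" by simp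
  have le1: "norm (real n / real N) \<le> 1" "norm (real (n - l) / real N) \<le> 1" for l
    using assms by auto
  have "norm ((\<Prod>l<a. real n / real N) - (\<Prod>l<a. real (n - l) / real N)) \<le>
      (\<Sum>l<a. norm (real n / real N - real (n - l) / real N))"
    by (rule norm_prod_diff) (use le1 in auto)
  also have "\<dots> \<le> (\<Sum>l<a. real a / real N)"
  proof (rule sum_mono)
    fix l assume "l \<in> {..<a}"
    then have "\<bar>real n - real (n - l)\<bar> \<le> real a" by auto
    then show "norm (real n / real N - real (n - l) / real N) \<le> real a / real N"
      using assms(2) by (simp add: diff_divide_distrib[symmetric] divide_right_mono)
  qed
  finally show "\<bar>(real n / real N) ^ a - fact a * real (n choose a) / real N ^ a\<bar> \<le> (real a)\<^sup>2 / real N"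
    unfolding fall pw by (simp add: power2_eq_square)
  show "\<bar>fact a * real (n choose a) / real N ^ a\<bar> \<le> 1"
    unfolding fall abs_prod using le1(2) by (intro prod_le_1) auto
qed

lemma choose_over_power_tendsto:
  "(\<lambda>N. fact d * real (N choose d) / real N ^ d) \<longlonglongrightarrow> 1"
proof -
  have "(\<lambda>N. (real N / real N) ^ d - fact d * real (N choose d) / real N ^ d) \<longlonglongrightarrow> 0"
  proof (rule Lim_null_comparison)
    show "\<forall>\<^sub>F N in sequentially. norm ((real N / real N) ^ d - fact d * real (N choose d) / real N ^ d)
        \<le> (real d)\<^sup>2 / real N"
      using eventually_gt_at_top[of 0]
      by eventually_elim (use power_falling_diff(1)[OF order_refl] in \<open>simp only: real_norm_def\<close>)
    show "(\<lambda>N. (real d)\<^sup>2 / real N) \<longlonglongrightarrow> 0" by (rule lim_const_over_n)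
  qed
  then have "(\<lambda>N. 1 - fact d * real (N choose d) / real N ^ d) \<longlonglongrightarrow> 0"
    by (rule Lim_transform_eventually) (rule eventually_sequentiallyI[of 1], simp)
  from tendsto_diff[OF tendsto_const[of 1] this] show ?thesis by simp
qed

text \<open>A pair \<open>(n, a)\<close> encodes the point with coordinates \<open>\<surd>(n i / N) \<omega>\<^bsup>a i\<^esup>\<close>, where \<open>\<omega>\<close> is a root of unity of
  order \<open>N + 1\<close>. The squared moduli run over the first \<open>m\<close> parts of the compositions of \<open>N\<close> into
  \<open>m + s + 1\<close> parts, divided by \<open>N\<close>, and the binomial coefficient in the weight counts the
  compositions with given first parts. For large \<open>N\<close> the squared moduli have a Dirichlet
  distribution, and the averages approximate integration against the normalised measure
  \<open>(1 - \<parallel>z\<parallel>\<^sup>2)\<^sup>s dz\<close> on the ball.\<close>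

definition quad_index :: "nat \<Rightarrow> (('m::finite \<Rightarrow> nat) \<times> ('m \<Rightarrow> nat)) set"
  where "quad_index N = multiindices UNIV (\<lambda>t. t \<le> N) \<times> (UNIV \<rightarrow>\<^sub>E {..<Suc N})"

definition quad_weight :: "nat \<Rightarrow> nat \<Rightarrow> ('m::finite \<Rightarrow> nat) \<times> ('m \<Rightarrow> nat) \<Rightarrow> real"
  where "quad_weight s N x = real ((N - sum (fst x) UNIV + s) choose s) /
    (real ((N + s + CARD('m)) choose (s + CARD('m))) * real (Suc N) ^ CARD('m))"

definition quad_node :: "nat \<Rightarrow> ('m::finite \<Rightarrow> nat) \<times> ('m \<Rightarrow> nat) \<Rightarrow> complex ^ 'm"
  where "quad_node N x = (\<chi> i. of_real (sqrt (real (fst x i) / real N)) *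
    exp (2 * of_real pi * \<i> / of_nat (Suc N)) ^ snd x i)"

definition quad :: "nat \<Rightarrow> nat \<Rightarrow> (complex ^ 'm::finite \<Rightarrow> complex) \<Rightarrow> complex"
  where "quad s N F = (\<Sum>x\<in>quad_index N. of_real (quad_weight s N x) * F (quad_node N x))"

lemma finite_multiindices_le: "finite (multiindices (UNIV :: 'm::finite set) (\<lambda>t. t \<le> N))"
  by (rule finite_multiindices[where n = N]) auto

lemma quad_weight_nonneg: "0 \<le> quad_weight s N x"
  by (simp add: quad_weight_def)

lemma sum_quad_weight:
  "(\<Sum>x\<in>quad_index N. quad_weight s N (x :: ('m::finite \<Rightarrow> nat) \<times> ('m \<Rightarrow> nat))) = 1"
proof -
  let ?Z = "real ((N + s + CARD('m)) choose (s + CARD('m)))"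
  have pos: "?Z > 0" by simp
  have "(\<Sum>n\<in>multiindices (UNIV :: 'm set) (\<lambda>t. t \<le> N). (N - sum n UNIV + s) choose s) =
      (N + s + CARD('m)) choose (s + CARD('m))"
    using composition_factorial_moment[where I = "UNIV :: 'm set" and N = N and \<alpha> = "\<lambda>_. 0" and s = s, OF finite] by simp
  then have Z: "(\<Sum>n\<in>multiindices (UNIV :: 'm set) (\<lambda>t. t \<le> N). real ((N - sum n UNIV + s) choose s)) = ?Z"
    by (metis of_nat_sum)
  have "(\<Sum>x\<in>quad_index N. quad_weight s N (x :: ('m \<Rightarrow> nat) \<times> ('m \<Rightarrow> nat))) =
      (\<Sum>n\<in>multiindices (UNIV :: 'm set) (\<lambda>t. t \<le> N). \<Sum>a\<in>(UNIV :: 'm set) \<rightarrow>\<^sub>E {..<Suc N}.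
        real ((N - sum n UNIV + s) choose s) / (?Z * real (Suc N) ^ CARD('m)))"
    unfolding quad_index_def sum.cartesian_product quad_weight_def
    by (intro sum.cong refl) auto
  also have "\<dots> = (\<Sum>n\<in>multiindices (UNIV :: 'm set) (\<lambda>t. t \<le> N). real ((N - sum n UNIV + s) choose s)) / ?Z"
    by (simp add: card_PiE sum_divide_distrib del: of_nat_Suc)
  finally show ?thesis using pos unfolding Z by simp
qed

lemma quad_node_in_cball:
  assumes "x \<in> quad_index N"
  shows "norm (quad_node N x) \<le> 1"
proof -
  have le: "sum (fst x) UNIV \<le> N" using assms by (auto simp: quad_index_def multiindices_def)
  have "(norm (quad_node N x))\<^sup>2 = (\<Sum>i\<in>UNIV. (norm (quad_node N x $ i))\<^sup>2)"
    by (simp add: norm_vec_def L2_set_def sum_nonneg)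
  also have "\<dots> = (\<Sum>i\<in>UNIV. real (fst x i) / real N)"
    by (simp add: quad_node_def norm_mult norm_power)
  also have "\<dots> = real (sum (fst x) UNIV) / real N" by (simp add: sum_divide_distrib)
  also have "\<dots> \<le> 1" using le by (auto simp: divide_le_eq_1 simp del: of_nat_sum)
  finally show ?thesis by (simp add: power_le_one_iff abs_square_le_1)
qed

lemma quad_sum: "quad s N (\<lambda>z. \<Sum>i\<in>I. F i z) = (\<Sum>i\<in>I. quad s N (F i))"
  unfolding quad_def sum_distrib_left by (rule sum.swap)

lemma quad_add: "quad s N (\<lambda>z. F z + G z) = quad s N F + quad s N G"
  by (simp add: quad_def distrib_left sum.distrib)

lemma quad_cmult: "quad s N (\<lambda>z. c * F z) = c * quad s N F"
  by (simp add: quad_def sum_distrib_left mult.left_commute)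

lemma quad_diff: "quad s N (\<lambda>z. F z - G z) = quad s N F - quad s N G"
  by (simp add: quad_def right_diff_distrib sum_subtractf)

lemma norm_quad_le:
  fixes F :: "complex ^ 'm::finite \<Rightarrow> complex"
  assumes "\<And>z. norm z \<le> 1 \<Longrightarrow> cmod (F z) \<le> B"
  shows "cmod (quad s N F) \<le> B"
proof -
  have "cmod (quad s N F) \<le>
      (\<Sum>x\<in>quad_index N. quad_weight s N (x :: ('m \<Rightarrow> nat) \<times> ('m \<Rightarrow> nat)) * B)"
    unfolding quad_def
    by (rule sum_norm_le) (auto simp: norm_mult quad_weight_nonneg intro!: mult_left_mono assms quad_node_in_cball)
  also have "\<dots> = B" by (simp add: sum_distrib_right[symmetric] sum_quad_weight)
  finally show ?thesis .
qed

lemma quad_tendsto_by_approximation: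
  assumes "\<And>\<epsilon>. \<epsilon> > 0 \<Longrightarrow> \<exists>G l'. (\<forall>z. norm z \<le> 1 \<longrightarrow> cmod (F z - G z) \<le> \<epsilon>) \<and> cmod (l' - l) \<le> \<epsilon> \<and>
    (\<lambda>N. quad s N G) \<longlonglongrightarrow> l'"
  shows "(\<lambda>N. quad s N F) \<longlonglongrightarrow> l"
proof (rule tendstoI)
  fix e :: real assume e: "e > 0"
  obtain G l' where G: "\<And>z. norm z \<le> 1 \<Longrightarrow> cmod (F z - G z) \<le> e / 4" and l': "cmod (l' - l) \<le> e / 4"
    and lim: "(\<lambda>N. quad s N G) \<longlonglongrightarrow> l'"
    using assms[of "e / 4"] e by auto
  have "\<forall>\<^sub>F N in sequentially. dist (quad s N G) l' < e / 4"
    using lim e by (intro tendstoD) auto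
  then show "\<forall>\<^sub>F N in sequentially. dist (quad s N F) l < e"
  proof eventually_elim
    case (elim N)
    have "cmod (quad s N F - quad s N G) \<le> e / 4"
      unfolding quad_diff[symmetric] by (rule norm_quad_le) (rule G)
    moreover have "quad s N F - l = (quad s N F - quad s N G) + (quad s N G - l') + (l' - l)" by simp
    ultimately show ?case
      using elim l' e norm_triangle_ineq[of "(quad s N F - quad s N G) + (quad s N G - l')" "l' - l"]
        norm_triangle_ineq[of "quad s N F - quad s N G" "quad s N G - l'"]
      by (simp add: dist_norm)
  qed
qed

definition radial_moment :: "nat \<Rightarrow> nat \<Rightarrow> ('m::finite \<Rightarrow> nat) \<Rightarrow> real"
  where "radial_moment s N \<alpha> = (\<Sum>n\<in>multiindices (UNIV :: 'm set) (\<lambda>t. t \<le> N).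
    real ((N - sum n UNIV + s) choose s) / real ((N + s + CARD('m)) choose (s + CARD('m))) *
    (\<Prod>i\<in>UNIV. (real (n i) / real N) ^ \<alpha> i))"

text \<open>The limit is the squared norm of the monomial in the space with kernel \<open>(1 - \<langle>z, w\<rangle>)\<^bsup>-(K + 1)\<^esup>\<close>. It is
  exact for factorial moments, up to the factor \<open>d! (N choose d) / N\<^sup>d\<close>, which tends to \<open>1\<close>.\<close>

lemma radial_moment_tendsto:
  fixes \<alpha> :: "'m::finite \<Rightarrow> nat" and s :: nat
  defines "K \<equiv> s + CARD('m)" and "d \<equiv> sum \<alpha> UNIV"
  shows "(\<lambda>N. radial_moment s N \<alpha>) \<longlonglongrightarrow> (\<Prod>i\<in>UNIV. fact (\<alpha> i)) * fact K / fact (K + d)"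
proof -
  let ?S = "\<lambda>N. multiindices (UNIV :: 'm set) (\<lambda>t. t \<le> N)"
  let ?W = "\<lambda>N n. real ((N - sum n (UNIV :: 'm set) + s) choose s) / real ((N + K) choose K)"
  let ?a = "\<Prod>i\<in>UNIV. fact (\<alpha> i) :: real"
  \<comment> \<open>the factorial moments, with \<open>\<alpha>! (n choose \<alpha>)\<close> in place of \<open>n\<^bsup>\<alpha>\<^esup>\<close>\<close>
  define E' where "E' N = (\<Sum>n\<in>?S N. ?W N n * (\<Prod>i\<in>UNIV. fact (\<alpha> i) * real (n i choose \<alpha> i) / real N ^ \<alpha> i))" for N
  have W: "(\<Sum>n\<in>?S N. ?W N n) = 1" for N
  proof -
    have "(\<Sum>n\<in>?S N. real ((N - sum n UNIV + s) choose s)) = real ((N + K) choose K)"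
      using composition_factorial_moment[where I = "UNIV :: 'm set" and N = N and \<alpha> = "\<lambda>_. 0" and s = s, OF finite]
      by (simp add: K_def add.assoc flip: of_nat_sum)
    then show ?thesis by (simp add: sum_divide_distrib[symmetric])
  qed
  have "(\<lambda>N. radial_moment s N \<alpha> - E' N) \<longlonglongrightarrow> 0"
  proof (rule Lim_null_comparison)
    show "(\<lambda>N. (\<Sum>i\<in>UNIV. (real (\<alpha> i))\<^sup>2) / real N) \<longlonglongrightarrow> 0" by (rule lim_const_over_n)
    show "\<forall>\<^sub>F N in sequentially. norm (radial_moment s N \<alpha> - E' N) \<le> (\<Sum>i\<in>UNIV. (real (\<alpha> i))\<^sup>2) / real N"
      using eventually_gt_at_top[of 0]
    proof eventually_elim
      case (elim N)
      have bound: "\<bar>(\<Prod>i\<in>UNIV. (real (n i) / real N) ^ \<alpha> i) - (\<Prod>i\<in>UNIV. fact (\<alpha> i) * real (n i choose \<alpha> i) / real N ^ \<alpha> i)\<bar>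
          \<le> (\<Sum>i\<in>UNIV. (real (\<alpha> i))\<^sup>2) / real N" if n: "n \<in> ?S N" for n
      proof -
        have le: "n i \<le> N" for i
          using n member_le_sum[of i UNIV n] by (auto simp: multiindices_def)
        have "norm ((\<Prod>i\<in>UNIV. (real (n i) / real N) ^ \<alpha> i) - (\<Prod>i\<in>UNIV. fact (\<alpha> i) * real (n i choose \<alpha> i) / real N ^ \<alpha> i))
            \<le> (\<Sum>i\<in>UNIV. norm ((real (n i) / real N) ^ \<alpha> i - fact (\<alpha> i) * real (n i choose \<alpha> i) / real N ^ \<alpha> i))"
        proof (rule norm_prod_diff)
          fix i
          show "norm ((real (n i) / real N) ^ \<alpha> i) \<le> 1"
            using le[of i] elim by (simp add: norm_power power_le_one_iff abs_le_iff power_le_one)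
          show "norm (fact (\<alpha> i) * real (n i choose \<alpha> i) / real N ^ \<alpha> i) \<le> 1"
            using power_falling_diff(2)[OF le elim] by simp
        qed
        also have "\<dots> \<le> (\<Sum>i\<in>UNIV. (real (\<alpha> i))\<^sup>2 / real N)"
          unfolding real_norm_def by (intro sum_mono power_falling_diff(1) le elim)
        finally show ?thesis by (simp add: sum_divide_distrib)
      qed
      have eq: "radial_moment s N \<alpha> - E' N = (\<Sum>n\<in>?S N. ?W N n * ((\<Prod>i\<in>UNIV. (real (n i) / real N) ^ \<alpha> i) -
          (\<Prod>i\<in>UNIV. fact (\<alpha> i) * real (n i choose \<alpha> i) / real N ^ \<alpha> i)))"
        unfolding radial_moment_def E'_def right_diff_distrib sum_subtractf by (simp add: K_def add.assoc)
      have "norm (radial_moment s N \<alpha> - E' N) \<le> (\<Sum>n\<in>?S N. ?W N n * ((\<Sum>i\<in>UNIV. (real (\<alpha> i))\<^sup>2) / real N))"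
        unfolding eq
      proof (rule sum_norm_le)
        fix n assume "n \<in> ?S N"
        then show "norm (?W N n * ((\<Prod>i\<in>UNIV. (real (n i) / real N) ^ \<alpha> i) -
            (\<Prod>i\<in>UNIV. fact (\<alpha> i) * real (n i choose \<alpha> i) / real N ^ \<alpha> i)))
            \<le> ?W N n * ((\<Sum>i\<in>UNIV. (real (\<alpha> i))\<^sup>2) / real N)"
          unfolding real_norm_def abs_mult using bound by (intro mult_mono) auto
      qed
      also have "\<dots> = (\<Sum>i\<in>UNIV. (real (\<alpha> i))\<^sup>2) / real N"
        by (simp only: sum_distrib_right[symmetric] W mult_1_left)
      finally show ?case .
    qed
  qed
  moreover have "E' N = ?a * fact K / fact (K + d) * (fact d * real (N choose d) / real N ^ d)" for N
  proof -
    have prod_eq: "(\<Prod>i\<in>UNIV. fact (\<alpha> i) * real (n i choose \<alpha> i) / real N ^ \<alpha> i) =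
        ?a / real N ^ d * real (\<Prod>i\<in>UNIV. n i choose \<alpha> i)" for n
      by (simp add: prod_dividef prod.distrib d_def power_sum)
    have "E' N = ?a / real N ^ d / real ((N + K) choose K) *
        real (\<Sum>n\<in>?S N. (\<Prod>i\<in>UNIV. n i choose \<alpha> i) * ((N - sum n UNIV + s) choose s))"
      unfolding E'_def prod_eq of_nat_sum sum_distrib_left
      by (intro sum.cong refl) (simp add: field_simps)
    also have "(\<Sum>n\<in>?S N. (\<Prod>i\<in>UNIV. n i choose \<alpha> i) * ((N - sum n UNIV + s) choose s)) = (N + K) choose (K + d)"
      using composition_factorial_moment[where I = "UNIV :: 'm set" and N = N and \<alpha> = \<alpha> and s = s, OF finite] by (simp add: K_def d_def add.assoc)
    also have "real ((N + K) choose (K + d)) = real ((N + K) choose K) * (fact K * fact d * real (N choose d) / fact (K + d))"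
    proof (cases "d \<le> N")
      case True
      have "((N + K) choose (K + d)) * ((K + d) choose K) = ((N + K) choose K) * (N choose d)"
        using choose_mult[of K "K + d" "N + K"] True by simp
      then have "real ((N + K) choose (K + d)) * real ((K + d) choose K) = real ((N + K) choose K) * real (N choose d)"
        by (metis of_nat_mult)
      moreover have "real ((K + d) choose K) = fact (K + d) / (fact K * fact d)"
        by (simp add: binomial_fact)
      ultimately show ?thesis by (simp add: field_simps)
    qed (simp add: binomial_eq_0)
    finally show ?thesis by (simp add: field_simps)
  qed
  moreover have "(\<lambda>N. ?a * fact K / fact (K + d) * (fact d * real (N choose d) / real N ^ d))
      \<longlonglongrightarrow> ?a * fact K / fact (K + d) * 1"
    by (intro tendsto_mult tendsto_const choose_over_power_tendsto)
  ultimately have "(\<lambda>N. (radial_moment s N \<alpha> - E' N) + E' N) \<longlonglongrightarrow> 0 + ?a * fact K / fact (K + d)"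
    by (intro tendsto_add) simp_all
  then show ?thesis by simp
qed

text \<open>Once \<open>N\<close> exceeds the exponents, averaging over the arguments annihilates all mixed terms.\<close>

lemma quad_monomials:
  fixes \<alpha> \<beta> :: "'m::finite \<Rightarrow> nat"
  assumes N: "sum \<alpha> UNIV + sum \<beta> UNIV \<le> N"
  shows "quad s N (\<lambda>z. monomial_value \<alpha> z * cnj (monomial_value \<beta> z)) =
    (if \<alpha> = \<beta> then of_real (radial_moment s N \<alpha>) else 0)"
proof -
  define \<omega> where "\<omega> = exp (2 * of_real pi * \<i> / of_nat (Suc N))"
  let ?S = "multiindices (UNIV :: 'm set) (\<lambda>t. t \<le> N)"
  let ?Z = "real ((N + s + CARD('m)) choose (s + CARD('m)))"
  let ?r = "\<lambda>n i. of_real (sqrt (real (n i) / real N)) :: complex"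
  let ?h = "\<lambda>n i l. ?r n i ^ (\<alpha> i + \<beta> i) * ((\<omega> ^ l) ^ \<alpha> i * cnj ((\<omega> ^ l) ^ \<beta> i))"
  have lt: "\<alpha> i < Suc N" "\<beta> i < Suc N" for i
    using member_le_sum[of i UNIV \<alpha>] member_le_sum[of i UNIV \<beta>] N by auto
  have node: "monomial_value \<alpha> (quad_node N (n, a)) * cnj (monomial_value \<beta> (quad_node N (n, a))) =
      (\<Prod>i\<in>UNIV. ?h n i (a i))" for n a
    unfolding monomial_value_def quad_node_def cnj_prod prod.distrib[symmetric] \<omega>_def[symmetric]
    by (intro prod.cong refl) (simp add: power_mult_distrib power_add mult_ac)
  have angle: "(\<Sum>a\<in>(UNIV :: 'm set) \<rightarrow>\<^sub>E {..<Suc N}. \<Prod>i\<in>UNIV. ?h n i (a i)) =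
      (if \<alpha> = \<beta> then of_nat (Suc N) ^ CARD('m) * of_real (\<Prod>i\<in>UNIV. (real (n i) / real N) ^ \<alpha> i) else 0)"
    for n :: "'m \<Rightarrow> nat"
  proof -
    have "(\<Sum>a\<in>(UNIV :: 'm set) \<rightarrow>\<^sub>E {..<Suc N}. \<Prod>i\<in>UNIV. ?h n i (a i)) = (\<Prod>i\<in>UNIV. \<Sum>l<Suc N. ?h n i l)"
      by (rule prod_sum_PiE[symmetric]) auto
    also have "\<dots> = (\<Prod>i\<in>UNIV. ?r n i ^ (\<alpha> i + \<beta> i) * (if \<alpha> i = \<beta> i then of_nat (Suc N) else 0))"
      unfolding sum_distrib_left[symmetric] \<omega>_def root_of_unity_orthogonality[OF lt] ..
    also have "\<dots> = (if \<alpha> = \<beta> then of_nat (Suc N) ^ CARD('m) * of_real (\<Prod>i\<in>UNIV. (real (n i) / real N) ^ \<alpha> i) else 0)"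
    proof (cases "\<alpha> = \<beta>")
      case True
      have "?r n i ^ (\<beta> i + \<beta> i) = of_real ((real (n i) / real N) ^ \<beta> i)" for i
        by (simp only: mult_2[symmetric] power_mult of_real_power[symmetric]) simp
      then show ?thesis using True by (simp add: prod.distrib del: of_nat_Suc of_real_divide of_real_power)
    next
      case False
      then obtain i where "\<alpha> i \<noteq> \<beta> i" by auto
      then have "(\<Prod>i\<in>UNIV. ?r n i ^ (\<alpha> i + \<beta> i) * (if \<alpha> i = \<beta> i then of_nat (Suc N) else 0)) = 0"
        by (intro prod_zero) auto
      then show ?thesis using False by simp
    qed
    finally show ?thesis .
  qed
  have "quad s N (\<lambda>z. monomial_value \<alpha> z * cnj (monomial_value \<beta> z)) =
      (\<Sum>n\<in>?S. \<Sum>a\<in>(UNIV :: 'm set) \<rightarrow>\<^sub>E {..<Suc N}.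
        of_real (real ((N - sum n UNIV + s) choose s) / (?Z * real (Suc N) ^ CARD('m))) * (\<Prod>i\<in>UNIV. ?h n i (a i)))"
    unfolding quad_def quad_index_def sum.cartesian_product
    by (intro sum.cong refl) (auto simp: quad_weight_def node)
  also have "\<dots> = (\<Sum>n\<in>?S. of_real (real ((N - sum n UNIV + s) choose s) / (?Z * real (Suc N) ^ CARD('m))) *
      (if \<alpha> = \<beta> then of_nat (Suc N) ^ CARD('m) * of_real (\<Prod>i\<in>UNIV. (real (n i) / real N) ^ \<alpha> i) else 0))"
    unfolding sum_distrib_left[symmetric] angle ..
  also have "\<dots> = (if \<alpha> = \<beta> then of_real (radial_moment s N \<alpha>) else 0)"
  proof (cases "\<alpha> = \<beta>")
    case True
    have cancel: "complex_of_real (w / (Z * real M ^ c)) * (of_nat M ^ c * of_real q) = of_real (w / Z * q)"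
      if "M > 0" for w Z q :: real and M c :: nat
    proof -
      have "w / (Z * real M ^ c) * (real M ^ c * q) = w / Z * q" using that by simp
      then show ?thesis by (metis of_real_mult of_real_of_nat_eq of_real_power)
    qed
    show ?thesis
      using True unfolding radial_moment_def of_real_sum
      by (simp only: if_True cancel[OF zero_less_Suc] simp_thms)
  qed simp
  finally show ?thesis .
qed

lemma quad_monomials_tendsto:
  fixes \<alpha> \<beta> :: "'m::finite \<Rightarrow> nat"
  shows "(\<lambda>N. quad s N (\<lambda>z. monomial_value \<alpha> z * cnj (monomial_value \<beta> z))) \<longlonglongrightarrow>
    (if \<alpha> = \<beta> then of_real ((\<Prod>i\<in>UNIV. fact (\<alpha> i)) * fact (s + CARD('m)) / fact (s + CARD('m) + sum \<alpha> UNIV)) else 0)"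
proof -
  have "(\<lambda>N. if \<alpha> = \<beta> then complex_of_real (radial_moment s N \<alpha>) else 0) \<longlonglongrightarrow>
      (if \<alpha> = \<beta> then of_real ((\<Prod>i\<in>UNIV. fact (\<alpha> i)) * fact (s + CARD('m)) / fact (s + CARD('m) + sum \<alpha> UNIV)) else 0)"
    by (cases "\<alpha> = \<beta>")
      (simp_all only: if_True if_False simp_thms tendsto_const tendsto_of_real[OF radial_moment_tendsto])
  then show ?thesis
    by (rule Lim_transform_eventually)
      (rule eventually_sequentiallyI[of "sum \<alpha> UNIV + sum \<beta> UNIV"], simp add: quad_monomials)
qed

section \<open>The reproducing property of the quadrature\<close>

lemma negative_binomial_sums:
  fixes x :: complex
  assumes "cmod x < 1"
  shows "(\<lambda>n. of_nat ((K + n) choose n) * x ^ n) sums (1 / (1 - x) ^ Suc K)"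
proof -
  have "(\<lambda>n. (- of_nat (Suc K) gchoose n) * (- x) ^ n) sums (1 + (- x)) powr (- of_nat (Suc K))"
    using assms by (intro gen_binomial_complex) simp
  moreover have "(- of_nat (Suc K) gchoose n) * (- x) ^ n = of_nat ((K + n) choose n) * x ^ n" for n
  proof -
    have "(- of_nat (Suc K) gchoose n) = (-1) ^ n * ((of_nat (K + n) :: complex) gchoose n)"
      by (subst gbinomial_minus) (simp add: algebra_simps)
    moreover have "(- x) ^ n = (-1) ^ n * x ^ n" by (rule power_minus)
    moreover have "(-1) ^ n * (-1) ^ n = (1::complex)" by (simp add: power_mult_distrib[symmetric])
    ultimately show ?thesis
      unfolding binomial_gbinomial[symmetric] by (metis mult.assoc mult.commute mult_1_left)
  qed
  moreover have "(1 + (- x)) powr (- of_nat (Suc K)) = 1 / (1 - x) ^ Suc K"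
  proof -
    have "1 - x \<noteq> 0" using assms by auto
    then have "(1 - x) powr of_nat (Suc K) = (1 - x) ^ Suc K" by (simp only: powr_nat if_False)
    then show ?thesis by (simp only: powr_minus divide_inverse mult_1_left diff_conv_add_uminus[symmetric])
  qed
  ultimately show ?thesis by (simp only:)
qed

lemma norm_cinner_lt_1:
  assumes "norm z \<le> 1" "norm w < 1"
  shows "cmod (cinner z w) < 1"
proof -
  have "cmod (cinner z w) \<le> norm z * norm w" by (rule cinner_Cauchy_Schwarz)
  also have "\<dots> \<le> 1 * norm w" using assms by (intro mult_right_mono) auto
  finally show ?thesis using assms by simp
qed

lemma cinner_power_multinomial:
  fixes z w :: "complex ^ 'm::finite"
  shows "cinner z w ^ n = (\<Sum>\<beta>\<in>multiindices UNIV (\<lambda>t. t = n).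
    fact n / (\<Prod>i\<in>UNIV. fact (\<beta> i)) * cnj (monomial_value \<beta> w) * monomial_value \<beta> z)"
proof -
  have "cinner z w = (\<Sum>i\<in>UNIV. z $ i * cnj (w $ i))"
    by (simp add: cinner_vec_def cinner_complex_def)
  then have "cinner z w ^ n = fact n * ((\<Sum>i\<in>UNIV. z $ i * cnj (w $ i)) ^ n / fact n)" by simp
  also have "\<dots> = (\<Sum>\<beta>\<in>multiindices UNIV (\<lambda>t. t = n). fact n * (\<Prod>i\<in>UNIV. (z $ i * cnj (w $ i)) ^ \<beta> i / fact (\<beta> i)))"
    unfolding multinomial_power[OF finite] sum_distrib_left ..
  also have "\<dots> = (\<Sum>\<beta>\<in>multiindices UNIV (\<lambda>t. t = n).
      fact n / (\<Prod>i\<in>UNIV. fact (\<beta> i)) * cnj (monomial_value \<beta> w) * monomial_value \<beta> z)"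
    by (intro sum.cong refl) (simp add: monomial_value_def power_mult_distrib prod.distrib prod_dividef mult_ac)
  finally show ?thesis .
qed

lemma norm_monomial_value_le_1:
  assumes "norm z \<le> 1"
  shows "cmod (monomial_value \<alpha> z) \<le> 1"
proof -
  have "cmod (z $ i) \<le> 1" for i
    by (rule order_trans[OF Finite_Cartesian_Product.norm_nth_le assms])
  then show ?thesis
    unfolding monomial_value_def prod_norm[symmetric]
    by (intro prod_le_1) (auto simp: norm_power power_le_one)
qed

text \<open>In the expansion of the kernel only the term of index \<open>\<alpha>\<close> survives in the limit, and its coefficient
  is the value of the monomial at \<open>w\<close> divided by the limiting moment. The expansion is truncated
  at a degree \<open>L\<close> beyond that of
  the monomial, with an error that is uniform on the closed ball and hence uniform in \<open>N\<close>.\<close>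

lemma quad_reproducing_monomial:
  fixes w :: "complex ^ 'm::finite"
  assumes w: "norm w < 1"
  shows "(\<lambda>N. quad s N (\<lambda>z. monomial_value \<alpha> z * cnj (ball_kernel (Suc (s + CARD('m))) z w)))
    \<longlonglongrightarrow> monomial_value \<alpha> w"
proof (rule quad_tendsto_by_approximation)
  fix \<epsilon> :: real assume "\<epsilon> > 0"
  define K where "K = s + CARD('m)"
  define d where "d = sum \<alpha> UNIV"
  define c where "c n = real ((K + n) choose n)" for n
  let ?q = "norm w"
  have sums: "(\<lambda>n. of_real (c n) * cinner z w ^ n) sums ball_kernel (Suc K) z w" if "norm z \<le> 1" for z
    using negative_binomial_sums[OF norm_cinner_lt_1[OF that w], of K]
    by (simp only: c_def of_real_of_nat_eq ball_kernel_def)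
  have "(\<lambda>n. complex_of_real (c n * ?q ^ n)) sums (1 / (1 - of_real ?q) ^ Suc K)"
    using negative_binomial_sums[of "of_real ?q" K] w
    by (simp only: c_def of_real_of_nat_eq of_real_mult of_real_power) simp
  then have sumq: "summable (\<lambda>n. c n * ?q ^ n)"
    using summable_complex_of_real[of "\<lambda>n. c n * ?q ^ n"] sums_summable by blast
  have "(\<lambda>L. suminf (\<lambda>n. c (n + L) * ?q ^ (n + L))) \<longlonglongrightarrow> 0"
    by (rule suminf_exist_split2[OF sumq])
  then have "\<forall>\<^sub>F L in sequentially. suminf (\<lambda>n. c (n + L) * ?q ^ (n + L)) < \<epsilon>"
    using \<open>\<epsilon> > 0\<close> by (rule order_tendstoD(2))
  then have "\<forall>\<^sub>F L in sequentially. suminf (\<lambda>n. c (n + L) * ?q ^ (n + L)) < \<epsilon> \<and> d < L"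
    using eventually_gt_at_top by (rule eventually_conj)
  then obtain L where L: "suminf (\<lambda>n. c (n + L) * ?q ^ (n + L)) < \<epsilon>" "d < L"
    by (auto simp: eventually_sequentially)
  define Q where "Q z = (\<Sum>n<L. of_real (c n) * cinner z w ^ n)" for z
  have approx: "cmod (ball_kernel (Suc K) z w - Q z) \<le> \<epsilon>" if z: "norm z \<le> 1" for z
  proof -
    have tail: "(\<lambda>n. of_real (c (n + L)) * cinner z w ^ (n + L)) sums (ball_kernel (Suc K) z w - Q z)"
      unfolding Q_def by (rule sums_split_initial_segment[OF sums[OF z]])
    have le: "cmod (of_real (c (n + L)) * cinner z w ^ (n + L)) \<le> c (n + L) * ?q ^ (n + L)" for n
    proof -
      have "cmod (cinner z w) \<le> norm z * norm w" by (rule cinner_Cauchy_Schwarz)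
      also have "\<dots> \<le> ?q" using z by (simp add: mult_left_le_one_le)
      finally have "cmod (cinner z w) ^ (n + L) \<le> ?q ^ (n + L)" by (intro power_mono) auto
      then show ?thesis by (simp only: norm_mult norm_power) (simp add: c_def mult_left_mono)
    qed
    have summ: "summable (\<lambda>n. c (n + L) * ?q ^ (n + L))"
      using summable_iff_shift[of "\<lambda>n. c n * ?q ^ n" L] sumq by simp
    have summ': "summable (\<lambda>n. cmod (of_real (c (n + L)) * cinner z w ^ (n + L)))"
      by (rule summable_comparison_test'[OF summ, of 0]) (use le in simp)
    have "cmod (ball_kernel (Suc K) z w - Q z) \<le> suminf (\<lambda>n. cmod (of_real (c (n + L)) * cinner z w ^ (n + L)))"
      using summable_norm[OF summ'] tail by (simp only: sums_iff)
    also have "\<dots> \<le> suminf (\<lambda>n. c (n + L) * ?q ^ (n + L))"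
      by (rule suminf_le[OF le summ' summ])
    finally show ?thesis using L by simp
  qed
  define b where "b n \<beta> = of_real (c n) * (fact n / (\<Prod>i\<in>UNIV. fact (\<beta> i)) * monomial_value \<beta> w)"
    for n and \<beta> :: "'m \<Rightarrow> nat"
  \<comment> \<open>the limiting moment of \<open>\<alpha>\<close>\<close>
  define mom where "mom = complex_of_real ((\<Prod>i\<in>UNIV. fact (\<alpha> i)) * fact K / fact (K + d))"
  let ?I = "\<lambda>n. multiindices (UNIV :: 'm set) (\<lambda>t. t = n)"
  have expand: "monomial_value \<alpha> z * cnj (Q z) =
      (\<Sum>n<L. \<Sum>\<beta>\<in>?I n. b n \<beta> * (monomial_value \<alpha> z * cnj (monomial_value \<beta> z)))" for z
    unfolding Q_def cinner_power_multinomial cnj_sum sum_distrib_left b_def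
    by (intro sum.cong refl) (simp add: mult_ac)
  have finI: "finite (?I n)" for n by (rule finite_multiindices[where n = n]) auto
  have "(\<lambda>N. quad s N (\<lambda>z. monomial_value \<alpha> z * cnj (Q z))) \<longlonglongrightarrow>
      (\<Sum>n<L. \<Sum>\<beta>\<in>?I n. b n \<beta> * (if \<alpha> = \<beta> then mom else 0))"
    unfolding expand quad_sum quad_cmult mom_def K_def d_def
    by (intro tendsto_sum tendsto_mult tendsto_const quad_monomials_tendsto)
  also have "(\<Sum>n<L. \<Sum>\<beta>\<in>?I n. b n \<beta> * (if \<alpha> = \<beta> then mom else 0)) = (\<Sum>n<L. if n = d then b d \<alpha> * mom else 0)"
  proof (intro sum.cong refl)
    fix n
    have "(\<Sum>\<beta>\<in>?I n. b n \<beta> * (if \<alpha> = \<beta> then mom else 0)) = (\<Sum>\<beta>\<in>?I n. if \<beta> = \<alpha> then b n \<alpha> * mom else 0)"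
      by (intro sum.cong refl) auto
    also have "\<dots> = (if \<alpha> \<in> ?I n then b n \<alpha> * mom else 0)" using finI by (simp add: sum.delta')
    also have "\<alpha> \<in> ?I n \<longleftrightarrow> n = d" by (auto simp: multiindices_def d_def)
    finally show "(\<Sum>\<beta>\<in>?I n. b n \<beta> * (if \<alpha> = \<beta> then mom else 0)) = (if n = d then b d \<alpha> * mom else 0)"
      by auto
  qed
  also have "\<dots> = b d \<alpha> * mom" using L(2) by simp
  also have "\<dots> = monomial_value \<alpha> w"
  proof -
    have "c d * (fact d / (\<Prod>i\<in>UNIV. fact (\<alpha> i))) * ((\<Prod>i\<in>UNIV. fact (\<alpha> i)) * fact K / fact (K + d)) = 1"
      by (simp add: c_def binomial_fact)
    then have "complex_of_real (c d * (fact d / (\<Prod>i\<in>UNIV. fact (\<alpha> i))) * ((\<Prod>i\<in>UNIV. fact (\<alpha> i)) * fact K / fact (K + d))) = 1"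
      by (simp only: of_real_1)
    moreover have "b d \<alpha> * mom = complex_of_real (c d * (fact d / (\<Prod>i\<in>UNIV. fact (\<alpha> i))) *
        ((\<Prod>i\<in>UNIV. fact (\<alpha> i)) * fact K / fact (K + d))) * monomial_value \<alpha> w"
      by (simp add: b_def mom_def mult_ac)
    ultimately show ?thesis by simp
  qed
  finally have lim: "(\<lambda>N. quad s N (\<lambda>z. monomial_value \<alpha> z * cnj (Q z))) \<longlonglongrightarrow> monomial_value \<alpha> w" .
  have "cmod (monomial_value \<alpha> z * cnj (ball_kernel (Suc K) z w) - monomial_value \<alpha> z * cnj (Q z)) \<le> \<epsilon>"
    if z: "norm z \<le> 1" for z
  proof -
    have "cmod (monomial_value \<alpha> z * cnj (ball_kernel (Suc K) z w) - monomial_value \<alpha> z * cnj (Q z)) =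
        cmod (monomial_value \<alpha> z) * cmod (ball_kernel (Suc K) z w - Q z)"
      by (simp only: right_diff_distrib[symmetric] complex_cnj_diff[symmetric] norm_mult complex_mod_cnj)
    also have "\<dots> \<le> 1 * \<epsilon>"
      by (intro mult_mono norm_monomial_value_le_1 approx z) auto
    finally show ?thesis by simp
  qed
  then show "\<exists>G l'. (\<forall>z. norm z \<le> 1 \<longrightarrow>
      cmod (monomial_value \<alpha> z * cnj (ball_kernel (Suc (s + CARD('m))) z w) - G z) \<le> \<epsilon>) \<and>
      cmod (l' - monomial_value \<alpha> w) \<le> \<epsilon> \<and> (\<lambda>N. quad s N G) \<longlonglongrightarrow> l'"
    using lim \<open>\<epsilon> > 0\<close> unfolding K_def
    by (intro exI[of _ "\<lambda>z. monomial_value \<alpha> z * cnj (Q z)"] exI[of _ "monomial_value \<alpha> w"]) simp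
qed

lemma norm_ball_kernel_le:
  assumes "norm z \<le> 1" "norm w < 1"
  shows "cmod (ball_kernel k z w) \<le> 1 / (1 - norm w) ^ k"
proof -
  have "cmod (cinner z w) \<le> norm z * norm w" by (rule cinner_Cauchy_Schwarz)
  also have "\<dots> \<le> norm w" using assms by (simp add: mult_left_le_one_le)
  finally have "1 - norm w \<le> cmod (1 - cinner z w)"
    using norm_triangle_ineq2[of 1 "cinner z w"] by simp
  then show ?thesis using assms(2)
    unfolding ball_kernel_def norm_divide norm_power norm_one
    by (intro divide_left_mono power_mono mult_pos_pos zero_less_power) auto
qed

theorem quad_reproducing:
  fixes w :: "complex ^ 'm::finite"
  assumes f: "holomorphic_map_on f (ball 0 R)" "1 < R" and w: "norm w < 1"
  shows "(\<lambda>N. quad s N (\<lambda>z. f z * cnj (ball_kernel (Suc (s + CARD('m))) z w))) \<longlonglongrightarrow> f w"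
proof (rule quad_tendsto_by_approximation)
  fix \<epsilon> :: real assume "\<epsilon> > 0"
  let ?K = "\<lambda>z. ball_kernel (Suc (s + CARD('m))) z w"
  define B where "B = 1 / (1 - norm w) ^ Suc (s + CARD('m)) + 1"
  have B: "B > 1" using w by (simp add: B_def)
  have "\<exists>P\<in>polyfuns. \<forall>z\<in>cball 0 1. cmod (f z - P z) \<le> \<epsilon> / B"
    using \<open>\<epsilon> > 0\<close> B by (intro holomorphic_polynomial_approximation[OF f]) simp
  then obtain P where P: "P \<in> polyfuns" "\<And>z. norm z \<le> 1 \<Longrightarrow> cmod (f z - P z) \<le> \<epsilon> / B" by auto
  from P(1) have lim: "(\<lambda>N. quad s N (\<lambda>z. P z * cnj (?K z))) \<longlonglongrightarrow> P w"
  proof (induction rule: polyfuns.induct)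
    case (monomial c \<alpha>)
    show ?case
      unfolding mult.assoc quad_cmult by (intro tendsto_mult tendsto_const quad_reproducing_monomial w)
  next
    case (add f g)
    show ?case unfolding distrib_right quad_add by (intro tendsto_add add.IH)
  qed
  have "cmod (f z * cnj (?K z) - P z * cnj (?K z)) \<le> \<epsilon>" if z: "norm z \<le> 1" for z
  proof -
    have "cmod (f z * cnj (?K z) - P z * cnj (?K z)) = cmod (f z - P z) * cmod (?K z)"
      by (simp only: left_diff_distrib[symmetric] norm_mult complex_mod_cnj)
    also have "\<dots> \<le> \<epsilon> / B * B"
      using norm_ball_kernel_le[OF z w, of "Suc (s + CARD('m))"] \<open>\<epsilon> > 0\<close> B
      by (intro mult_mono P z) (auto simp: B_def)
    finally show ?thesis using B by simp
  qed
  moreover have "cmod (P w - f w) \<le> \<epsilon>"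
  proof -
    have "cmod (f w - P w) \<le> \<epsilon> / B" using w by (intro P) simp
    also have "\<dots> \<le> \<epsilon> / 1" using \<open>\<epsilon> > 0\<close> B by (intro divide_left_mono) auto
    finally show ?thesis by (simp add: norm_minus_commute)
  qed
  ultimately show "\<exists>G l'. (\<forall>z. norm z \<le> 1 \<longrightarrow> cmod (f z * cnj (?K z) - G z) \<le> \<epsilon>) \<and>
      cmod (l' - f w) \<le> \<epsilon> \<and> (\<lambda>N. quad s N G) \<longlonglongrightarrow> l'"
    using lim by (intro exI[of _ "\<lambda>z. P z * cnj (?K z)"] exI[of _ "P w"]) simp
qed

section \<open>Bounded holomorphic multipliers\<close>

lemma holomorphic_map_on_subset: "holomorphic_map_on f S \<Longrightarrow> T \<subseteq> S \<Longrightarrow> holomorphic_map_on f T"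
  unfolding holomorphic_map_on_def by (meson has_derivative_subset subsetD)

lemma bounded_clinear_linear_combination:
  assumes "bounded_clinear D" "bounded_clinear E"
  shows "bounded_clinear (\<lambda>h. a *\<^sub>C D h + b *\<^sub>C E h)"
proof -
  have "bounded_linear (\<lambda>h. a *\<^sub>C D h + b *\<^sub>C E h)"
    by (intro bounded_linear_add bounded_linear_compose[OF
        bounded_bilinear.bounded_linear_right[OF bounded_bilinear_scaleC]] bounded_clinearD(1) assms)
  then show ?thesis
    unfolding bounded_clinear_def
    by (simp add: bounded_clinearD(3)[OF assms(1)] bounded_clinearD(3)[OF assms(2)]
        scaleC_add_right scaleC_scaleC mult.commute)
qed

lemma bounded_clinear_scaleC_left: "bounded_clinear (\<lambda>c. c *\<^sub>C x)"
  unfolding bounded_clinear_def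
  by (auto intro: bounded_bilinear.bounded_linear_left[OF bounded_bilinear_scaleC]
      simp: scaleC_complex_def scaleC_scaleC)

lemma bounded_clinear_cinner_left: "bounded_clinear (\<lambda>x. cinner x y)"
  unfolding bounded_clinear_def
  by (auto intro: bounded_bilinear.bounded_linear_left[OF bounded_bilinear_cinner]
      simp: scaleC_complex_def cinner_scaleC_left)

lemma holomorphic_map_on_clinear_compose:
  assumes "bounded_clinear A" "holomorphic_map_on f S"
  shows "holomorphic_map_on (\<lambda>z. A (f z)) S"
  unfolding holomorphic_map_on_def
proof
  fix z assume "z \<in> S"
  then obtain D where D: "bounded_clinear D" "(f has_derivative D) (at z within S)"
    using assms(2) unfolding holomorphic_map_on_def by blast
  have "((\<lambda>z. A (f z)) has_derivative (\<lambda>h. A (D h))) (at z within S)"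
    by (rule bounded_linear.has_derivative[OF bounded_clinearD(1)[OF assms(1)] D(2)])
  moreover have "bounded_clinear (\<lambda>h. A (D h))"
    using bounded_clinear_compose[OF assms(1) D(1)] by (simp add: o_def)
  ultimately show "\<exists>D. bounded_clinear D \<and> ((\<lambda>z. A (f z)) has_derivative D) (at z within S)" by blast
qed

lemma holomorphic_map_on_scaleC:
  assumes "holomorphic_map_on c S" "holomorphic_map_on f S"
  shows "holomorphic_map_on (\<lambda>z. c z *\<^sub>C f z) S"
  unfolding holomorphic_map_on_def
proof
  fix z assume z: "z \<in> S"
  obtain D where D: "bounded_clinear D" "(c has_derivative D) (at z within S)"
    using assms(1) z unfolding holomorphic_map_on_def by blast
  obtain E where E: "bounded_clinear E" "(f has_derivative E) (at z within S)"
    using assms(2) z unfolding holomorphic_map_on_def by blast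
  have "((\<lambda>z. c z *\<^sub>C f z) has_derivative (\<lambda>h. c z *\<^sub>C E h + D h *\<^sub>C f z)) (at z within S)"
    by (rule bounded_bilinear.FDERIV[OF bounded_bilinear_scaleC D(2) E(2)])
  moreover have "bounded_clinear (\<lambda>h. c z *\<^sub>C E h + D h *\<^sub>C f z)"
    using bounded_clinear_linear_combination[OF E(1) bounded_clinear_compose[OF bounded_clinear_scaleC_left D(1)],
        of "c z" 1 "f z"]
    by (simp only: o_def scaleC_one)
  ultimately show "\<exists>D. bounded_clinear D \<and> ((\<lambda>z. c z *\<^sub>C f z) has_derivative D) (at z within S)" by blast
qed

lemma holomorphic_map_on_scalar_compose:
  fixes f :: "'a::complex_inner \<Rightarrow> complex"
  assumes "holomorphic_map_on f S" "g holomorphic_on T" "open T" "f ` S \<subseteq> T"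
  shows "holomorphic_map_on (\<lambda>z. g (f z)) S"
  unfolding holomorphic_map_on_def
proof
  fix z assume z: "z \<in> S"
  obtain D where D: "bounded_clinear D" "(f has_derivative D) (at z within S)"
    using assms(1) z unfolding holomorphic_map_on_def by blast
  have "(g has_field_derivative deriv g (f z)) (at (f z))"
    using holomorphic_derivI[OF assms(2,3)] assms(4) z by blast
  then have "((\<lambda>z. g (f z)) has_derivative (\<lambda>h. deriv g (f z) * D h)) (at z within S)"
    using has_derivative_compose[OF D(2), of g "(*) (deriv g (f z))"]
    by (simp add: has_field_derivative_def)
  moreover have "bounded_clinear (\<lambda>h. deriv g (f z) *\<^sub>C D h + 0 *\<^sub>C D h)"
    by (rule bounded_clinear_linear_combination[OF D(1) D(1)])
  then have "bounded_clinear (\<lambda>h. deriv g (f z) * D h)" by (simp add: scaleC_complex_def)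
  ultimately show "\<exists>D. bounded_clinear D \<and> ((\<lambda>z. g (f z)) has_derivative D) (at z within S)" by blast
qed

lemma holomorphic_map_on_dilation:
  fixes f :: "'a::complex_inner \<Rightarrow> 'b::complex_inner"
  assumes f: "holomorphic_map_on f (ball 0 1)" and r: "0 < r"
  shows "holomorphic_map_on (\<lambda>z. f (r *\<^sub>R z)) (ball 0 (1 / r))"
  unfolding holomorphic_map_on_def
proof
  fix z :: 'a assume z: "z \<in> ball 0 (1 / r)"
  then have rz: "r *\<^sub>R z \<in> ball 0 1" using r by (simp add: field_simps)
  obtain D where D: "bounded_clinear D" "(f has_derivative D) (at (r *\<^sub>R z) within ball 0 1)"
    using f rz unfolding holomorphic_map_on_def by blast
  have fD: "(f has_derivative D) (at (r *\<^sub>R z))"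
    using D(2) at_within_open[OF rz open_ball] by simp
  have "((\<lambda>z. r *\<^sub>R z) has_derivative (\<lambda>h. r *\<^sub>R h)) (at z within ball 0 (1 / r))"
    by (rule bounded_linear_imp_has_derivative[OF bounded_linear_scaleR_right])
  from has_derivative_compose[OF this fD]
  have "((\<lambda>z. f (r *\<^sub>R z)) has_derivative (\<lambda>h. D (r *\<^sub>R h))) (at z within ball 0 (1 / r))" .
  moreover have "bounded_clinear (D \<circ> (\<lambda>h. r *\<^sub>R h))"
    by (rule bounded_clinear_compose[OF D(1)])
      (auto simp: bounded_clinear_def bounded_linear_scaleR_right scaleR_scaleC_commute)
  then have "bounded_clinear (\<lambda>h. D (r *\<^sub>R h))" by (simp add: o_def)
  ultimately show "\<exists>D. bounded_clinear D \<and> ((\<lambda>z. f (r *\<^sub>R z)) has_derivative D) (at z within ball 0 (1 / r))"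
    by blast
qed

lemma holomorphic_map_on_ball_kernel:
  fixes w :: "complex ^ 'm::finite"
  assumes "R * norm w < 1"
  shows "holomorphic_map_on (\<lambda>z. ball_kernel k z w) (ball 0 R)"
  unfolding ball_kernel_def
proof (rule holomorphic_map_on_scalar_compose[where T = "ball 0 1"
      and f = "\<lambda>z. cinner z w" and g = "\<lambda>x. 1 / (1 - x) ^ k"])
  have id: "holomorphic_map_on (\<lambda>z :: complex ^ 'm. z) (ball 0 R)"
    unfolding holomorphic_map_on_def
    by (auto intro!: exI[of _ "\<lambda>h. h"] bounded_clinearI[where K = 1])
  show "holomorphic_map_on (\<lambda>z. cinner z w) (ball 0 R)"
    by (rule holomorphic_map_on_clinear_compose[OF bounded_clinear_cinner_left id])
  show "(\<lambda>x. 1 / (1 - x) ^ k) holomorphic_on ball 0 1"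
    by (intro holomorphic_intros) auto
  show "(\<lambda>z. cinner z w) ` ball 0 R \<subseteq> ball 0 1"
  proof clarsimp
    fix z :: "complex ^ 'm" assume "norm z < R"
    then have "norm z * norm w \<le> R * norm w" by (intro mult_right_mono) auto
    then show "cmod (cinner z w) < 1" using cinner_Cauchy_Schwarz[of z w] assms by linarith
  qed
qed simp

text \<open>A radius beyond \<open>1\<close> up to which the kernel function at \<open>w\<close> and a given function on the ball of
  radius \<open>R\<close> are both holomorphic.\<close>

lemma exists_larger_radius:
  fixes w :: "'a::real_normed_vector"
  assumes "1 < R" "norm w < 1"
  shows "\<exists>R'>1. R' \<le> R \<and> R' * norm w < 1"
proof (cases "w = 0")
  case True
  then show ?thesis using assms by auto
next
  case False
  define R' where "R' = min R (2 / (1 + norm w))"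
  have pos: "0 < 1 + norm w" by (simp add: add_pos_nonneg)
  have "1 < 2 / (1 + norm w)" using assms pos by (simp only: less_divide_eq) simp
  moreover have "R' * norm w \<le> 2 / (1 + norm w) * norm w"
    by (intro mult_right_mono) (auto simp: R'_def)
  moreover have "2 / (1 + norm w) * norm w < 1" using assms pos
    by (simp only: times_divide_eq_left divide_less_eq) simp
  ultimately show ?thesis using assms by (intro exI[of _ R']) (auto simp: R'_def)
qed

text \<open>The Cauchy--Schwarz inequality for the quadrature, which has nonnegative weights and nodes in the
  closed ball, where the pointwise bound holds.\<close>

lemma quad_Cauchy_Schwarz:
  fixes f h :: "complex ^ 'm::finite \<Rightarrow> complex" and V :: "complex ^ 'm \<Rightarrow> real"
  assumes "0 \<le> C" and le: "\<And>z. norm z \<le> 1 \<Longrightarrow> cmod (f z) \<le> C * V z"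
  shows "(cmod (quad s N (\<lambda>z. f z * cnj (h z))))\<^sup>2 \<le>
    C\<^sup>2 * Re (quad s N (\<lambda>z. of_real ((V z)\<^sup>2))) * Re (quad s N (\<lambda>z. h z * cnj (h z)))"
proof -
  let ?X = "quad_index N :: (('m \<Rightarrow> nat) \<times> ('m \<Rightarrow> nat)) set"
  let ?w = "\<lambda>x. sqrt (quad_weight s N x)" and ?n = "quad_node N"
  have w2: "(?w x * a) * (?w x * b) = quad_weight s N x * (a * b)" for x a b
  proof -
    have "(?w x * a) * (?w x * b) = (?w x * ?w x) * (a * b)" by (simp only: mult_ac)
    also have "?w x * ?w x = quad_weight s N x" by (simp add: quad_weight_nonneg)
    finally show ?thesis .
  qed
  have "cmod (quad s N (\<lambda>z. f z * cnj (h z))) \<le> (\<Sum>x\<in>?X. (?w x * (C * V (?n x))) * (?w x * cmod (h (?n x))))"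
    unfolding quad_def
  proof (rule sum_norm_le)
    fix x assume "x \<in> ?X"
    then have "cmod (f (?n x)) * cmod (h (?n x)) \<le> (C * V (?n x)) * cmod (h (?n x))"
      by (intro mult_right_mono le quad_node_in_cball) auto
    then have "quad_weight s N x * (cmod (f (?n x)) * cmod (h (?n x))) \<le>
        quad_weight s N x * ((C * V (?n x)) * cmod (h (?n x)))"
      by (intro mult_left_mono quad_weight_nonneg)
    then show "cmod (of_real (quad_weight s N x) * (f (?n x) * cnj (h (?n x)))) \<le>
        (?w x * (C * V (?n x))) * (?w x * cmod (h (?n x)))"
      unfolding w2 norm_mult norm_of_real complex_mod_cnj abs_of_nonneg[OF quad_weight_nonneg] .
  qed
  then have "(cmod (quad s N (\<lambda>z. f z * cnj (h z))))\<^sup>2 \<le>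
      (\<Sum>x\<in>?X. (?w x * (C * V (?n x))) * (?w x * cmod (h (?n x))))\<^sup>2"
    by (intro power_mono) auto
  also have "\<dots> \<le> (\<Sum>x\<in>?X. (?w x * (C * V (?n x)))\<^sup>2) * (\<Sum>x\<in>?X. (?w x * cmod (h (?n x)))\<^sup>2)"
    by (rule Cauchy_Schwarz_ineq_sum)
  also have "(\<Sum>x\<in>?X. (?w x * (C * V (?n x)))\<^sup>2) = C\<^sup>2 * Re (quad s N (\<lambda>z. of_real ((V z)\<^sup>2)))"
    unfolding quad_def Re_sum sum_distrib_left
    by (intro sum.cong refl) (simp add: power_mult_distrib quad_weight_nonneg mult_ac flip: of_real_mult of_real_power)
  also have "(\<Sum>x\<in>?X. (?w x * cmod (h (?n x)))\<^sup>2) = Re (quad s N (\<lambda>z. h z * cnj (h z)))"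
    unfolding quad_def Re_sum
    by (intro sum.cong refl)
      (simp add: power_mult_distrib quad_weight_nonneg complex_norm_square[symmetric] flip: of_real_mult of_real_power)
  finally show ?thesis .
qed

text \<open>With \<open>M\<^sub>g\<close> the multiplication by \<open>g\<close>, the two sums are the squared norms of
  \<open>M\<^sub>g\<^sup>* h\<close> and of \<open>C h\<close> for a combination \<open>h\<close> of kernel functions. Writing
  \<open>\<parallel>M\<^sub>g\<^sup>* h\<parallel>\<^sup>2 = \<langle>M\<^sub>g M\<^sub>g\<^sup>* h, h\<rangle>\<close> as a quadrature, the pointwise bound on \<open>g\<close> and the Cauchy--Schwarz
  inequality give \<open>\<parallel>M\<^sub>g\<^sup>* h\<parallel>\<^sup>2 \<le> C \<parallel>M\<^sub>g\<^sup>* h\<parallel> \<parallel>h\<parallel>\<close>.\<close>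

lemma multiplier_bound_larger_ball:
  fixes g :: "complex ^ 'm::finite \<Rightarrow> 'h::complex_inner" and s :: nat
  assumes g: "holomorphic_map_on g (ball 0 R)" "1 < R" and C: "\<And>z. norm z \<le> 1 \<Longrightarrow> norm (g z) \<le> C"
    and J: "finite J" "\<And>v. v \<in> J \<Longrightarrow> norm v < 1"
  defines "K \<equiv> ball_kernel (Suc (s + CARD('m)))"
  shows "Re (\<Sum>u\<in>J. \<Sum>v\<in>J. c u * cnj (c v) * cinner (g u) (g v) * K u v) \<le>
    C\<^sup>2 * Re (\<Sum>u\<in>J. \<Sum>v\<in>J. c u * cnj (c v) * K u v)"
proof -
  let ?d = "\<lambda>v. cnj (c v)"
  define A2 where "A2 = (\<Sum>u\<in>J. \<Sum>v\<in>J. c u * cnj (c v) * cinner (g u) (g v) * K u v)"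
  define A1 where "A1 = (\<Sum>u\<in>J. \<Sum>v\<in>J. c u * cnj (c v) * K u v)"
  have C0: "0 \<le> C" by (rule order_trans[OF norm_ge_zero C[of 0]]) simp
  \<comment> \<open>\<open>V\<close> plays the part of \<open>M\<^sub>g\<^sup>* h\<close> (up to conjugation) and \<open>S = \<langle>g, V\<rangle>\<close> that of \<open>M\<^sub>g M\<^sub>g\<^sup>* h\<close>\<close>
  define h where "h z = (\<Sum>v\<in>J. ?d v * K z v)" for z
  define S where "S z = (\<Sum>v\<in>J. ?d v * (K z v * cinner (g z) (g v)))" for z
  define V where "V z = (\<Sum>v\<in>J. cnj (?d v * K z v) *\<^sub>C g v)" for z
  have repr: "(\<lambda>N. quad s N (\<lambda>z. f z * cnj (K z u))) \<longlonglongrightarrow> f u"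
    if "holomorphic_map_on f (ball 0 R')" "1 < R'" "u \<in> J" for f R' u
    unfolding K_def by (rule quad_reproducing[OF that(1,2) J(2)[OF that(3)]])
  have hol_K: "\<exists>R'>1. R' \<le> R \<and> holomorphic_map_on (\<lambda>z. K z v) (ball 0 R')" if "v \<in> J" for v
    using exists_larger_radius[OF g(2) J(2)[OF that]] holomorphic_map_on_ball_kernel unfolding K_def by blast
  have repr_K: "(\<lambda>N. quad s N (\<lambda>z. K z v * cnj (K z u))) \<longlonglongrightarrow> K u v" if "u \<in> J" "v \<in> J" for u v
    using hol_K[OF that(2)] repr that(1) by blast
  have repr_Kg: "(\<lambda>N. quad s N (\<lambda>z. (K z v * cinner (g z) (g v)) * cnj (K z u))) \<longlonglongrightarrow> K u v * cinner (g u) (g v)"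
    if uv: "u \<in> J" "v \<in> J" for u v
  proof -
    obtain R' where R': "R' > 1" "R' \<le> R" "holomorphic_map_on (\<lambda>z. K z v) (ball 0 R')"
      using hol_K[OF uv(2)] by blast
    have "holomorphic_map_on g (ball 0 R')"
      using g(1) R'(2) by (auto intro: holomorphic_map_on_subset)
    then have "holomorphic_map_on (\<lambda>z. cinner (g z) (g v)) (ball 0 R')"
      by (rule holomorphic_map_on_clinear_compose[OF bounded_clinear_cinner_left])
    from holomorphic_map_on_scaleC[OF R'(3) this]
    have "holomorphic_map_on (\<lambda>z. K z v * cinner (g z) (g v)) (ball 0 R')"
      by (simp add: scaleC_complex_def)
    from repr[OF this R'(1) uv(1)] show ?thesis .
  qed
  have "(\<lambda>N. \<Sum>u\<in>J. \<Sum>v\<in>J. cnj (?d u) * (?d v * quad s N (\<lambda>z. (K z v * cinner (g z) (g v)) * cnj (K z u)))) \<longlonglongrightarrow>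
      (\<Sum>u\<in>J. \<Sum>v\<in>J. cnj (?d u) * (?d v * (K u v * cinner (g u) (g v))))"
    by (intro tendsto_sum tendsto_mult tendsto_const repr_Kg)
  moreover have "(\<Sum>u\<in>J. \<Sum>v\<in>J. cnj (?d u) * (?d v * quad s N (\<lambda>z. (K z v * cinner (g z) (g v)) * cnj (K z u)))) =
      quad s N (\<lambda>z. S z * cnj (h z))" for N
    unfolding quad_cmult[symmetric] quad_sum[symmetric] S_def h_def cnj_sum sum_product
    by (subst sum.swap) (simp add: mult_ac)
  ultimately have lim_S: "(\<lambda>N. quad s N (\<lambda>z. S z * cnj (h z))) \<longlonglongrightarrow> A2"
    by (simp add: A2_def mult_ac)
  have "(\<lambda>N. \<Sum>u\<in>J. \<Sum>v\<in>J. cnj (?d u) * (?d v * quad s N (\<lambda>z. K z v * cnj (K z u)))) \<longlonglongrightarrow>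
      (\<Sum>u\<in>J. \<Sum>v\<in>J. cnj (?d u) * (?d v * K u v))"
    by (intro tendsto_sum tendsto_mult tendsto_const repr_K)
  moreover have "(\<Sum>u\<in>J. \<Sum>v\<in>J. cnj (?d u) * (?d v * quad s N (\<lambda>z. K z v * cnj (K z u)))) =
      quad s N (\<lambda>z. h z * cnj (h z))" for N
    unfolding quad_cmult[symmetric] quad_sum[symmetric] h_def cnj_sum sum_product
    by (subst sum.swap) (simp add: mult_ac)
  ultimately have lim_h: "(\<lambda>N. quad s N (\<lambda>z. h z * cnj (h z))) \<longlonglongrightarrow> A1"
    by (simp add: A1_def mult_ac)
  have V_expand: "complex_of_real ((norm (V z))\<^sup>2) =
      (\<Sum>u\<in>J. \<Sum>v\<in>J. (cnj (?d u) * ?d v * cinner (g u) (g v)) * (K z v * cnj (K z u)))" for z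
    unfolding cinner_self[symmetric] V_def cinner_sum_left cinner_sum_right
    by (subst sum.swap) (simp add: cinner_scaleC_left cinner_scaleC_right mult_ac)
  have "(\<lambda>N. \<Sum>u\<in>J. \<Sum>v\<in>J. (cnj (?d u) * ?d v * cinner (g u) (g v)) * quad s N (\<lambda>z. K z v * cnj (K z u))) \<longlonglongrightarrow>
      (\<Sum>u\<in>J. \<Sum>v\<in>J. (cnj (?d u) * ?d v * cinner (g u) (g v)) * K u v)"
    by (intro tendsto_sum tendsto_mult tendsto_const repr_K)
  moreover have "(\<Sum>u\<in>J. \<Sum>v\<in>J. (cnj (?d u) * ?d v * cinner (g u) (g v)) * quad s N (\<lambda>z. K z v * cnj (K z u))) =
      quad s N (\<lambda>z. of_real ((norm (V z))\<^sup>2))" for N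
    unfolding quad_cmult[symmetric] quad_sum[symmetric] V_expand ..
  ultimately have lim_V: "(\<lambda>N. quad s N (\<lambda>z. of_real ((norm (V z))\<^sup>2))) \<longlonglongrightarrow> A2"
    by (simp add: A2_def)
  have "cmod (S z) \<le> C * norm (V z)" if "norm z \<le> 1" for z
  proof -
    have "S z = cinner (g z) (V z)"
      by (simp add: S_def V_def cinner_sum_right cinner_scaleC_right mult_ac)
    then have "cmod (S z) \<le> norm (g z) * norm (V z)" by (simp add: cinner_Cauchy_Schwarz)
    also have "\<dots> \<le> C * norm (V z)" by (intro mult_right_mono C that) auto
    finally show ?thesis .
  qed
  then have ineq: "(cmod (quad s N (\<lambda>z. S z * cnj (h z))))\<^sup>2 \<le>
      C\<^sup>2 * Re (quad s N (\<lambda>z. of_real ((norm (V z))\<^sup>2))) * Re (quad s N (\<lambda>z. h z * cnj (h z)))" for N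
    by (intro quad_Cauchy_Schwarz C0)
  have "(cmod A2)\<^sup>2 \<le> C\<^sup>2 * Re A2 * Re A1"
    by (rule LIMSEQ_le[OF tendsto_power[OF tendsto_norm[OF lim_S]]
        tendsto_mult[OF tendsto_mult[OF tendsto_const tendsto_Re[OF lim_V]] tendsto_Re[OF lim_h]]])
      (use ineq in blast)
  have pos: "0 \<le> Re (quad s N (\<lambda>z. of_real ((norm (V z))\<^sup>2)))" for N
    unfolding quad_def Re_sum by (intro sum_nonneg) (simp add: quad_weight_nonneg)
  have A2_pos: "0 \<le> Re A2"
    by (rule LIMSEQ_le_const[OF tendsto_Re[OF lim_V]]) (use pos in blast)
  have pos1: "0 \<le> Re (quad s N (\<lambda>z. h z * cnj (h z)))" for N
    unfolding quad_def Re_sum complex_norm_square[symmetric]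
    by (intro sum_nonneg) (simp add: quad_weight_nonneg)
  have A1_pos: "0 \<le> Re A1"
    by (rule LIMSEQ_le_const[OF tendsto_Re[OF lim_h]]) (use pos1 in blast)
  have "(Re A2)\<^sup>2 \<le> (cmod A2)\<^sup>2" using A2_pos complex_Re_le_cmod by (intro power_mono) auto
  also have "\<dots> \<le> C\<^sup>2 * Re A2 * Re A1" by fact
  finally have "Re A2 * Re A2 \<le> (C\<^sup>2 * Re A1) * Re A2" by (simp add: power2_eq_square mult_ac)
  then have "Re A2 \<le> C\<^sup>2 * Re A1"
    using A2_pos A1_pos by (cases "Re A2 = 0") auto
  then show ?thesis by (simp only: A1_def A2_def)
qed

text \<open>The dilations \<open>z \<mapsto> g (r z)\<close> are holomorphic on larger balls and satisfy the same bound; let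
  \<open>r\<close> tend to \<open>1\<close>.\<close>

theorem multiplier_bound:
  fixes g :: "complex ^ 'm::finite \<Rightarrow> 'h::complex_inner"
  assumes g: "holomorphic_map_on g (ball 0 1)" and C: "\<And>z. norm z < 1 \<Longrightarrow> norm (g z) \<le> C"
    and J: "finite J" "J \<subseteq> ball 0 1" and k: "k > CARD('m)"
  shows "Re (\<Sum>u\<in>J. \<Sum>v\<in>J. c u * cnj (c v) * cinner (g u) (g v) * ball_kernel k u v) \<le>
    C\<^sup>2 * Re (\<Sum>u\<in>J. \<Sum>v\<in>J. c u * cnj (c v) * ball_kernel k u v)"
proof -
  define s where "s = k - Suc (CARD('m))"
  have k_eq: "k = Suc (s + CARD('m))" using k by (simp add: s_def)
  define r where "r n = 1 - inverse (real (Suc (Suc n)))" for n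
  have r: "0 < r n" "r n < 1" for n by (simp_all add: r_def inverse_less_1_iff)
  have r_lim: "r \<longlonglongrightarrow> 1"
    unfolding r_def using tendsto_diff[OF tendsto_const LIMSEQ_Suc[OF LIMSEQ_inverse_real_of_nat], of 1] by simp
  have J1: "norm v < 1" if "v \<in> J" for v using J(2) that by auto
  have g_lim: "(\<lambda>n. g (r n *\<^sub>R v)) \<longlonglongrightarrow> g v" if "v \<in> J" for v
  proof -
    have "isCont g v"
      using holomorphic_map_on_imp_continuous_on[OF g] J(2) that
      by (auto simp: continuous_on_eq_continuous_at)
    moreover have "(\<lambda>n. r n *\<^sub>R v) \<longlonglongrightarrow> 1 *\<^sub>R v" by (intro tendsto_scaleR r_lim tendsto_const)
    ultimately show ?thesis
      using isCont_tendsto_compose[of v g "\<lambda>n. r n *\<^sub>R v" sequentially] by simp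
  qed
  have "Re (\<Sum>u\<in>J. \<Sum>v\<in>J. c u * cnj (c v) * cinner (g (r n *\<^sub>R u)) (g (r n *\<^sub>R v)) * ball_kernel k u v) \<le>
      C\<^sup>2 * Re (\<Sum>u\<in>J. \<Sum>v\<in>J. c u * cnj (c v) * ball_kernel k u v)" for n
    unfolding k_eq
  proof (rule multiplier_bound_larger_ball[OF holomorphic_map_on_dilation[OF g r(1)[of n]] _ _ J(1) J1])
    show "1 < 1 / r n" using r[of n] by simp
    fix z :: "complex ^ 'm" assume "norm z \<le> 1"
    then have "r n * norm z \<le> r n * 1" using r[of n] by (intro mult_left_mono) auto
    also have "\<dots> < 1" using r[of n] by simp
    finally show "norm (g (r n *\<^sub>R z)) \<le> C" using r[of n] by (intro C) simp
  qed
  moreover have "(\<lambda>n. Re (\<Sum>u\<in>J. \<Sum>v\<in>J. c u * cnj (c v) * cinner (g (r n *\<^sub>R u)) (g (r n *\<^sub>R v)) * ball_kernel k u v)) \<longlonglongrightarrow>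
      Re (\<Sum>u\<in>J. \<Sum>v\<in>J. c u * cnj (c v) * cinner (g u) (g v) * ball_kernel k u v)"
    by (intro tendsto_Re tendsto_sum tendsto_mult tendsto_const tendsto_cinner g_lim)
  ultimately show ?thesis by (intro LIMSEQ_le_const2) auto
qed

section \<open>Orthonormal expansions and Gram matrices\<close>

text \<open>The partial expansions \<open>P n\<close> are contractions and are eventually the identity on each vector of the
  dense span, so they converge strongly to the identity.\<close>

lemma orthonormal_basis_parseval:
  fixes x y :: "'a::complex_inner"
  assumes e: "orthonormal_basis e"
  shows "(\<lambda>n. \<Sum>i<n. cinner x (e i) * cinner (e i) y) \<longlonglongrightarrow> cinner x y"
proof -
  have orth: "cinner (e i) (e j) = (if i = j then 1 else 0)" for i j
    using e by (simp add: orthonormal_basis_def)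
  define P where "P n z = (\<Sum>i<n. cinner z (e i) *\<^sub>C e i)" for n z
  have P_add: "P n (z + z') = P n z + P n z'" for n z z'
    by (simp add: P_def cinner_add_left scaleC_add_left sum.distrib)
  have P_diff: "P n (z - z') = P n z - P n z'" for n z z'
    by (simp add: P_def cinner_diff_left complex_vector.scale_left_diff_distrib sum_subtractf)
  have P_scale: "P n (c *\<^sub>C z) = c *\<^sub>C P n z" for n z c
    by (simp add: P_def cinner_scaleC_left complex_vector.scale_sum_right scaleC_scaleC)
  have bessel: "norm (P n z) \<le> norm z" for n z
  proof -
    have "cinner (P n z) (P n z) = (\<Sum>i<n. cinner z (e i) * (\<Sum>j<n. cnj (cinner z (e j)) * (if i = j then 1 else 0)))"
      unfolding P_def cinner_sum_left cinner_scaleC_left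
      by (simp only: cinner_sum_right cinner_scaleC_right orth)
    also have "\<dots> = (\<Sum>i<n. cinner z (e i) * cnj (cinner z (e i)))"
      by (intro sum.cong refl) (simp add: mult_delta_right)
    also have "\<dots> = cinner z (P n z)"
      by (simp add: P_def cinner_sum_right cinner_scaleC_right mult.commute)
    finally have "Re (of_real ((norm (P n z))\<^sup>2)) = Re (cinner z (P n z))"
      by (simp only: cinner_self)
    then have "(norm (P n z))\<^sup>2 = Re (cinner z (P n z))" by (simp only: Re_complex_of_real)
    also have "\<dots> \<le> norm z * norm (P n z)"
      by (rule order_trans[OF complex_Re_le_cmod cinner_Cauchy_Schwarz])
    finally show ?thesis
      by (cases "norm (P n z) = 0") (auto simp: power2_eq_square)
  qed
  have fix_e: "P n (e j) = e j" if "j < n" for n j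
  proof -
    have "P n (e j) = (\<Sum>i<n. if i = j then e j else 0)"
      unfolding P_def orth by (intro sum.cong refl) (auto simp: scaleC_one)
    then show ?thesis using that by simp
  qed
  have fix_span: "\<exists>m. \<forall>n\<ge>m. P n z = z" if "z \<in> complex_vector.span (range e)" for z
    using that
  proof (induction rule: complex_vector.span_induct_alt)
    case base
    then show ?case by (simp add: P_def)
  next
    case (step c x z)
    then obtain j m where "x = e j" "\<forall>n\<ge>m. P n z = z" by blast
    then have "\<forall>n\<ge>max m (Suc j). P n (c *\<^sub>C x + z) = c *\<^sub>C x + z"
      by (simp add: P_add P_scale fix_e)
    then show ?case by blast
  qed
  have "(\<lambda>n. P n x) \<longlonglongrightarrow> x"
  proof (rule LIMSEQ_I)
    fix r :: real assume r: "r > 0"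
    have "x \<in> closure (complex_vector.span (range e))" using e by (simp add: orthonormal_basis_def)
    then obtain z where z: "z \<in> complex_vector.span (range e)" "dist z x < r / 2"
      using r unfolding closure_approachable by (meson half_gt_zero)
    obtain m where m: "\<And>n. n \<ge> m \<Longrightarrow> P n z = z" using fix_span[OF z(1)] by blast
    have "norm (P n x - x) < r" if "n \<ge> m" for n
    proof -
      have "P n x - x = P n (x - z) + (z - x)" by (simp add: P_diff m[OF that])
      also have "norm \<dots> \<le> norm (x - z) + norm (z - x)"
        by (rule order_trans[OF norm_triangle_ineq add_right_mono[OF bessel]])
      also have "\<dots> < r" using z(2) by (simp add: dist_norm norm_minus_commute)
      finally show ?thesis .
    qed
    then show "\<exists>m. \<forall>n\<ge>m. norm (P n x - x) < r" by blast
  qed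
  then have "(\<lambda>n. cinner (P n x) y) \<longlonglongrightarrow> cinner x y" by (intro tendsto_cinner tendsto_const)
  then show ?thesis by (simp add: P_def cinner_sum_left cinner_scaleC_left)
qed

lemma norm_linear_combination_squared:
  "(norm (\<Sum>u\<in>J. c u *\<^sub>C x u))\<^sup>2 = Re (\<Sum>u\<in>J. \<Sum>v\<in>J. c u * cnj (c v) * cinner (x u) (x v))"
proof -
  have "cinner (\<Sum>u\<in>J. c u *\<^sub>C x u) (\<Sum>v\<in>J. c v *\<^sub>C x v) =
      (\<Sum>u\<in>J. \<Sum>v\<in>J. c u * cnj (c v) * cinner (x u) (x v))"
    unfolding cinner_sum_left cinner_scaleC_left unfolding cinner_sum_right cinner_scaleC_right sum_distrib_left
    by (intro sum.cong refl) (simp add: mult_ac)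
  then have "Re (\<Sum>u\<in>J. \<Sum>v\<in>J. c u * cnj (c v) * cinner (x u) (x v)) = Re (of_real ((norm (\<Sum>u\<in>J. c u *\<^sub>C x u))\<^sup>2))"
    by (simp only: cinner_self[symmetric])
  then show ?thesis by simp
qed

text \<open>The sum is the squared norm of \<open>\<Sum>u. c u (y u \<otimes> \<kappa> u)\<close> in the Hilbert space tensor product,
  computed in an orthonormal basis of the second factor.\<close>

lemma gram_product_nonneg:
  fixes y :: "'i \<Rightarrow> 'h::complex_inner" and \<kappa> :: "'i \<Rightarrow> 'b::complex_inner"
    and e :: "nat \<Rightarrow> 'b"
  assumes e: "orthonormal_basis e"
  shows "0 \<le> Re (\<Sum>u\<in>J. \<Sum>v\<in>J. c u * cnj (c v) * cinner (y u) (y v) * cinner (\<kappa> u) (\<kappa> v))"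
proof (rule LIMSEQ_le_const)
  show "(\<lambda>n. Re (\<Sum>u\<in>J. \<Sum>v\<in>J. c u * cnj (c v) * cinner (y u) (y v) *
      (\<Sum>i<n. cinner (\<kappa> u) (e i) * cinner (e i) (\<kappa> v)))) \<longlonglongrightarrow>
      Re (\<Sum>u\<in>J. \<Sum>v\<in>J. c u * cnj (c v) * cinner (y u) (y v) * cinner (\<kappa> u) (\<kappa> v))"
    by (intro tendsto_Re tendsto_sum tendsto_mult tendsto_const orthonormal_basis_parseval e)
  have "Re (\<Sum>u\<in>J. \<Sum>v\<in>J. c u * cnj (c v) * cinner (y u) (y v) * (\<Sum>i<n. cinner (\<kappa> u) (e i) * cinner (e i) (\<kappa> v))) =
      (\<Sum>i<n. (norm (\<Sum>u\<in>J. (c u * cinner (\<kappa> u) (e i)) *\<^sub>C y u))\<^sup>2)" for n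
  proof -
    have "(\<Sum>u\<in>J. \<Sum>v\<in>J. c u * cnj (c v) * cinner (y u) (y v) * (\<Sum>i<n. cinner (\<kappa> u) (e i) * cinner (e i) (\<kappa> v))) =
        (\<Sum>u\<in>J. \<Sum>i<n. \<Sum>v\<in>J. c u * cnj (c v) * cinner (y u) (y v) * (cinner (\<kappa> u) (e i) * cinner (e i) (\<kappa> v)))"
      unfolding sum_distrib_left by (intro sum.cong refl sum.swap)
    also have "\<dots> = (\<Sum>i<n. \<Sum>u\<in>J. \<Sum>v\<in>J. c u * cnj (c v) * cinner (y u) (y v) * (cinner (\<kappa> u) (e i) * cinner (e i) (\<kappa> v)))"
      by (rule sum.swap)
    also have "\<dots> = (\<Sum>i<n. \<Sum>u\<in>J. \<Sum>v\<in>J.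
        (c u * cinner (\<kappa> u) (e i)) * cnj (c v * cinner (\<kappa> v) (e i)) * cinner (y u) (y v))"
    proof (intro sum.cong refl)
      fix i u v
      have "cinner (e i) (\<kappa> v) = cnj (cinner (\<kappa> v) (e i))" by (rule cinner_commute)
      then show "c u * cnj (c v) * cinner (y u) (y v) * (cinner (\<kappa> u) (e i) * cinner (e i) (\<kappa> v)) =
          (c u * cinner (\<kappa> u) (e i)) * cnj (c v * cinner (\<kappa> v) (e i)) * cinner (y u) (y v)"
        by (simp add: mult_ac)
    qed
    finally show ?thesis by (simp only: Re_sum[of _ "{..<n}"] norm_linear_combination_squared)
  qed
  then show "\<exists>N. \<forall>n\<ge>N. 0 \<le> Re (\<Sum>u\<in>J. \<Sum>v\<in>J. c u * cnj (c v) * cinner (y u) (y v) *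
      (\<Sum>i<n. cinner (\<kappa> u) (e i) * cinner (e i) (\<kappa> v)))"
    by (simp add: sum_nonneg)
qed

section \<open>Polynomials in the adjoint tuple\<close>

lemma funpow_commute_funpow:
  assumes "A \<circ> B = B \<circ> A"
  shows "(A ^^ a) \<circ> (B ^^ b) = (B ^^ b) \<circ> (A ^^ a)"
proof -
  have step: "A ((B ^^ b) x) = (B ^^ b) (A x)" for x
    using assms by (induction b) (simp_all add: fun_eq_iff)
  have "(A ^^ a) ((B ^^ b) x) = (B ^^ b) ((A ^^ a) x)" for x
    by (induction a) (simp_all add: step)
  then show ?thesis by (simp add: fun_eq_iff)
qed

text \<open>Folding over the coordinates is independent of their order only because the operators commute; this
  rule packages that fact for inductions over the set of coordinates.\<close>

lemma tuple_power_induct: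
  fixes S :: "'m::finite \<Rightarrow> 'h \<Rightarrow> 'h"
  assumes comm: "\<And>i j. S i \<circ> S j = S j \<circ> S i"
    and empty: "Q {} id" and insert: "\<And>i F B. i \<notin> F \<Longrightarrow> Q F B \<Longrightarrow> Q (insert i F) ((S i ^^ \<alpha> i) \<circ> B)"
  shows "Q UNIV (tuple_power S \<alpha>)"
proof -
  let ?f = "\<lambda>i A. (S i ^^ \<alpha> i) \<circ> A"
  interpret comp_fun_commute ?f
  proof
    fix i j
    have "(S i ^^ \<alpha> i) \<circ> (S j ^^ \<alpha> j) = (S j ^^ \<alpha> j) \<circ> (S i ^^ \<alpha> i)"
      by (rule funpow_commute_funpow[OF comm])
    then show "?f j \<circ> ?f i = ?f i \<circ> ?f j" by (simp add: fun_eq_iff)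
  qed
  have "Q F (Finite_Set.fold ?f id F)" if "finite F" for F
    using that
  proof (induction F rule: finite_induct)
    case empty
    show ?case unfolding fold_empty by (rule assms(2))
  next
    case (insert i F)
    show ?case unfolding fold_insert[OF insert.hyps] by (rule assms(3)[OF insert.hyps(2) insert.IH])
  qed
  from this[OF finite] show ?thesis unfolding tuple_power_def .
qed

lemma adjoint_tuple_commute:
  fixes T :: "'m \<Rightarrow> 'h::complex_hilbert \<Rightarrow> 'h"
  assumes T: "\<And>i. bounded_clinear (T i)" and comm: "\<And>i j. T i \<circ> T j = T j \<circ> T i"
  shows "adjoint_tuple T i \<circ> adjoint_tuple T j = adjoint_tuple T j \<circ> adjoint_tuple T i"
proof
  fix y
  have "cinner x ((adjoint_tuple T i \<circ> adjoint_tuple T j) y) = cinner x ((adjoint_tuple T j \<circ> adjoint_tuple T i) y)" for x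
  proof -
    have "T j (T i x) = T i (T j x)" using comm[of j i] by (simp add: fun_eq_iff)
    then show ?thesis by (simp add: adjoint_tuple_def cinner_cadjoint_right[OF T, symmetric])
  qed
  then show "(adjoint_tuple T i \<circ> adjoint_tuple T j) y = (adjoint_tuple T j \<circ> adjoint_tuple T i) y"
    by (intro cinner_eqI[of "(adjoint_tuple T i \<circ> adjoint_tuple T j) y"]) (metis cinner_commute)
qed

lemma joint_kernel_eigenvector:
  "h \<in> joint_kernel T w \<longleftrightarrow> (\<forall>i. T i h = (w $ i) *\<^sub>C h)"
  by (simp add: joint_kernel_def tuple_operator_def shifted_tuple_def vec_eq_iff)

definition cnj_vec :: "complex ^ 'm \<Rightarrow> complex ^ 'm"
  where "cnj_vec w = (\<chi> i. cnj (w $ i))"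

context
  fixes T :: "'m::finite \<Rightarrow> 'h::complex_hilbert \<Rightarrow> 'h"
  assumes T: "\<And>i. bounded_clinear (T i)" and comm: "\<And>i j. T i \<circ> T j = T j \<circ> T i"
begin

lemma bounded_clinear_tuple_power_adjoint: "bounded_clinear (tuple_power (adjoint_tuple T) \<alpha>)"
proof (rule tuple_power_induct[where Q = "\<lambda>F B. bounded_clinear B"])
  show "bounded_clinear (id :: 'h \<Rightarrow> 'h)" by (rule bounded_clinearI[where K = 1]) auto
  show "bounded_clinear ((adjoint_tuple T i ^^ \<alpha> i) \<circ> B)" if "bounded_clinear B" for i B
    by (intro bounded_clinear_compose bounded_clinear_funpow that)
      (simp add: adjoint_tuple_def bounded_clinear_cadjoint T)
qed (rule adjoint_tuple_commute[OF T comm])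

lemma cinner_tuple_power_adjoint_eigenvector:
  assumes h: "h \<in> joint_kernel T w"
  shows "cinner (tuple_power (adjoint_tuple T) \<alpha> x) h = (\<Prod>i\<in>UNIV. cnj (w $ i) ^ \<alpha> i) * cinner x h"
proof -
  have one: "cinner (adjoint_tuple T i y) h = cnj (w $ i) * cinner y h" for i y
  proof -
    have "cinner (adjoint_tuple T i y) h = cnj (cinner h (adjoint_tuple T i y))" by (rule cinner_commute)
    also have "cinner h (adjoint_tuple T i y) = (w $ i) * cinner h y"
      using h by (simp add: adjoint_tuple_def cinner_cadjoint_right[OF T, symmetric]
          joint_kernel_eigenvector cinner_scaleC_left)
    also have "cinner h y = cnj (cinner y h)" by (rule cinner_commute)
    finally show ?thesis by simp
  qed
  have pow: "cinner ((adjoint_tuple T i ^^ a) y) h = cnj (w $ i) ^ a * cinner y h" for i a y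
    by (induction a) (simp_all add: one)
  have "\<forall>x. cinner (tuple_power (adjoint_tuple T) \<alpha> x) h = (\<Prod>i\<in>UNIV. cnj (w $ i) ^ \<alpha> i) * cinner x h"
    by (rule tuple_power_induct[where Q = "\<lambda>F B. \<forall>x. cinner (B x) h = (\<Prod>i\<in>F. cnj (w $ i) ^ \<alpha> i) * cinner x h"])
      (simp_all add: adjoint_tuple_commute[OF T comm] pow mult.assoc)
  then show ?thesis by blast
qed

lemma bounded_clinear_poly_operator_adjoint: "bounded_clinear (poly_operator q (adjoint_tuple T))"
proof -
  have "bounded_clinear (\<lambda>h. \<Sum>\<alpha>\<in>I. c \<alpha> *\<^sub>C tuple_power (adjoint_tuple T) \<alpha> h)" if "finite I" for I c
    using that
  proof (induction I rule: finite_induct)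
    case empty
    show ?case by (rule bounded_clinearI[where K = 0]) auto
  next
    case (insert \<alpha> I)
    have "bounded_clinear (\<lambda>h. c \<alpha> *\<^sub>C tuple_power (adjoint_tuple T) \<alpha> h +
        1 *\<^sub>C (\<Sum>\<alpha>\<in>I. c \<alpha> *\<^sub>C tuple_power (adjoint_tuple T) \<alpha> h))"
      by (intro bounded_clinear_linear_combination bounded_clinear_tuple_power_adjoint insert.IH)
    then show ?case unfolding sum.insert[OF insert.hyps] by (simp only: scaleC_one)
  qed
  from this[OF finite_keys] show ?thesis by (simp add: poly_operator_def[abs_def])
qed

text \<open>On joint eigenvectors the adjoint of a polynomial in \<open>T\<^sup>*\<close> acts as the polynomial in \<open>T\<close> with
  conjugate coefficients, hence as a scalar.\<close>

lemma cadjoint_poly_operator_eigenvector: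
  assumes h: "h \<in> joint_kernel T w"
  shows "cadjoint (poly_operator q (adjoint_tuple T)) h = cnj (poly_value q (cnj_vec w)) *\<^sub>C h"
proof -
  have "cinner x (cadjoint (poly_operator q (adjoint_tuple T)) h) = cinner x (cnj (poly_value q (cnj_vec w)) *\<^sub>C h)" for x
  proof -
    have "cinner x (cadjoint (poly_operator q (adjoint_tuple T)) h) = cinner (poly_operator q (adjoint_tuple T) x) h"
      by (rule cinner_cadjoint_right[OF bounded_clinear_poly_operator_adjoint, symmetric])
    also have "\<dots> = poly_value q (cnj_vec w) * cinner x h"
      by (simp add: poly_operator_def poly_value_def cnj_vec_def cinner_sum_left cinner_scaleC_left
          cinner_tuple_power_adjoint_eigenvector[OF h] sum_distrib_right mult.assoc)
    finally show ?thesis by (simp add: cinner_scaleC_right)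
  qed
  then show ?thesis
    by (intro cinner_eqI[of "cadjoint (poly_operator q (adjoint_tuple T)) h"]) (metis cinner_commute)
qed

text \<open>The weak form of the tail condition: \<open>D\<close> is self-adjoint and \<open>D\<^sup>2\<close> is the operator in the middle
  of each summand of the tail.\<close>

lemma tail_operator_expansion:
  assumes pos: "positive_operator (inverse_kernel_operator k T)"
    and tail: "(\<lambda>j. tail_operator k p j T h) \<longlonglongrightarrow> 0"
  defines "D \<equiv> defect_operator k T" and "P \<equiv> \<lambda>i. cadjoint (poly_operator (p i) (adjoint_tuple T))"
  shows "(\<lambda>j. \<Sum>i<j. cinner (D (P i h)) (D (P i h'))) \<longlonglongrightarrow> cinner h h'"
proof -
  have D: "positive_operator D" "\<And>x. D (D x) = inverse_kernel_operator k T x"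
    unfolding D_def defect_operator_def using sqrt_operator_positive_square[OF pos] by blast+
  have "cinner (tail_operator k p j T h) h' = cinner h h' - (\<Sum>i<j. cinner (D (P i h)) (D (P i h')))" for j
    by (simp add: tail_operator_def P_def cinner_diff_left cinner_sum_left D(2)[symmetric]
        cinner_cadjoint_right[OF bounded_clinear_poly_operator_adjoint] positive_operator_symmetric[OF D(1)])
  moreover have "(\<lambda>j. cinner (tail_operator k p j T h) h') \<longlonglongrightarrow> cinner 0 h'"
    by (intro tendsto_cinner tail tendsto_const)
  ultimately have "(\<lambda>j. cinner h h' - (\<Sum>i<j. cinner (D (P i h)) (D (P i h')))) \<longlonglongrightarrow> 0" by simp
  from tendsto_diff[OF tendsto_const[of "cinner h h'"] this] show ?thesis by simp
qed

end

section \<open>The kernel functions and the adjoint multiplications\<close>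

lemma norm_cnj_vec [simp]: "norm (cnj_vec v) = norm v"
  by (simp add: cnj_vec_def norm_vec_def)

lemma cnj_vec_cnj_vec [simp]: "cnj_vec (cnj_vec v) = v"
  by (simp add: cnj_vec_def vec_eq_iff)

lemma ball_kernel_cnj_vec: "ball_kernel k (cnj_vec v) (cnj_vec u) = ball_kernel k u v"
  by (simp add: ball_kernel_def cinner_vec_def cinner_complex_def cnj_vec_def mult.commute)

text \<open>Conjugating the base point turns the conjugate-linear dependence of kernel functions on it
  into a holomorphic one, so that \<open>\<kappa> v\<close> is an eigenvector of \<open>M\<^sub>z\<^sup>*\<close> for \<open>v\<close> itself.\<close>

lemma ball_space_kernel_functions:
  fixes ev :: "'b::complex_hilbert \<Rightarrow> complex ^ 'm::finite \<Rightarrow> complex"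
  assumes "is_ball_space k ev"
  shows "\<exists>\<kappa>. (\<forall>v\<in>ball 0 1. \<forall>f. ev f (cnj_vec v) = cinner f (\<kappa> v)) \<and>
    (\<forall>u\<in>ball 0 1. \<forall>v\<in>ball 0 1. cinner (\<kappa> u) (\<kappa> v) = ball_kernel k u v) \<and>
    closure (complex_vector.span (\<kappa> ` ball 0 1)) = UNIV"
proof -
  have fhs: "function_hilbert_space (ball 0 1) ev" and rk: "has_reproducing_kernel (ball 0 1) ev (ball_kernel k)"
    using assms by (auto simp: is_ball_space_def)
  have "\<forall>w\<in>ball 0 1. \<exists>Kw. (\<forall>z\<in>ball 0 1. ev Kw z = ball_kernel k z w) \<and> (\<forall>f. ev f w = cinner f Kw)"
    using rk by (simp add: has_reproducing_kernel_def)
  then obtain \<phi> where \<phi>: "\<And>w z. w \<in> ball 0 1 \<Longrightarrow> z \<in> ball 0 1 \<Longrightarrow> ev (\<phi> w) z = ball_kernel k z w"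
      "\<And>w f. w \<in> ball 0 1 \<Longrightarrow> ev f w = cinner f (\<phi> w)"
    by metis
  define \<kappa> where "\<kappa> v = \<phi> (cnj_vec v)" for v
  have 1: "ev f (cnj_vec v) = cinner f (\<kappa> v)" if "v \<in> ball 0 1" for v f
    unfolding \<kappa>_def using that by (intro \<phi>(2)) simp
  have 2: "cinner (\<kappa> u) (\<kappa> v) = ball_kernel k u v" if "u \<in> ball 0 1" "v \<in> ball 0 1" for u v
    using 1[OF that(2), of "\<kappa> u"] \<phi>(1)[of "cnj_vec u" "cnj_vec v"] that
    by (simp add: \<kappa>_def ball_kernel_cnj_vec)
  have 3: "closure (complex_vector.span (\<kappa> ` ball 0 1)) = UNIV"
  proof (rule dense_if_orthogonal_trivial)
    fix x assume x: "\<And>s. s \<in> \<kappa> ` ball 0 1 \<Longrightarrow> cinner x s = 0"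
    have "ev x z = ev 0 z" if z: "z \<in> ball 0 1" for z
    proof -
      have v: "cnj_vec z \<in> ball 0 1" using z by simp
      have "ev x z = cinner x (\<kappa> (cnj_vec z))" "ev 0 z = cinner 0 (\<kappa> (cnj_vec z))"
        using 1[OF v] by (simp_all only: cnj_vec_cnj_vec)
      then show ?thesis using x v by simp
    qed
    then show "x = 0" using fhs unfolding function_hilbert_space_def by blast
  qed
  show ?thesis using 1 2 3 by blast
qed

text \<open>The operator \<open>\<kappa> v \<mapsto> v\<^sub>i \<kappa> v\<close> is bounded because the coordinate function is a multiplier. By the
  reproducing property its adjoint is multiplication by that coordinate, which is thereby shown to
  be everywhere defined and bounded.\<close>

lemma adjoint_coordinate_mult:
  fixes ev :: "'b::complex_hilbert \<Rightarrow> complex ^ 'm::finite \<Rightarrow> complex" and \<kappa> :: "complex ^ 'm \<Rightarrow> 'b"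
    and i :: 'm
  assumes ev: "is_ball_space k ev" and k: "k > CARD('m)"
    and \<kappa>_ev: "\<And>v f. v \<in> ball 0 1 \<Longrightarrow> ev f (cnj_vec v) = cinner f (\<kappa> v)"
    and \<kappa>_inner: "\<And>u v. u \<in> ball 0 1 \<Longrightarrow> v \<in> ball 0 1 \<Longrightarrow> cinner (\<kappa> u) (\<kappa> v) = ball_kernel k u v"
    and \<kappa>_dense: "closure (complex_vector.span (\<kappa> ` ball 0 1)) = UNIV"
  defines "L \<equiv> adjoint_tuple (coordinate_mult ev) i"
  shows "bounded_clinear L" and "v \<in> ball 0 1 \<Longrightarrow> L (\<kappa> v) = (v $ i) *\<^sub>C \<kappa> v"
proof -
  have coord_hol: "holomorphic_map_on (\<lambda>z :: complex ^ 'm. z $ i) (ball 0 1)"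
    unfolding holomorphic_map_on_def
  proof
    fix z :: "complex ^ 'm"
    have "bounded_clinear (\<lambda>h :: complex ^ 'm. h $ i)"
      unfolding bounded_clinear_def
      by (simp add: bounded_linear_vec_nth scaleC_vec_def)
    then show "\<exists>D. bounded_clinear D \<and> ((\<lambda>z. z $ i) has_derivative D) (at z within ball 0 1)"
      using bounded_clinearD(1) bounded_linear_imp_has_derivative by blast
  qed
  have "\<exists>L'. bounded_clinear L' \<and> (\<forall>v\<in>ball 0 1. L' (\<kappa> v) = (v $ i) *\<^sub>C \<kappa> v)"
  proof (rule bounded_clinear_extension[OF \<kappa>_dense, of _ 1])
    fix J :: "(complex ^ 'm) set" and c
    assume J: "finite J" "J \<subseteq> ball 0 1"
    have ker: "cinner (\<kappa> u) (\<kappa> v) = ball_kernel k u v" if "u \<in> J" "v \<in> J" for u v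
      using J that by (intro \<kappa>_inner) auto
    have "(norm (\<Sum>v\<in>J. c v *\<^sub>C (v $ i) *\<^sub>C \<kappa> v))\<^sup>2 =
        Re (\<Sum>u\<in>J. \<Sum>v\<in>J. c u * cnj (c v) * cinner (u $ i) (v $ i) * ball_kernel k u v)"
      unfolding norm_linear_combination_squared
      by (intro arg_cong[where f = Re] sum.cong refl)
        (simp add: cinner_scaleC_left cinner_scaleC_right ker cinner_complex_def)
    also have "\<dots> \<le> 1\<^sup>2 * Re (\<Sum>u\<in>J. \<Sum>v\<in>J. c u * cnj (c v) * ball_kernel k u v)"
    proof (rule multiplier_bound[OF coord_hol _ J k])
      fix z :: "complex ^ 'm" assume "norm z < 1"
      then show "cmod (z $ i) \<le> 1"
        using Finite_Cartesian_Product.norm_nth_le[of z i] by linarith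
    qed
    also have "\<dots> = (norm (\<Sum>v\<in>J. c v *\<^sub>C \<kappa> v))\<^sup>2"
      unfolding norm_linear_combination_squared power_one mult_1_left
      by (intro arg_cong[where f = Re] sum.cong refl) (simp add: ker)
    finally have "(norm (\<Sum>v\<in>J. c v *\<^sub>C (v $ i) *\<^sub>C \<kappa> v))\<^sup>2 \<le> (norm (\<Sum>v\<in>J. c v *\<^sub>C \<kappa> v))\<^sup>2" .
    then show "norm (\<Sum>v\<in>J. c v *\<^sub>C (v $ i) *\<^sub>C \<kappa> v) \<le> 1 * norm (\<Sum>v\<in>J. c v *\<^sub>C \<kappa> v)"
      unfolding mult_1_left by (rule power2_le_imp_le) simp
  qed
  then obtain L' where L': "bounded_clinear L'" "\<And>v. v \<in> ball 0 1 \<Longrightarrow> L' (\<kappa> v) = (v $ i) *\<^sub>C \<kappa> v"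
    by blast
  define M where "M = cadjoint L'"
  have M: "cinner (M x) y = cinner x (L' y)" for x y
  proof -
    have "cinner (M x) y = cnj (cinner y (M x))" by (rule cinner_commute)
    also have "\<dots> = cnj (cinner (L' y) x)" by (simp only: M_def cinner_cadjoint_right[OF L'(1)])
    also have "\<dots> = cinner x (L' y)" by (rule cinner_commute[symmetric])
    finally show ?thesis .
  qed
  have ev_M: "ev (M f) z = z $ i * ev f z" if z: "z \<in> ball 0 1" for f z
  proof -
    have v: "cnj_vec z \<in> ball 0 1" using z by simp
    have "ev (M f) z = cinner (M f) (\<kappa> (cnj_vec z))"
      using \<kappa>_ev[OF v, of "M f"] by (simp only: cnj_vec_cnj_vec)
    also have "\<dots> = cnj (cnj_vec z $ i) * cinner f (\<kappa> (cnj_vec z))"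
      by (simp only: M L'(2)[OF v] cinner_scaleC_right)
    also have "cinner f (\<kappa> (cnj_vec z)) = ev f z"
      using \<kappa>_ev[OF v, of f] by (simp only: cnj_vec_cnj_vec)
    finally show ?thesis by (simp add: cnj_vec_def)
  qed
  have "coordinate_mult ev i = M"
  proof
    fix f
    show "coordinate_mult ev i f = M f"
      unfolding coordinate_mult_def
    proof (rule the_equality)
      fix g assume "\<forall>z\<in>ball 0 1. ev g z = z $ i * ev f z"
      then have "\<forall>z\<in>ball 0 1. ev g z = ev (M f) z" by (simp add: ev_M)
      then show "g = M f" using ev by (auto simp: is_ball_space_def function_hilbert_space_def)
    qed (simp add: ev_M)
  qed
  then have "L = L'" unfolding L_def adjoint_tuple_def using cadjoint_unique[OF M] by simp
  then show "bounded_clinear L" and "v \<in> ball 0 1 \<Longrightarrow> L (\<kappa> v) = (v $ i) *\<^sub>C \<kappa> v"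
    using L' by auto
qed

section \<open>Similarity to the adjoint multiplication tuple\<close>

text \<open>The joint kernels are one-dimensional, so a nonvanishing section spans each of them.\<close>

lemma cowen_douglas_section_dense:
  fixes t :: "complex ^ 'm::finite \<Rightarrow> 'h::complex_hilbert"
  assumes cd: "cowen_douglas 1 \<Omega> T" and t: "\<And>w. w \<in> \<Omega> \<Longrightarrow> t w \<in> joint_kernel T w" "\<And>w. w \<in> \<Omega> \<Longrightarrow> t w \<noteq> 0"
  shows "closure (complex_vector.span (t ` \<Omega>)) = UNIV"
proof -
  have "joint_kernel T w \<subseteq> complex_vector.span (t ` \<Omega>)" if w: "w \<in> \<Omega>" for w
  proof -
    have dim: "complex_vector.dim (joint_kernel T w) = 1"
      using cd w by (simp add: cowen_douglas_def)
    obtain B where B: "B \<subseteq> joint_kernel T w" "joint_kernel T w \<subseteq> complex_vector.span B"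
        "card B = complex_vector.dim (joint_kernel T w)"
      using complex_vector.basis_exists[of "joint_kernel T w"] by metis
    then obtain b where b: "B = {b}" using dim by (metis card_1_singletonE)
    have "t w \<in> complex_vector.span {b}" using t(1)[OF w] B(2) b by blast
    then obtain c where c: "t w = c *\<^sub>C b" by (auto simp: complex_vector.span_singleton)
    with t(2)[OF w] have "c \<noteq> 0" by auto
    then have "b = inverse c *\<^sub>C t w" by (simp add: c scaleC_scaleC scaleC_one)
    then have "b \<in> complex_vector.span (t ` \<Omega>)"
      using w by (metis complex_vector.span_base complex_vector.span_scale image_eqI)
    then have "complex_vector.span B \<subseteq> complex_vector.span (t ` \<Omega>)"
      unfolding b by (intro complex_vector.span_minimal complex_vector.subspace_span) simp
    then show ?thesis using B(2) by blast
  qed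
  then have "complex_vector.span (\<Union>w\<in>\<Omega>. joint_kernel T w) \<subseteq> complex_vector.span (t ` \<Omega>)"
    by (intro complex_vector.span_minimal complex_vector.subspace_span) blast
  then have "closure (complex_vector.span (\<Union>w\<in>\<Omega>. joint_kernel T w)) \<subseteq> closure (complex_vector.span (t ` \<Omega>))"
    by (rule closure_mono)
  then show ?thesis using cd by (auto simp: cowen_douglas_def)
qed

text \<open>The tail condition makes \<open>h \<mapsto> \<Sum>i. e i \<otimes> D (e i (T\<^sup>*))\<^sup>* h\<close> an isometry, and this
  isometry sends \<open>t w\<close> to \<open>\<kappa> w \<otimes> D (t w)\<close>.\<close>

lemma eigensection_gram:
  fixes T :: "'m::finite \<Rightarrow> 'h::complex_hilbert \<Rightarrow> 'h" and ev :: "'b::complex_hilbert \<Rightarrow> complex ^ 'm \<Rightarrow> complex"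
    and \<kappa> :: "complex ^ 'm \<Rightarrow> 'b"
  assumes T: "\<And>i. bounded_clinear (T i)" "\<And>i j. T i \<circ> T j = T j \<circ> T i"
    and pos: "positive_operator (inverse_kernel_operator k T)"
    and e: "orthonormal_basis e" and p: "\<And>i z. z \<in> ball 0 1 \<Longrightarrow> ev (e i) z = poly_value (p i) z"
    and tail: "\<And>h. (\<lambda>j. tail_operator k p j T h) \<longlonglongrightarrow> 0"
    and \<kappa>_ev: "\<And>v f. v \<in> ball 0 1 \<Longrightarrow> ev f (cnj_vec v) = cinner f (\<kappa> v)"
    and u: "u \<in> ball 0 1" "x \<in> joint_kernel T u" and v: "v \<in> ball 0 1" "y \<in> joint_kernel T v"
  defines "D \<equiv> defect_operator k T"
  shows "cinner x y = cinner (D x) (D y) * cinner (\<kappa> u) (\<kappa> v)"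
proof -
  have D: "bounded_clinear D"
    unfolding D_def defect_operator_def by (rule positive_operatorD(1)[OF sqrt_operator_positive_square(1)[OF pos]])
  have p_val: "poly_value (p i) (cnj_vec w) = cinner (e i) (\<kappa> w)" if "w \<in> ball 0 1" for i w
  proof -
    have "cnj_vec w \<in> ball 0 1" using that by simp
    then show ?thesis using p[of "cnj_vec w" i] \<kappa>_ev[OF that] by simp
  qed
  let ?P = "\<lambda>i. cadjoint (poly_operator (p i) (adjoint_tuple T))"
  have "cinner (D (?P i x)) (D (?P i y)) = cinner (D x) (D y) * (cinner (\<kappa> u) (e i) * cinner (e i) (\<kappa> v))" for i
  proof -
    have "cinner (\<kappa> u) (e i) = cnj (cinner (e i) (\<kappa> u))" by (rule cinner_commute)
    then show ?thesis
      by (simp add: cadjoint_poly_operator_eigenvector[OF T u(2)] cadjoint_poly_operator_eigenvector[OF T v(2)]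
          p_val[OF u(1)] p_val[OF v(1)] bounded_clinearD(3)[OF D] cinner_scaleC_left cinner_scaleC_right)
  qed
  then have "(\<lambda>j. cinner (D x) (D y) * (\<Sum>i<j. cinner (\<kappa> u) (e i) * cinner (e i) (\<kappa> v))) \<longlonglongrightarrow> cinner x y"
    using tail_operator_expansion[OF T pos tail[of x], of y] by (simp add: D_def sum_distrib_left)
  moreover have "(\<lambda>j. cinner (D x) (D y) * (\<Sum>i<j. cinner (\<kappa> u) (e i) * cinner (e i) (\<kappa> v))) \<longlonglongrightarrow>
      cinner (D x) (D y) * cinner (\<kappa> u) (\<kappa> v)"
    by (intro tendsto_mult tendsto_const orthonormal_basis_parseval e)
  ultimately show ?thesis by (rule LIMSEQ_unique)
qed

theorem theorem1p3:
  fixes T :: "'m::finite \<Rightarrow> 'h::complex_hilbert \<Rightarrow> 'h"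
    and k :: nat
    and ev :: "'b::complex_hilbert \<Rightarrow> complex ^ 'm \<Rightarrow> complex"
    and e :: "nat \<Rightarrow> 'b"
    and p :: "nat \<Rightarrow> 'm polynomial"
    and t :: "complex ^ 'm \<Rightarrow> 'h"
    and \<zeta>0 :: 'h
  assumes "separable_space (euclidean :: 'h topology)"
    and "cowen_douglas 1 (ball 0 1) T"
    and "k > CARD('m) + 1"
    and "is_ball_space k ev"
    and "positive_operator (inverse_kernel_operator k T)"
    and "orthonormal_basis e"
    and "\<And>i z. z \<in> ball 0 1 \<Longrightarrow> ev (e i) z = poly_value (p i) z"
    and "\<And>h. (\<lambda>j. tail_operator k p j T h) \<longlonglongrightarrow> 0"
    and "holomorphic_eigensection (ball 0 1) T t"
    and "\<And>w. w \<in> ball 0 1 \<Longrightarrow> t w \<noteq> 0"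
    and "\<zeta>0 \<in> closure (range (defect_operator k T))"
    and "norm \<zeta>0 = 1"
    and "\<And>w. w \<in> ball 0 1 \<Longrightarrow> cinner (defect_operator k T (t w)) \<zeta>0 \<noteq> 0"
    and "bdd_above ((\<lambda>w. (norm (defect_operator k T (t w)))\<^sup>2 /
            (cmod (cinner (defect_operator k T (t w)) \<zeta>0))\<^sup>2) ` ball 0 1)"
  shows "similar_tuples T (adjoint_tuple (coordinate_mult ev))"
proof -
  let ?B = "ball 0 1 :: (complex ^ 'm) set"
  have T: "\<And>i. bounded_clinear (T i)" "\<And>i j. T i \<circ> T j = T j \<circ> T i"
    using assms(2) by (simp_all add: cowen_douglas_def)
  have k: "k > CARD('m)" using assms(3) by simp
  have t_hol: "holomorphic_map_on t ?B" and t_ker: "\<And>w. w \<in> ?B \<Longrightarrow> t w \<in> joint_kernel T w"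
    using assms(9) by (simp_all add: holomorphic_eigensection_def)
  obtain \<kappa> :: "complex ^ 'm \<Rightarrow> 'b" where
    \<kappa>_ev: "\<And>v f. v \<in> ?B \<Longrightarrow> ev f (cnj_vec v) = cinner f (\<kappa> v)"
    and \<kappa>_inner: "\<And>u v. u \<in> ?B \<Longrightarrow> v \<in> ?B \<Longrightarrow> cinner (\<kappa> u) (\<kappa> v) = ball_kernel k u v"
    and \<kappa>_dense: "closure (complex_vector.span (\<kappa> ` ?B)) = UNIV"
    using ball_space_kernel_functions[OF assms(4)] by blast
  define L where "L i = adjoint_tuple (coordinate_mult ev) i" for i
  have L: "bounded_clinear (L i)" "\<And>v. v \<in> ?B \<Longrightarrow> L i (\<kappa> v) = (v $ i) *\<^sub>C \<kappa> v" for i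
    using adjoint_coordinate_mult[OF assms(4) k \<kappa>_ev \<kappa>_inner \<kappa>_dense] unfolding L_def by blast+
  define D where "D = defect_operator k T"
  have D: "bounded_clinear D"
    unfolding D_def defect_operator_def
    by (rule positive_operatorD(1)[OF sqrt_operator_positive_square(1)[OF assms(5)]])
  have gram: "cinner (t u) (t v) = cinner (D (t u)) (D (t v)) * cinner (\<kappa> u) (\<kappa> v)"
    if "u \<in> ?B" "v \<in> ?B" for u v
    unfolding D_def
    by (rule eigensection_gram[OF T assms(5,6,7,8) \<kappa>_ev that(1) t_ker[OF that(1)] that(2) t_ker[OF that(2)]])
  have t_dense: "closure (complex_vector.span (t ` ?B)) = UNIV"
    by (rule cowen_douglas_section_dense[OF assms(2) t_ker assms(10)])
  define q where "q w = cinner (D (t w)) \<zeta>0" for w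
  have q0: "q w \<noteq> 0" if "w \<in> ?B" for w using assms(13)[OF that] by (simp add: q_def D_def)
  define g where "g w = (1 / q w) *\<^sub>C D (t w)" for w
  have Dt_hol: "holomorphic_map_on (\<lambda>w. D (t w)) ?B"
    by (rule holomorphic_map_on_clinear_compose[OF D t_hol])
  have "holomorphic_map_on q ?B"
    unfolding q_def[abs_def] by (rule holomorphic_map_on_clinear_compose[OF bounded_clinear_cinner_left Dt_hol])
  then have "holomorphic_map_on (\<lambda>w. 1 / q w) ?B"
    by (rule holomorphic_map_on_scalar_compose[where T = "- {0}" and g = "\<lambda>x. 1 / x"])
      (auto intro!: holomorphic_intros simp: q0 simp del: mem_ball mem_ball_0)
  then have g_hol: "holomorphic_map_on g ?B"
    unfolding g_def[abs_def] by (rule holomorphic_map_on_scaleC[OF _ Dt_hol])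
  obtain M where "\<forall>w\<in>?B. (norm (D (t w)))\<^sup>2 / (cmod (q w))\<^sup>2 \<le> M"
    using assms(14) by (auto simp: bdd_above_def q_def D_def)
  then have M: "(norm (D (t w)))\<^sup>2 / (cmod (q w))\<^sup>2 \<le> M" if "w \<in> ?B" for w
    using that by blast
  have g_bound: "norm (g w) \<le> sqrt M" if "norm w < 1" for w
  proof (rule real_le_rsqrt)
    show "(norm (g w))\<^sup>2 \<le> M"
      using M[of w] that by (simp add: g_def norm_scaleC norm_divide power_divide power_mult_distrib)
  qed
  \<comment> \<open>by \<open>gram\<close> the required inequality is the multiplier bound for \<open>g\<close>\<close>
  have "\<exists>Y. bounded_clinear Y \<and> (\<forall>w\<in>?B. Y (\<kappa> w) = (1 / q w) *\<^sub>C t w)"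
  proof (rule bounded_clinear_extension[OF \<kappa>_dense, of _ "\<bar>sqrt M\<bar>"])
    fix J :: "(complex ^ 'm) set" and c
    assume J: "finite J" "J \<subseteq> ?B"
    have JB: "u \<in> ?B" if "u \<in> J" for u using J(2) that by blast
    have "(norm (\<Sum>w\<in>J. c w *\<^sub>C (1 / q w) *\<^sub>C t w))\<^sup>2 =
        Re (\<Sum>u\<in>J. \<Sum>v\<in>J. c u * cnj (c v) * cinner (g u) (g v) * ball_kernel k u v)"
      unfolding norm_linear_combination_squared
      by (intro arg_cong[where f = Re] sum.cong refl)
        (simp add: cinner_scaleC_left cinner_scaleC_right g_def gram JB \<kappa>_inner
          del: mem_ball mem_ball_0)
    also have "\<dots> \<le> (sqrt M)\<^sup>2 * Re (\<Sum>u\<in>J. \<Sum>v\<in>J. c u * cnj (c v) * ball_kernel k u v)"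
      by (rule multiplier_bound[OF g_hol g_bound J k])
    also have "Re (\<Sum>u\<in>J. \<Sum>v\<in>J. c u * cnj (c v) * ball_kernel k u v) = (norm (\<Sum>w\<in>J. c w *\<^sub>C \<kappa> w))\<^sup>2"
      unfolding norm_linear_combination_squared
      by (intro arg_cong[where f = Re] sum.cong refl) (simp add: \<kappa>_inner JB del: mem_ball mem_ball_0)
    finally have "(norm (\<Sum>w\<in>J. c w *\<^sub>C (1 / q w) *\<^sub>C t w))\<^sup>2 \<le> (\<bar>sqrt M\<bar> * norm (\<Sum>w\<in>J. c w *\<^sub>C \<kappa> w))\<^sup>2"
      by (simp only: power_mult_distrib power2_abs)
    then show "norm (\<Sum>w\<in>J. c w *\<^sub>C (1 / q w) *\<^sub>C t w) \<le> \<bar>sqrt M\<bar> * norm (\<Sum>w\<in>J. c w *\<^sub>C \<kappa> w)"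
      by (rule power2_le_imp_le) simp
  qed
  then obtain Y where Y: "bounded_clinear Y" "\<And>w. w \<in> ?B \<Longrightarrow> Y (\<kappa> w) = (1 / q w) *\<^sub>C t w" by blast
  have "\<exists>X. bounded_clinear X \<and> (\<forall>w\<in>?B. X (t w) = q w *\<^sub>C \<kappa> w)"
  proof (rule bounded_clinear_extension[OF t_dense, of _ 1])
    fix J :: "(complex ^ 'm) set" and c
    assume J: "finite J" "J \<subseteq> ?B"
    have JB: "u \<in> ?B" if "u \<in> J" for u using J(2) that by blast
    \<comment> \<open>the part of \<open>D (t w)\<close> orthogonal to \<open>\<zeta>0\<close>; times that of \<open>\<kappa>\<close>, its Gram matrix is the loss of norm under \<open>X\<close>\<close>
    define y where "y w = D (t w) - q w *\<^sub>C \<zeta>0" for w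
    have y: "cinner (y u) (y v) = cinner (D (t u)) (D (t v)) - q u * cnj (q v)" for u v
    proof -
      have "cinner \<zeta>0 \<zeta>0 = 1" using assms(12) by (simp add: cinner_self)
      moreover have "cinner \<zeta>0 (D (t v)) = cnj (q v)" unfolding q_def by (rule cinner_commute)
      ultimately show ?thesis
        by (simp add: y_def cinner_diff_left cinner_diff_right cinner_scaleC_left cinner_scaleC_right
            q_def[symmetric])
    qed
    have "0 \<le> Re (\<Sum>u\<in>J. \<Sum>v\<in>J. c u * cnj (c v) * cinner (y u) (y v) * cinner (\<kappa> u) (\<kappa> v))"
      by (rule gram_product_nonneg[OF assms(6)])
    also have "(\<Sum>u\<in>J. \<Sum>v\<in>J. c u * cnj (c v) * cinner (y u) (y v) * cinner (\<kappa> u) (\<kappa> v)) =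
        (\<Sum>u\<in>J. \<Sum>v\<in>J. c u * cnj (c v) * cinner (t u) (t v)) -
        (\<Sum>u\<in>J. \<Sum>v\<in>J. c u * cnj (c v) * cinner (q u *\<^sub>C \<kappa> u) (q v *\<^sub>C \<kappa> v))"
      unfolding sum_subtractf[symmetric]
      by (intro sum.cong refl) (simp add: y gram JB cinner_scaleC_left cinner_scaleC_right algebra_simps
          del: mem_ball mem_ball_0)
    finally have "(norm (\<Sum>w\<in>J. c w *\<^sub>C q w *\<^sub>C \<kappa> w))\<^sup>2 \<le> (norm (\<Sum>w\<in>J. c w *\<^sub>C t w))\<^sup>2"
      unfolding norm_linear_combination_squared by (simp only: minus_complex.sel diff_ge_0_iff_ge)
    then show "norm (\<Sum>w\<in>J. c w *\<^sub>C q w *\<^sub>C \<kappa> w) \<le> 1 * norm (\<Sum>w\<in>J. c w *\<^sub>C t w)"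
      unfolding mult_1_left by (rule power2_le_imp_le) simp
  qed
  then obtain X where X: "bounded_clinear X" "\<And>w. w \<in> ?B \<Longrightarrow> X (t w) = q w *\<^sub>C \<kappa> w" by blast
  note XD = bounded_clinearD[OF X(1)] and YD = bounded_clinearD[OF Y(1)]
  have id: "bounded_clinear (id :: 'z::complex_inner \<Rightarrow> 'z)"
    by (rule bounded_clinearI[where K = 1]) auto
  have "Y \<circ> X = id"
    by (rule bounded_clinear_eq_on_dense[OF bounded_clinear_compose[OF Y(1) X(1)] id t_dense])
      (auto simp: X(2) Y(2) YD(3) scaleC_scaleC scaleC_one q0 simp del: mem_ball mem_ball_0)
  moreover have "X \<circ> Y = id"
    by (rule bounded_clinear_eq_on_dense[OF bounded_clinear_compose[OF X(1) Y(1)] id \<kappa>_dense])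
      (auto simp: X(2) Y(2) XD(3) scaleC_scaleC scaleC_one q0 simp del: mem_ball mem_ball_0)
  moreover have "X \<circ> T i = L i \<circ> X" for i
  proof (rule bounded_clinear_eq_on_dense[OF bounded_clinear_compose[OF X(1) T(1)]
        bounded_clinear_compose[OF L(1) X(1)] t_dense])
    fix s assume "s \<in> t ` ?B"
    then obtain w where w: "w \<in> ?B" "s = t w" by blast
    have "T i (t w) = (w $ i) *\<^sub>C t w" using t_ker[OF w(1)] by (simp add: joint_kernel_eigenvector)
    then show "(X \<circ> T i) s = (L i \<circ> X) s"
      by (simp add: w(2) X(2)[OF w(1)] L(2)[OF w(1)] XD(3) bounded_clinearD(3)[OF L(1)] scaleC_scaleC mult.commute)
  qed
  ultimately show ?thesis
    unfolding similar_tuples_def L_def using X(1) Y(1) by blast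
qed

end
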